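(* Let $(x,v)\in C_0([0,T],U)\times\mathcal{S}_T$ be such that $x$ has finite quadratic variation along the sequence of subdivisions $\pi_n=(0=t^n_0\le t^n_1\le\dots\le t^n_{k(n)}=T)$, and $\sup_{t\in[0,T]\setminus\pi_n}|v(t)-v(t-)|\to 0$ as $n\to\infty$. Denote $$x^n(t)=\sum_{i=0}^{k(n)-1}x(t^n_{i+1})1_{[t^n_i,t^n_{i+1})}(t)+x(T)1_{\{T\}}(t),\qquad v^n(t)=\sum_{i=0}^{k(n)-1}v(t^n_i)1_{[t^n_i,t^n_{i+1})}(t)+v(T)1_{\{T\}}(t).$$ Then for any non-anticipative functional $F\in\mathbb{C}^{1,2}$ that is predictable in the second variable (i.e. $F_t(x_t,v_t)=F_t(x_t,v_{t-})$ for all $t\le T$ and all $(x,v)\in\mathcal{U}_t\times\mathcal{S}_t$) and satisfies 1. $F,\nabla_xF,\nabla_x^2F\in\mathbb{F}^\infty_l$; 2. $\nabla_x^2F$ and $\mathcal{D}F$ satisfy the local boundedness property; the limit $$\int_0^T\nabla_xF(x_u,v_u)\,d^\pi x:=\lim_{n\to\infty}\sum_{i=0}^{k(n)-1}\nabla_xF_{t^n_i}(x^n_{t^n_i-},v^n_{t^n_i-})\,(x(t^n_{i+1})-x(t^n_i))$$ exists, and $$F_T(x_T,v_T)-F_0(x_0,v_0)=\int_0^T\mathcal{D}_uF(x_u,v_u)\,du+\int_0^T\frac12\mathrm{tr}\left({}^t\nabla_x^2F_u(x_u,v_u)\,d[x](u)\right)+\int_0^T\nabla_xF(x_u,v_u)\,d^\pi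 x.$$
   Context: Spaces. $T>0$, $U\subset\mathbb{R}^d$ is open, $S\subset\mathbb{R}^m$ is Borel. $\mathcal{U}_t=D([0,t],U)$ is the set of right-continuous functions $[0,t]\to U$ with left limits, all left limits lying in $U$; $\mathcal{S}_t=D([0,t],S)$ is defined likewise with $S$. $C_0([0,T],U)$ is the set of continuous $U$-valued functions on $[0,T]$. Path notation. For a path $x$, $x(t)$ is its value at $t$ and $x_t=x|_{[0,t]}$ its restriction. $x_{t-}$ is the path on $[0,t]$ with $x_{t-}(u)=x(u)$ for $u<t$ and $x_{t-}(t)=x(t-)$. For $h\ge0$ the horizontal extension $x_{t,h}$ of $x_t$ to $[0,t+h]$ is $x_{t,h}(u)=x(u)$ for $u\le t$, $x_{t,h}(u)=x(t)$ for $u\in(t,t+h]$. For small $e\in\mathbb{R}^d$ the vertical perturbation $x_t^e$ is $x_t^e(u)=x_t(u)+e\,1_{u=t}$ on $[0,t]$. At time $0$ conventions: $v^n_{0-}=v(0)$ and $x^n_{0-}=x(0)$. Distance. For $(x,v)\in\mathcal{U}_t\times\mathcal{S}_t$ and $(x',v')\in\mathcal{U}_{t+h}\times\mathcal{S}_{t+h}$, $h\ge0$: $d_\infty((x,v),(x',v'))=\sup_{u\in[0,t+h]}|x_{t,h}(u)-x'(u)|+\sup_{u\in[0,t+h]}|v_{t,h}(u)-v'(u)|+h$, and $d_\infty$ is symmetric. Functionals. A non-anticipative functional is a family $F=(F_t)_{t\in[0,T]}$ of maps $F_t:\mathcal{U}_t\times\mathcal{S}_t\to\mathbb{R}$ (vector-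 or matrix-valued, or indexed by $[0,T)$, similarly; conditions are then imposed for $t$ in the index set). It is continuous at fixed times if each $F_t$ is continuous for the supremum norm. $F\in\mathbb{F}^\infty_l$ if for all $t\in[0,T]$, $\epsilon>0$, $(x,v)\in\mathcal{U}_t\times\mathcal{S}_t$ there is $\eta>0$ such that for all $h\in[0,t]$ and $(x',v')\in\mathcal{U}_{t-h}\times\mathcal{S}_{t-h}$: $d_\infty((x,v),(x',v'))<\eta\Rightarrow|F_t(x,v)-F_{t-h}(x',v')|<\epsilon$. Local boundedness property: for every $(x,v)\in\mathcal{U}_T\times\mathcal{S}_T$ there exist $C>0,\eta>0$ such that for all $t$ and all $(x',v')\in\mathcal{U}_t\times\mathcal{S}_t$: $d_\infty((x_t,v_t),(x',v'))<\eta\Rightarrow|F_t(x',v')|\le C$. Derivatives. Horizontal derivative at $(x,v)\in\mathcal{U}_t\times\mathcal{S}_t$, $t<T$: $\mathcal{D}_tF(x,v)=\lim_{h\to0^+}\frac{F_{t+h}(x_{t,h},v_{t,h})-F_t(x,v)}{h}$; $\mathcal{D}F=(\mathcal{D}_tF)_{t\in[0,T)}$. Vertical derivative: $\nabla_xF_t(x,v)$ is the gradient at $e=0$ of $e\mapsto F_t(x_t^e,v_t)$ (assumed differentiable at $0$); $\nabla_xF=(\nabla_xF_t)_t$; $\nabla_x^2F$ is obtained by iterating. (The condition $\nabla_xF,\nabla_x^2F\in\mathbb{F}^\infty_l$ includes that these derivatives exist for $t\in[0,T]$.) $\mathbb{C}^{j,k}$ is the set of functionals $F$ that are continuous at fixed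 times, admit $j$ horizontal and $k$ vertical derivatives at all $(x,v)\in\mathcal{U}_t\times\mathcal{S}_t$, $t\in[0,T)$, and such that $\mathcal{D}^mF$ ($m\le j$) and $\nabla_x^nF$ ($n\le k$) are continuous at fixed times. Quadratic variation. $(\pi_n)$ is a sequence of subdivisions of $[0,T]$ with step size tending to $0$. A continuous $f:[0,T]\to\mathbb{R}$ has finite quadratic variation along $(\pi_n)$ if the measures $\xi^n=\sum_{i=0}^{k(n)-1}(f(t^n_{i+1})-f(t^n_i))^2\delta_{t^n_i}$ converge vaguely to a Radon measure $\xi$ on $[0,T]$ without atoms; then $[f](t)=\xi([0,t])$. $x\in C_0([0,T],U)$ has finite quadratic variation along $(\pi_n)$ if all $x_i$ ($1\le i\le d$) and $x_i+x_j$ ($1\le i<j\le d$) do; then $[x]$ is the function with values in positive symmetric $d\times d$ matrices given by $[x]_{ii}=[x_i]$, $[x]_{ij}=\frac12([x_i+x_j]-[x_i]-[x_j])$ for $i\ne j$. *)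

theory Defs
  imports "HOL-Analysis.Analysis"
begin

text \<open>
  A path on \<open>[0,t]\<close> is an extensional function on \<^term>\<open>{0..t::real}\<close>, so that two paths
  are equal as soon as they agree on \<open>[0,t]\<close>.  The restriction \<open>x\<^sub>t\<close> of a path is
  \<^term>\<open>restrict x {0..t::real}\<close>.
\<close>

definition cadlag_paths :: "real \<Rightarrow> 'a::topological_space set \<Rightarrow> (real \<Rightarrow> 'a) set" where
  "cadlag_paths t A = {x \<in> {0..t} \<rightarrow>\<^sub>E A.
     (\<forall>s\<in>{0..<t}. (x \<longlongrightarrow> x s) (at_right s)) \<and>
     (\<forall>s\<in>{0<..t}. \<exists>l\<in>A. (x \<longlongrightarrow> l) (at_left s))}"

definition continuous_paths :: "real \<Rightarrow> 'a::topological_space set \<Rightarrow> (real \<Rightarrow> 'a) set" where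
  "continuous_paths t A = {x \<in> {0..t} \<rightarrow>\<^sub>E A. continuous_on {0..t} x}"

definition left_lim :: "(real \<Rightarrow> 'a::t2_space) \<Rightarrow> real \<Rightarrow> 'a" where
  "left_lim x t = Lim (at_left t) x"

text \<open>
  \<open>path_minus a t x\<close> is the path \<open>x\<^sub>t\<^sub>-\<close>.  There is no left limit at time 0; the argument \<open>a\<close> is
  the value that the path \<open>x\<^sub>0\<^sub>-\<close> takes by convention.
\<close>

definition path_minus :: "'a::t2_space \<Rightarrow> real \<Rightarrow> (real \<Rightarrow> 'a) \<Rightarrow> real \<Rightarrow> 'a" where
  "path_minus a t x =
     (\<lambda>u\<in>{0..t}. if u < t then x u else if t = 0 then a else left_lim x t)"

definition hor_ext :: "real \<Rightarrow> real \<Rightarrow> (real \<Rightarrow> 'a) \<Rightarrow> real \<Rightarrow> 'a" where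
  "hor_ext t h x = (\<lambda>u\<in>{0..t + h}. if u \<le> t then x u else x t)"

definition vert_pert :: "real \<Rightarrow> 'a::monoid_add \<Rightarrow> (real \<Rightarrow> 'a) \<Rightarrow> real \<Rightarrow> 'a" where
  "vert_pert t e x = (\<lambda>u\<in>{0..t}. x u + (if u = t then e else 0))"

text \<open>
  With \<open>s = max t t'\<close> only the path living on the shorter interval is really extended, which
  makes the distance symmetric by construction.
\<close>

definition d_infty ::
  "real \<Rightarrow> (real \<Rightarrow> 'a::real_normed_vector) \<Rightarrow> (real \<Rightarrow> 'b::real_normed_vector) \<Rightarrow>
   real \<Rightarrow> (real \<Rightarrow> 'a) \<Rightarrow> (real \<Rightarrow> 'b) \<Rightarrow> real" where
  "d_infty t x v t' x' v' = (let s = max t t' in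
     (SUP u\<in>{0..s}. norm (hor_ext t (s - t) x u - hor_ext t' (s - t') x' u)) +
     (SUP u\<in>{0..s}. norm (hor_ext t (s - t) v u - hor_ext t' (s - t') v' u)) +
     \<bar>t - t'\<bar>)"

text \<open>
  The value \<open>F t x v\<close> of a functional matters only for \<open>t\<close> in its index set \<open>I\<close>,
  \<open>x \<in> cadlag_paths t U\<close> and \<open>v \<in> cadlag_paths t S\<close>.
\<close>

type_synonym ('a, 'b, 'c) functional = "real \<Rightarrow> (real \<Rightarrow> 'a) \<Rightarrow> (real \<Rightarrow> 'b) \<Rightarrow> 'c"

text \<open>
  For two pairs of paths on the same interval, \<^const>\<open>d_infty\<close> is the distance of a supremum norm.
\<close>

definition continuous_at_fixed_times ::
  "'a::real_normed_vector set \<Rightarrow> 'b::real_normed_vector set \<Rightarrow> real set \<Rightarrow>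
   ('a, 'b, 'c::real_normed_vector) functional \<Rightarrow> bool" where
  "continuous_at_fixed_times U S I F \<longleftrightarrow>
     (\<forall>t\<in>I. \<forall>x\<in>cadlag_paths t U. \<forall>v\<in>cadlag_paths t S. \<forall>\<epsilon>>0. \<exists>\<eta>>0.
        \<forall>x'\<in>cadlag_paths t U. \<forall>v'\<in>cadlag_paths t S.
          d_infty t x v t x' v' < \<eta> \<longrightarrow> norm (F t x v - F t x' v') < \<epsilon>)"

definition left_continuous_functional ::
  "'a::real_normed_vector set \<Rightarrow> 'b::real_normed_vector set \<Rightarrow> real set \<Rightarrow>
   ('a, 'b, 'c::real_normed_vector) functional \<Rightarrow> bool" where
  "left_continuous_functional U S I F \<longleftrightarrow>
     (\<forall>t\<in>I. \<forall>\<epsilon>>0. \<forall>x\<in>cadlag_paths t U. \<forall>v\<in>cadlag_paths t S. \<exists>\<eta>>0.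
        \<forall>h\<in>{0..t}. \<forall>x'\<in>cadlag_paths (t - h) U. \<forall>v'\<in>cadlag_paths (t - h) S.
          d_infty t x v (t - h) x' v' < \<eta> \<longrightarrow> norm (F t x v - F (t - h) x' v') < \<epsilon>)"

definition locally_bounded_functional ::
  "real \<Rightarrow> 'a::real_normed_vector set \<Rightarrow> 'b::real_normed_vector set \<Rightarrow> real set \<Rightarrow>
   ('a, 'b, 'c::real_normed_vector) functional \<Rightarrow> bool" where
  "locally_bounded_functional T U S I F \<longleftrightarrow>
     (\<forall>x\<in>cadlag_paths T U. \<forall>v\<in>cadlag_paths T S. \<exists>C>0. \<exists>\<eta>>0.
        \<forall>t\<in>I. \<forall>x'\<in>cadlag_paths t U. \<forall>v'\<in>cadlag_paths t S.
          d_infty t (restrict x {0..t}) (restrict v {0..t}) t x' v' < \<eta> \<longrightarrow>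
          norm (F t x' v') \<le> C)"

definition predictable_in_second ::
  "'a::topological_space set \<Rightarrow> 'b::t2_space set \<Rightarrow> real set \<Rightarrow>
   ('a, 'b, 'c) functional \<Rightarrow> bool" where
  "predictable_in_second U S I F \<longleftrightarrow>
     (\<forall>t\<in>I. \<forall>x\<in>cadlag_paths t U. \<forall>v\<in>cadlag_paths t S.
        F t x v = F t x (path_minus (v 0) t v))"

definition hor_quotient ::
  "('a, 'b, real) functional \<Rightarrow> real \<Rightarrow> (real \<Rightarrow> 'a) \<Rightarrow> (real \<Rightarrow> 'b) \<Rightarrow> real \<Rightarrow> real" where
  "hor_quotient F t x v h = (F (t + h) (hor_ext t h x) (hor_ext t h v) - F t x v) / h"

definition hor_deriv :: "('a, 'b, real) functional \<Rightarrow> ('a, 'b, real) functional" where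
  "hor_deriv F t x v = Lim (at_right 0) (hor_quotient F t x v)"

definition hor_differentiable ::
  "'a::topological_space set \<Rightarrow> 'b::topological_space set \<Rightarrow> real set \<Rightarrow>
   ('a, 'b, real) functional \<Rightarrow> bool" where
  "hor_differentiable U S I F \<longleftrightarrow>
     (\<forall>t\<in>I. \<forall>x\<in>cadlag_paths t U. \<forall>v\<in>cadlag_paths t S.
        \<exists>D. (hor_quotient F t x v \<longlongrightarrow> D) (at_right 0))"

definition vert_differentiable ::
  "(real^'d) set \<Rightarrow> 'b::topological_space set \<Rightarrow> real set \<Rightarrow>
   (real^'d, 'b, 'c::real_normed_vector) functional \<Rightarrow> bool" where
  "vert_differentiable U S I F \<longleftrightarrow>
     (\<forall>t\<in>I. \<forall>x\<in>cadlag_paths t U. \<forall>v\<in>cadlag_paths t S.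
        (\<lambda>e. F t (vert_pert t e x) v) differentiable (at 0))"

definition vert_grad :: "(real^'d, 'b, real) functional \<Rightarrow> (real^'d, 'b, real^'d) functional" where
  "vert_grad F t x v = (THE D. GDERIV (\<lambda>e. F t (vert_pert t e x) v) 0 :> D)"

text \<open>The second vertical derivative is the Jacobian matrix of the vertical gradient.\<close>

definition vert_hess :: "(real^'d, 'b, real) functional \<Rightarrow> (real^'d, 'b, real^'d^'d) functional" where
  "vert_hess F t x v =
     matrix (frechet_derivative (\<lambda>e. vert_grad F t (vert_pert t e x) v) (at 0))"

text \<open>
  The class of functionals with one horizontal and two vertical derivatives.  The functional
  itself is indexed by \<open>[0,T]\<close>, its derivatives here by \<open>[0,T)\<close>.
\<close>

definition C12_functional ::
  "real \<Rightarrow> (real^'d) set \<Rightarrow> 'b::real_normed_vector set \<Rightarrow> (real^'d, 'b, real) functional \<Rightarrow> bool"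
  where
  "C12_functional T U S F \<longleftrightarrow>
     continuous_at_fixed_times U S {0..T} F \<and>
     hor_differentiable U S {0..<T} F \<and>
     continuous_at_fixed_times U S {0..<T} (hor_deriv F) \<and>
     vert_differentiable U S {0..<T} F \<and>
     continuous_at_fixed_times U S {0..<T} (vert_grad F) \<and>
     vert_differentiable U S {0..<T} (vert_grad F) \<and>
     continuous_at_fixed_times U S {0..<T} (vert_hess F)"

text \<open>
  The \<open>n\<close>-th subdivision is \<open>0 = \<tau> n 0 \<le> \<dots> \<le> \<tau> n (k n) = T\<close>; values \<open>\<tau> n i\<close> with \<open>i > k n\<close>
  are irrelevant.
\<close>

definition subdivisions :: "real \<Rightarrow> (nat \<Rightarrow> nat) \<Rightarrow> (nat \<Rightarrow> nat \<Rightarrow> real) \<Rightarrow> bool" where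
  "subdivisions T k \<tau> \<longleftrightarrow>
     (\<forall>n. \<tau> n 0 = 0 \<and> \<tau> n (k n) = T \<and> (\<forall>i<k n. \<tau> n i \<le> \<tau> n (Suc i))) \<and>
     (\<lambda>n. Max ((\<lambda>i. \<tau> n (Suc i) - \<tau> n i) ` {..<k n})) \<longlonglongrightarrow> 0"

text \<open>
  The measure \<open>\<Sum>i<k n. (f (\<tau> n (Suc i)) - f (\<tau> n i))\<^sup>2 \<delta>(\<tau> n i)\<close> on \<open>[0,T]\<close>, as the image under
  \<open>\<tau> n\<close> of a weighted counting measure on the indices.
\<close>

definition qv_discrete ::
  "real \<Rightarrow> (nat \<Rightarrow> nat) \<Rightarrow> (nat \<Rightarrow> nat \<Rightarrow> real) \<Rightarrow> (real \<Rightarrow> real) \<Rightarrow> nat \<Rightarrow> real measure" where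
  "qv_discrete T k \<tau> f n =
     distr (point_measure {..<k n} (\<lambda>i. ennreal ((f (\<tau> n (Suc i)) - f (\<tau> n i))\<^sup>2)))
       (restrict_space borel {0..T}) (\<tau> n)"

text \<open>
  As \<open>[0,T]\<close> is compact, Radon measures are the finite Borel measures, and all continuous
  functions on \<open>[0,T]\<close> are test functions for vague convergence.
\<close>

definition qv_limit ::
  "real \<Rightarrow> (nat \<Rightarrow> nat) \<Rightarrow> (nat \<Rightarrow> nat \<Rightarrow> real) \<Rightarrow> (real \<Rightarrow> real) \<Rightarrow> real measure \<Rightarrow> bool" where
  "qv_limit T k \<tau> f \<xi> \<longleftrightarrow>
     sets \<xi> = sets (restrict_space borel {0..T}) \<and> finite_measure \<xi> \<and>
     (\<forall>s\<in>{0..T}. emeasure \<xi> {s} = 0) \<and>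
     (\<forall>g::real \<Rightarrow> real. continuous_on {0..T} g \<longrightarrow>
        (\<lambda>n. \<integral>s. g s \<partial>qv_discrete T k \<tau> f n) \<longlonglongrightarrow> (\<integral>s. g s \<partial>\<xi>))"

definition finite_qv ::
  "real \<Rightarrow> (nat \<Rightarrow> nat) \<Rightarrow> (nat \<Rightarrow> nat \<Rightarrow> real) \<Rightarrow> (real \<Rightarrow> real) \<Rightarrow> bool" where
  "finite_qv T k \<tau> f \<longleftrightarrow> (\<exists>\<xi>. qv_limit T k \<tau> f \<xi>)"

text \<open>A finite measure on \<open>[0,T]\<close> is determined by the integrals of continuous functions, so the
  choice below is from at most one measure.\<close>

definition qv_measure ::
  "real \<Rightarrow> (nat \<Rightarrow> nat) \<Rightarrow> (nat \<Rightarrow> nat \<Rightarrow> real) \<Rightarrow> (real \<Rightarrow> real) \<Rightarrow> real measure" where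
  "qv_measure T k \<tau> f = (SOME \<xi>. qv_limit T k \<tau> f \<xi>)"

definition qvar ::
  "real \<Rightarrow> (nat \<Rightarrow> nat) \<Rightarrow> (nat \<Rightarrow> nat \<Rightarrow> real) \<Rightarrow> (real \<Rightarrow> real) \<Rightarrow> real \<Rightarrow> real" where
  "qvar T k \<tau> f t = measure (qv_measure T k \<tau> f) {0..t}"

text \<open>The index type carries no order; \<open>i < j\<close> becomes \<open>i \<noteq> j\<close> because \<open>x\<^sub>i + x\<^sub>j\<close> is symmetric.\<close>

definition finite_qv_vec ::
  "real \<Rightarrow> (nat \<Rightarrow> nat) \<Rightarrow> (nat \<Rightarrow> nat \<Rightarrow> real) \<Rightarrow> (real \<Rightarrow> real^'d) \<Rightarrow> bool" where
  "finite_qv_vec T k \<tau> x \<longleftrightarrow>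
     (\<forall>i. finite_qv T k \<tau> (\<lambda>s. x s $ i)) \<and>
     (\<forall>i j. i \<noteq> j \<longrightarrow> finite_qv T k \<tau> (\<lambda>s. x s $ i + x s $ j))"

definition qvar_matrix ::
  "real \<Rightarrow> (nat \<Rightarrow> nat) \<Rightarrow> (nat \<Rightarrow> nat \<Rightarrow> real) \<Rightarrow> (real \<Rightarrow> real^'d) \<Rightarrow> real \<Rightarrow> real^'d^'d" where
  "qvar_matrix T k \<tau> x t = (\<chi> i j.
     if i = j then qvar T k \<tau> (\<lambda>s. x s $ i) t
     else (qvar T k \<tau> (\<lambda>s. x s $ i + x s $ j) t
           - qvar T k \<tau> (\<lambda>s. x s $ i) t - qvar T k \<tau> (\<lambda>s. x s $ j) t) / 2)"

text \<open>
  Integration against \<open>d[x]\<^sub>i\<^sub>j\<close>, a difference of finite measures for \<open>i \<noteq> j\<close>.  Its distribution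
  function is the corresponding entry of \<^const>\<open>qvar_matrix\<close>, see the lemma below.
\<close>

definition qvar_integrable ::
  "real \<Rightarrow> (nat \<Rightarrow> nat) \<Rightarrow> (nat \<Rightarrow> nat \<Rightarrow> real) \<Rightarrow> (real \<Rightarrow> real^'d) \<Rightarrow> 'd \<Rightarrow> 'd \<Rightarrow>
   (real \<Rightarrow> real) \<Rightarrow> bool" where
  "qvar_integrable T k \<tau> x i j g \<longleftrightarrow>
     integrable (qv_measure T k \<tau> (\<lambda>s. x s $ i)) g \<and>
     integrable (qv_measure T k \<tau> (\<lambda>s. x s $ j)) g \<and>
     (i \<noteq> j \<longrightarrow> integrable (qv_measure T k \<tau> (\<lambda>s. x s $ i + x s $ j)) g)"

definition qvar_integral ::
  "real \<Rightarrow> (nat \<Rightarrow> nat) \<Rightarrow> (nat \<Rightarrow> nat \<Rightarrow> real) \<Rightarrow> (real \<Rightarrow> real^'d) \<Rightarrow> 'd \<Rightarrow> 'd \<Rightarrow>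
   (real \<Rightarrow> real) \<Rightarrow> real" where
  "qvar_integral T k \<tau> x i j g =
     (if i = j then (\<integral>u. g u \<partial>qv_measure T k \<tau> (\<lambda>s. x s $ i))
      else ((\<integral>u. g u \<partial>qv_measure T k \<tau> (\<lambda>s. x s $ i + x s $ j))
            - (\<integral>u. g u \<partial>qv_measure T k \<tau> (\<lambda>s. x s $ i))
            - (\<integral>u. g u \<partial>qv_measure T k \<tau> (\<lambda>s. x s $ j))) / 2)"

lemma space_qv_measure:
  assumes "finite_qv T k \<tau> f"
  shows "space (qv_measure T k \<tau> f) = {0..T}"
proof -
  have "qv_limit T k \<tau> f (qv_measure T k \<tau> f)"
    using assms unfolding finite_qv_def qv_measure_def by (rule someI_ex)
  then have "sets (qv_measure T k \<tau> f) = sets (restrict_space borel {0..T})"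
    by (simp add: qv_limit_def)
  then show ?thesis
    by (auto dest: sets_eq_imp_space_eq simp: space_restrict_space)
qed

lemma qvar_integral_indicator:
  fixes x :: "real \<Rightarrow> real^'d"
  assumes "finite_qv_vec T k \<tau> x" "t \<le> T"
  shows "qvar_integral T k \<tau> x i j (indicator {0..t}) = qvar_matrix T k \<tau> x t $ i $ j"
proof -
  have "{0..t} \<inter> {0..T} = {0..t}"
    using assms(2) by auto
  then show ?thesis
    using assms(1)
    by (auto simp: qvar_integral_def qvar_matrix_def qvar_def finite_qv_vec_def space_qv_measure)
qed

text \<open>\<open>\<integral> tr(\<^sup>tH d[x])\<close>, as \<open>tr(\<^sup>tA B)\<close> is the sum of all \<open>A\<^sub>i\<^sub>j B\<^sub>i\<^sub>j\<close>.\<close>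

definition trace_qvar_integral ::
  "real \<Rightarrow> (nat \<Rightarrow> nat) \<Rightarrow> (nat \<Rightarrow> nat \<Rightarrow> real) \<Rightarrow> (real \<Rightarrow> real^'d) \<Rightarrow>
   (real \<Rightarrow> real^'d^'d) \<Rightarrow> real" where
  "trace_qvar_integral T k \<tau> x H =
     (\<Sum>i\<in>UNIV. \<Sum>j\<in>UNIV. qvar_integral T k \<tau> x i j (\<lambda>u. H u $ i $ j))"

definition x_approx ::
  "real \<Rightarrow> (nat \<Rightarrow> nat) \<Rightarrow> (nat \<Rightarrow> nat \<Rightarrow> real) \<Rightarrow> (real \<Rightarrow> 'a::real_vector) \<Rightarrow> nat \<Rightarrow> real \<Rightarrow> 'a" where
  "x_approx T k \<tau> x n = (\<lambda>t\<in>{0..T}.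
     (\<Sum>i<k n. indicator {\<tau> n i..<\<tau> n (Suc i)} t *\<^sub>R x (\<tau> n (Suc i))) + indicator {T} t *\<^sub>R x T)"

definition v_approx ::
  "real \<Rightarrow> (nat \<Rightarrow> nat) \<Rightarrow> (nat \<Rightarrow> nat \<Rightarrow> real) \<Rightarrow> (real \<Rightarrow> 'a::real_vector) \<Rightarrow> nat \<Rightarrow> real \<Rightarrow> 'a" where
  "v_approx T k \<tau> v n = (\<lambda>t\<in>{0..T}.
     (\<Sum>i<k n. indicator {\<tau> n i..<\<tau> n (Suc i)} t *\<^sub>R v (\<tau> n i)) + indicator {T} t *\<^sub>R v T)"

text \<open>
  At time 0 the path \<open>x\<^sup>n\<^sub>0\<^sub>-\<close> takes the value \<open>x 0\<close>, which in general differs from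
  \<open>x_approx T k \<tau> x n 0\<close>.
\<close>

definition follmer_sum ::
  "real \<Rightarrow> (nat \<Rightarrow> nat) \<Rightarrow> (nat \<Rightarrow> nat \<Rightarrow> real) \<Rightarrow> (real^'d, 'b::real_normed_vector, real) functional \<Rightarrow>
   (real \<Rightarrow> real^'d) \<Rightarrow> (real \<Rightarrow> 'b) \<Rightarrow> nat \<Rightarrow> real" where
  "follmer_sum T k \<tau> F x v n =
     (\<Sum>i<k n. vert_grad F (\<tau> n i)
                 (path_minus (x 0) (\<tau> n i) (x_approx T k \<tau> x n))
                 (path_minus (v 0) (\<tau> n i) (v_approx T k \<tau> v n))
               \<bullet> (x (\<tau> n (Suc i)) - x (\<tau> n i)))"

definition follmer_integral ::
  "real \<Rightarrow> (nat \<Rightarrow> nat) \<Rightarrow> (nat \<Rightarrow> nat \<Rightarrow> real) \<Rightarrow> (real^'d, 'b::real_normed_vector, real) functional \<Rightarrow>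
   (real \<Rightarrow> real^'d) \<Rightarrow> (real \<Rightarrow> 'b) \<Rightarrow> real" where
  "follmer_integral T k \<tau> F x v = lim (follmer_sum T k \<tau> F x v)"

end

theory Submission
  imports Defs
begin

text \<open>
  Write the increment of \<open>F\<close> over a cell \<open>[\<tau>\<^sub>i, \<tau>\<^sub>i\<^sub>+\<^sub>1]\<close> along the step paths \<open>(x\<^sup>n, v\<^sup>n)\<close> as the sum of a
  horizontal increment, in which both paths are frozen, and of the vertical increment caused by the jump
  of \<open>x\<^sup>n\<close> at \<open>\<tau>\<^sub>i\<close>; by predictability the jump of \<open>v\<^sup>n\<close> contributes nothing.  Horizontal increments are
  integrals of the right derivative \<open>DF\<close>, and dominated convergence applies to their sum.  A second
  order Taylor expansion of the vertical increments yields the Follmer sum and sums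
  \<open>\<Sum> a\<^sub>i (\<delta>x\<^sub>i)\<^sup>2\<close> with values \<open>a\<^sub>i\<close> of \<open>\<nabla>\<^sup>2F\<close> at paths close to \<open>(x, v)\<close>.  Since \<open>u \<mapsto> \<nabla>\<^sup>2F(x\<^sub>u, v\<^sub>u)\<close> is
  only left continuous, the latter converge because a left limit property, uniform over nearby paths,
  forces continuity off a countable set, which is null for the atomless quadratic variation.
\<close>

subsection \<open>Right derivatives\<close>

text \<open>The existence of the limit of the Follmer sums is not shown by estimates on the
  gradient: in the exact identity for large \<open>n\<close> every other term converges, so the
  Follmer sums converge by subtraction. The step path \<open>X\<close> takes on each cell the value
  of \<open>x\<close> at the right endpoint. Hence its left limit at \<open>\<tau> n i\<close> is
  \<open>x (\<tau> n i)\<close> and its jump at the start of a nondegenerate cell is the coming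
  increment of \<open>x\<close>, which is what makes the first Taylor term the summand of the
  Follmer sum. The recurrent obstacle is the jump of \<open>v\<close> at a subdivision point:
  \<open>V\<close> is uniformly close to \<open>v\<close>, but the path stopped just before the
  point has not jumped and may stay at a fixed distance from \<open>v\<close>. Predictability of
  \<open>F\<close> passes to its vertical derivatives, so that the stopped path and the restricted
  path may be exchanged, and each estimate uses the one that is close. Horizontal derivatives are
  one-sided limits, which is why a fundamental theorem of calculus for bounded right derivatives of
  continuous functions comes in.\<close>

lemma right_derivative_le:
  fixes f D :: "real \<Rightarrow> real"
  assumes "a \<le> b" and cont: "continuous_on {a..b} f"
    and deriv: "\<And>u. u \<in> {a..<b} \<Longrightarrow> (f has_real_derivative D u) (at_right u)"
    and bound: "\<And>u. u \<in> {a..<b} \<Longrightarrow> D u \<le> C"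
  shows "f b - f a \<le> C * (b - a)"
proof (cases "a = b")
  case False
  \<comment> \<open>The slack \<open>c > C\<close> makes the right derivative at
    \<open>Sup A\<close> strictly smaller than \<open>c\<close>, so the inequality defining
    \<open>A\<close> persists at some point to the right of \<open>Sup A\<close>, which contradicts
    maximality unless \<open>Sup A = b\<close>.\<close>
  have step: "f b - f a \<le> c * (b - a)" if "c > C" for c
  proof -
    define A where "A = {t \<in> {a..b}. f t - f a \<le> c * (t - a)}"
    have "closed A"
      unfolding A_def by (intro continuous_on_closed_Collect_le continuous_intros cont)
    moreover have "a \<in> A" and "bdd_above A"
      using \<open>a \<le> b\<close> by (auto simp: A_def intro!: bdd_aboveI[of _ b])
    ultimately have s: "Sup A \<in> A"
      using closed_contains_Sup[of A] by auto
    have "Sup A = b"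
    proof (rule ccontr)
      assume "Sup A \<noteq> b"
      then have sab: "Sup A \<in> {a..<b}"
        using s by (auto simp: A_def)
      have "((\<lambda>y. (f y - f (Sup A)) / (y - Sup A)) \<longlongrightarrow> D (Sup A)) (at_right (Sup A))"
        using deriv[OF sab] by (simp add: has_field_derivative_iff)
      moreover have "D (Sup A) < c"
        using bound[OF sab] \<open>c > C\<close> by simp
      ultimately have "\<forall>\<^sub>F y in at_right (Sup A). (f y - f (Sup A)) / (y - Sup A) < c"
        by (rule order_tendstoD)
      moreover have "\<forall>\<^sub>F y in at_right (Sup A). y \<in> {Sup A<..<b}"
        using sab by (intro eventually_at_right_real) auto
      ultimately have "\<forall>\<^sub>F y in at_right (Sup A). (f y - f (Sup A)) / (y - Sup A) < c \<and> y \<in> {Sup A<..<b}"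
        by (rule eventually_conj)
      then obtain y where y: "(f y - f (Sup A)) / (y - Sup A) < c" "y \<in> {Sup A<..<b}"
        using eventually_happens'[of "at_right (Sup A)"] by auto
      then have "f y - f (Sup A) < c * (y - Sup A)"
        by (simp add: divide_less_eq)
      moreover have "f (Sup A) - f a \<le> c * (Sup A - a)"
        using s by (simp add: A_def)
      ultimately have "y \<in> A"
        using y sab by (auto simp: A_def algebra_simps)
      then show False
        using y cSup_upper[OF _ \<open>bdd_above A\<close>, of y] by auto
    qed
    then show ?thesis
      using s by (simp add: A_def)
  qed
  show ?thesis
  proof (rule field_le_epsilon)
    fix e :: real
    assume "e > 0"
    have "f b - f a \<le> (C + e / (b - a)) * (b - a)"
      using \<open>e > 0\<close> False \<open>a \<le> b\<close> by (intro step) auto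
    also have "\<dots> = C * (b - a) + e"
      using False by (simp add: field_simps)
    finally show "f b - f a \<le> C * (b - a) + e" .
  qed
qed auto

lemma right_derivative_bound:
  fixes f D :: "real \<Rightarrow> real"
  assumes "a \<le> b" and cont: "continuous_on {a..b} f"
    and deriv: "\<And>u. u \<in> {a..<b} \<Longrightarrow> (f has_real_derivative D u) (at_right u)"
    and bound: "\<And>u. u \<in> {a..<b} \<Longrightarrow> \<bar>D u\<bar> \<le> C"
  shows "\<bar>f b - f a\<bar> \<le> C * (b - a)"
proof -
  have "f b - f a \<le> C * (b - a)"
    using bound by (intro right_derivative_le[OF assms(1) cont deriv]) (auto simp: abs_le_iff)
  moreover have "- f b - (- f a) \<le> C * (b - a)"
    using bound by (intro right_derivative_le[where D = "\<lambda>u. - D u" and f = "\<lambda>u. - f u"])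
      (auto intro!: continuous_intros cont deriv derivative_intros assms simp: abs_le_iff)
  ultimately show ?thesis
    by simp
qed

text \<open>Forward difference quotients of a continuous extension of \<open>f\<close> converge
  pointwise to \<open>D\<close> and are bounded by \<open>C\<close> through the mean value
  inequality above. So \<open>D\<close> is measurable as a limit and dominated convergence applies.
  The integrals of the quotients are explicit: an antiderivative of the extension reduces them to
  difference quotients at the two endpoints.\<close>

lemma right_derivative_integral:
  fixes f D :: "real \<Rightarrow> real"
  assumes "a \<le> b" and cont: "continuous_on {a..b} f"
    and deriv: "\<And>u. u \<in> {a..<b} \<Longrightarrow> (f has_real_derivative D u) (at_right u)"
    and bound: "\<And>u. u \<in> {a..<b} \<Longrightarrow> \<bar>D u\<bar> \<le> C"
  shows "set_integrable lborel {a..<b} D" and "(LBINT u:{a..<b}. D u) = f b - f a"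
proof -
  \<comment> \<open>Constant continuation beyond \<open>[a, b]\<close>: a quotient whose step leaves
    the interval compares \<open>f u\<close> with \<open>f b\<close> over a longer distance, so the
    bound \<open>C\<close> survives.\<close>
  define g where "g u = f (max a (min u b))" for u
  define h where "h m = 1 / real (Suc m)" for m
  define q where "q m u = (g (u + h m) - g u) / h m" for m u
  have h0: "h m > 0" "h m \<le> 1" for m
    by (auto simp: h_def)
  have h_lim: "h \<longlonglongrightarrow> 0"
    unfolding h_def using LIMSEQ_inverse_real_of_nat by (simp add: inverse_eq_divide)
  have gcont: "continuous_on UNIV g"
    unfolding g_def
    by (rule continuous_on_compose2[OF cont]) (use \<open>a \<le> b\<close> in \<open>auto intro!: continuous_intros\<close>)
  have isg: "isCont g u" for u
    using gcont by (simp add: continuous_on_eq_continuous_at)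
  have qcont: "isCont (q m) u" for m u
    unfolding q_def using h0[of m]
    by (intro continuous_intros isCont_o2[OF _ isg]) auto
  have qcont': "continuous_on UNIV (q m)" for m
    using qcont by (simp add: continuous_on_eq_continuous_at)
  have q_bound: "\<bar>q m u\<bar> \<le> C" if u: "u \<in> {a..<b}" for m u
  proof -
    have *: "g (u + h m) = f (min (u + h m) b)" "g u = f u"
      using u h0[of m] by (auto simp: g_def max_def min_def)
    have "\<bar>f (min (u + h m) b) - f u\<bar> \<le> C * (min (u + h m) b - u)"
      using u h0[of m]
      by (intro right_derivative_bound[where D = D] continuous_on_subset[OF cont] deriv bound) auto
    also have "\<dots> \<le> C * h m"
      using bound[OF u] u by (intro mult_left_mono) auto
    finally show ?thesis
      using h0[of m] by (simp add: q_def * field_simps)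
  qed
  have q_lim: "(\<lambda>m. q m u) \<longlonglongrightarrow> D u" if u: "u \<in> {a..<b}" for u
  proof -
    have "((\<lambda>y. (f y - f u) / (y - u)) \<longlongrightarrow> D u) (at_right u)"
      using deriv[OF u] by (simp add: has_field_derivative_iff)
    moreover have "filterlim (\<lambda>m. u + h m) (at_right u) sequentially"
      unfolding filterlim_at using h0 by (auto intro!: tendsto_eq_intros h_lim always_eventually)
        (metis add.right_neutral less_irrefl)
    ultimately have "(\<lambda>m. (f (u + h m) - f u) / (u + h m - u)) \<longlonglongrightarrow> D u"
      by (rule filterlim_compose)
    moreover have "\<forall>\<^sub>F m in sequentially. h m < b - u"
      using order_tendstoD(2)[OF h_lim, of "b - u"] u by auto
    then have "\<forall>\<^sub>F m in sequentially. (f (u + h m) - f u) / (u + h m - u) = q m u"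
    proof eventually_elim
      case (elim m)
      then show ?case
        using u h0[of m] by (auto simp: q_def g_def max_def min_def)
    qed
    ultimately show ?thesis
      by (rule Lim_transform_eventually)
  qed
  define Q where "Q m u = indicator {a..<b} u *\<^sub>R q m u" for m u
  have Q_meas: "Q m \<in> borel_measurable lborel" for m
    unfolding Q_def using borel_measurable_continuous_onI[OF qcont'[of m]] by measurable
  have Q_lim: "(\<lambda>m. Q m u) \<longlonglongrightarrow> indicator {a..<b} u *\<^sub>R D u" for u
    using q_lim[of u] by (cases "u \<in> {a..<b}") (auto simp: Q_def)
  have D_meas: "(\<lambda>u. indicator {a..<b} u *\<^sub>R D u) \<in> borel_measurable lborel"
    using borel_measurable_LIMSEQ_metric[OF Q_meas Q_lim] .
  have dom: "integrable lborel (\<lambda>u. indicator {a..<b} u *\<^sub>R C)"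
    using \<open>a \<le> b\<close> by (intro integrable_scaleR_left) (auto simp: integrable_indicator_iff)
  have Q_dom: "norm (Q m u) \<le> indicator {a..<b} u *\<^sub>R C" for m u
    using q_bound[of u m] by (auto simp: Q_def indicator_def)
  show "set_integrable lborel {a..<b} D"
    unfolding set_integrable_def
    by (intro integrable_dominated_convergence[where s = Q, OF D_meas Q_meas dom] AE_I2 Q_lim Q_dom)
  have I1: "(\<lambda>m. integral\<^sup>L lborel (Q m)) \<longlonglongrightarrow> (LBINT u:{a..<b}. D u)"
    unfolding set_lebesgue_integral_def
    by (intro integral_dominated_convergence[where s = Q, OF D_meas Q_meas dom] AE_I2 Q_lim Q_dom)
  \<comment> \<open>The margins keep all \<open>u\<close> and \<open>u + h m\<close> with
    \<open>u\<close> in \<open>[a, b]\<close> and \<open>h m \<le> 1\<close> in the interior, where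
    \<open>G0\<close> has a two-sided derivative.\<close>
  obtain G0 where G0: "\<And>u. u \<in> {a - 1..b + 2} \<Longrightarrow>
      (G0 has_vector_derivative g u) (at u within {a - 1..b + 2})"
    using antiderivative_continuous[OF continuous_on_subset[OF gcont, of "{a - 1..b + 2}"]] by auto
  have G: "DERIV G0 u :> g u" if "u \<in> {a - 1<..<b + 2}" for u
  proof -
    have "at u within {a - 1..b + 2} = at u"
      using that by (intro at_within_interior) auto
    then show ?thesis
      using G0[of u] that by (simp add: has_real_derivative_iff_has_vector_derivative)
  qed
  have IQ: "integral\<^sup>L lborel (Q m) =
      (G0 (b + h m) - G0 b) / h m - (G0 (a + h m) - G0 a) / h m" for m
  proof -
    have "AE u in lborel. u \<noteq> b"
      by (rule AE_lborel_singleton)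
    then have "integral\<^sup>L lborel (Q m) = (\<integral>u. q m u * indicator {a..b} u \<partial>lborel)"
      using Q_meas borel_measurable_continuous_onI[OF qcont'[of m]]
      by (intro integral_cong_AE) (auto simp: Q_def indicator_def)
    also have "\<dots> = (G0 (b + h m) - G0 b) / h m - (G0 (a + h m) - G0 a) / h m"
    proof (rule integral_FTC_Icc_real[OF \<open>a \<le> b\<close>])
      fix u assume u: "a \<le> u" "u \<le> b"
      show "isCont (q m) u" by (rule qcont)
      have "((\<lambda>y. G0 (y + h m)) has_real_derivative g (u + h m)) (at u)"
        using G[of "u + h m"] u h0[of m] by (simp add: DERIV_shift)
      then show "((\<lambda>y. (G0 (y + h m) - G0 y) / h m) has_real_derivative q m u) (at u)"
        unfolding q_def using G[of u] u h0[of m]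
        by (auto intro!: derivative_eq_intros)
    qed
    finally show ?thesis .
  qed
  have H: "(\<lambda>m. (G0 (c + h m) - G0 c) / h m) \<longlonglongrightarrow> g c" if "c \<in> {a..b}" for c
  proof -
    have "(\<lambda>z. (G0 (c + z) - G0 c) / z) \<midarrow>0\<rightarrow> g c"
      using G[of c] that by (auto simp: DERIV_def)
    moreover have "filterlim h (at 0) sequentially"
      unfolding filterlim_at using h0 h_lim by (auto simp: less_imp_neq intro!: always_eventually)
        (metis less_irrefl)
    ultimately show ?thesis
      by (rule filterlim_compose)
  qed
  have "(\<lambda>m. integral\<^sup>L lborel (Q m)) \<longlonglongrightarrow> g b - g a"
    unfolding IQ using \<open>a \<le> b\<close> by (intro tendsto_diff H) auto
  then show "(LBINT u:{a..<b}. D u) = f b - f a"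
    using LIMSEQ_unique[OF I1] \<open>a \<le> b\<close> by (simp add: g_def)
qed

subsection \<open>Weighted sums converging to an integral\<close>

text \<open>\<open>f\<close> is the pointwise limit of its values at the last grid point of mesh
  \<open>1 / (m + 1)\<close> before \<open>u\<close>. These approximations factor through the
  integers, hence are measurable.\<close>

lemma left_continuous_borel_measurable:
  fixes f :: "real \<Rightarrow> 'a::metric_space"
  assumes left: "\<And>u. u \<in> {0<..T} \<Longrightarrow> (f \<longlongrightarrow> f u) (at_left u)"
  shows "f \<in> borel_measurable (restrict_space borel {0..T})"
proof -
  \<comment> \<open>For \<open>u > 0\<close> the ceiling gives a grid point strictly below
    \<open>u\<close>, as convergence in \<open>at_left u\<close> demands; the clamp makes
    \<open>r m 0 = 0\<close>, so the value at 0 is exact.\<close>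
  define r where "r m u = max 0 ((of_int \<lceil>real (Suc m) * u\<rceil> - 1) / real (Suc m))" for m :: nat and u :: real
  have meas: "(\<lambda>u. f (r m u)) \<in> borel_measurable (restrict_space borel {0..T})" for m
  proof (rule measurable_restrict_space1)
    have "(\<lambda>u::real. \<lceil>real (Suc m) * u\<rceil>) \<in> measurable borel (count_space UNIV)"
      by measurable
    moreover have "(\<lambda>j. f (max 0 ((of_int j - 1) / real (Suc m)))) \<in> measurable (count_space UNIV) borel"
      by simp
    ultimately show "(\<lambda>u. f (r m u)) \<in> borel_measurable borel"
      unfolding r_def by (rule measurable_compose)
  qed
  have "(\<lambda>m. f (r m u)) \<longlonglongrightarrow> f u" if u: "u \<in> {0..T}" for u
  proof (cases "u = 0")
    case False
    then have "u > 0"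
      using u by simp
    have r_less: "r m u < u" and r_ge: "u - 1 / real (Suc m) \<le> r m u" for m
    proof -
      have "of_int \<lceil>real (Suc m) * u\<rceil> - 1 < real (Suc m) * u" "real (Suc m) * u \<le> of_int \<lceil>real (Suc m) * u\<rceil>"
        by linarith+
      then have "(of_int \<lceil>real (Suc m) * u\<rceil> - 1) / real (Suc m) < u"
        "u \<le> of_int \<lceil>real (Suc m) * u\<rceil> / real (Suc m)"
        by (simp_all add: pos_divide_less_eq pos_le_divide_eq mult.commute del: of_nat_Suc)
      then show "r m u < u" "u - 1 / real (Suc m) \<le> r m u"
        using \<open>u > 0\<close> unfolding r_def diff_divide_distrib by linarith+
    qed
    have l: "(\<lambda>m. u - 1 / real (Suc m)) \<longlonglongrightarrow> u"
      using tendsto_diff[OF tendsto_const LIMSEQ_inverse_real_of_nat, of u] by (simp add: inverse_eq_divide)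
    have "(\<lambda>m. r m u) \<longlonglongrightarrow> u"
      by (rule tendsto_sandwich[OF _ _ l tendsto_const]) (use r_less r_ge in \<open>auto intro!: always_eventually less_imp_le\<close>)
    then have "filterlim (\<lambda>m. r m u) (at_left u) sequentially"
      unfolding filterlim_at using r_less by (auto intro!: always_eventually simp: less_imp_neq)
    then show ?thesis
      using u False by (intro filterlim_compose[OF left]) auto
  qed (simp add: r_def)
  then show ?thesis
    by (rule borel_measurable_LIMSEQ_metric[where f = "\<lambda>m u. f (r m u)", OF meas])
      (auto simp: space_restrict_space)
qed

text \<open>
  Left neighbourhoods \<open>(u - \<eta> u, u)\<close> cover all but countably many points, since the uncovered points
  are the right endpoints of disjoint intervals.
\<close>

lemma countable_left_neighbourhoods_uncovered:
  fixes \<eta> :: "real \<Rightarrow> real"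
  assumes "\<And>u. u \<in> I \<Longrightarrow> \<eta> u > 0"
  shows "countable (I - (\<Union>u\<in>I. {u - \<eta> u<..<u}))"
proof -
  define D where "D = I - (\<Union>u\<in>I. {u - \<eta> u<..<u})"
  define J where "J u = {u - \<eta> u<..<u}" for u
  have sep: "s \<le> t - \<eta> t" if "s \<in> D" "t \<in> D" "s < t" for s t
    using that by (fastforce simp: D_def)
  have disj: "disjnt (J s) (J t)" if "s \<in> D" "t \<in> D" "s < t" for s t
    using sep[OF that] by (auto simp: disjnt_def J_def)
  have "inj_on J D"
  proof (rule inj_onI)
    fix s t
    assume st: "s \<in> D" "t \<in> D" "J s = J t"
    have "J s \<noteq> {}"
      using assms[of s] st by (auto simp: J_def D_def intro!: dense)
    then show "s = t"
      using disj[of s t] disj[of t s] st by (auto simp: disjnt_def neq_iff)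
  qed
  moreover have "countable (J ` D)"
  proof (rule countable_disjoint_open_subsets)
    show "pairwise disjnt (J ` D)"
      unfolding pairwise_def by (metis (no_types, lifting) disj disjnt_sym imageE linorder_neqE)
  qed (auto simp: J_def)
  ultimately show ?thesis
    unfolding D_def[symmetric] by (rule countable_image_inj_on[rotated])
qed

text \<open>
  Pointwise convergence of the coefficients \<open>a\<close> to \<open>f\<close> would not suffice: the uniformity in
  left neighbourhoods makes the convergence continuous off a countable, hence \<open>\<xi>\<close>-null, set.  Bump
  functions \<open>h\<close> subordinate to finitely many of these neighbourhoods give a continuous \<open>g\<close> close to
  both \<open>f\<close> and \<open>a\<close>, up to an error that is itself bounded by a continuous function of small integral.
\<close>

lemma weighted_sum_tendsto_integral:
  fixes \<xi> :: "real measure" and f :: "real \<Rightarrow> real" and \<tau> w a :: "nat \<Rightarrow> nat \<Rightarrow> real"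
  assumes "T > 0"
    and sets_xi: "sets \<xi> = sets (restrict_space borel {0..T})" and fin: "finite_measure \<xi>"
    and atomless: "\<And>s. s \<in> {0..T} \<Longrightarrow> emeasure \<xi> {s} = 0"
    and conv: "\<And>g. continuous_on {0..T} g \<Longrightarrow>
       (\<lambda>n. \<Sum>i<k n. g (\<tau> n i) * w n i) \<longlonglongrightarrow> (\<integral>s. g s \<partial>\<xi>)"
    and w_nonneg: "\<And>n i. w n i \<ge> 0"
    and tau: "\<And>n i. i < k n \<Longrightarrow> \<tau> n i \<in> {0..T}"
    and f_bound: "\<And>u. u \<in> {0..T} \<Longrightarrow> \<bar>f u\<bar> \<le> C"
    and a_bound: "\<And>n i. n \<ge> N \<Longrightarrow> i < k n \<Longrightarrow> \<bar>a n i\<bar> \<le> C"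
    and left: "\<And>u e. u \<in> {0<..T} \<Longrightarrow> e > 0 \<Longrightarrow> \<exists>\<eta>>0. \<exists>M.
       (\<forall>t\<in>{0..T}. u - \<eta> < t \<and> t \<le> u \<longrightarrow> \<bar>f t - f u\<bar> \<le> e) \<and>
       (\<forall>n\<ge>M. \<forall>i<k n. u - \<eta> < \<tau> n i \<and> \<tau> n i \<le> u \<longrightarrow> \<bar>a n i - f u\<bar> \<le> e)"
  shows "integrable \<xi> f" and "(\<lambda>n. \<Sum>i<k n. a n i * w n i) \<longlonglongrightarrow> (\<integral>u. f u \<partial>\<xi>)"
proof -
  interpret finite_measure \<xi> by (rule fin)
  have space_xi: "space \<xi> = {0..T}"
    using sets_eq_imp_space_eq[OF sets_xi] by (simp add: space_restrict_space)
  have "(f \<longlongrightarrow> f u) (at_left u)" if u: "u \<in> {0<..T}" for u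
  proof (rule tendstoI)
    fix e :: real
    assume "e > 0"
    then obtain \<eta> where \<eta>: "\<eta> > 0" "\<And>t. t \<in> {0..T} \<Longrightarrow> u - \<eta> < t \<Longrightarrow> t \<le> u \<Longrightarrow> \<bar>f t - f u\<bar> \<le> e / 2"
      using left[OF u, of "e / 2"] by auto
    have "\<forall>\<^sub>F t in at_left u. t \<in> {max 0 (u - \<eta>)<..<u}"
      using u \<eta> by (intro eventually_at_left_real) auto
    then show "\<forall>\<^sub>F t in at_left u. dist (f t) (f u) < e"
    proof eventually_elim
      case (elim t)
      then show ?case
        using \<eta>(2)[of t] u \<open>e > 0\<close> by (auto simp: dist_real_def)
    qed
  qed
  then have "f \<in> borel_measurable (restrict_space borel {0..T})"
    by (rule left_continuous_borel_measurable)
  then have f_meas: "f \<in> borel_measurable \<xi>"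
    using measurable_cong_sets[OF sets_xi refl] by blast
  show f_int: "integrable \<xi> f"
    using f_bound by (intro integrable_const_bound[OF _ f_meas, of C]) (auto simp: space_xi)
  have cont_int: "integrable \<xi> g" if g: "continuous_on {0..T} g" for g :: "real \<Rightarrow> real"
  proof -
    have "g \<in> borel_measurable \<xi>"
      using borel_measurable_continuous_on_restrict[OF g] measurable_cong_sets[OF sets_xi refl] by blast
    moreover obtain B where "\<forall>s\<in>{0..T}. \<bar>g s\<bar> \<le> B"
      using compact_imp_bounded[OF compact_continuous_image[OF g compact_Icc]]
      unfolding bounded_iff by auto
    ultimately show ?thesis
      by (intro integrable_const_bound[of _ B]) (auto simp: space_xi)
  qed
  have C0: "C \<ge> 0"
    using f_bound[of 0] \<open>T > 0\<close> by auto
  have approx: "\<exists>g b M. continuous_on {0..T} g \<and> continuous_on {0..T} b \<and> (\<integral>s. b s \<partial>\<xi>) < e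
      \<and> (\<forall>u\<in>{0..T}. \<bar>f u - g u\<bar> \<le> b u) \<and> (\<forall>n\<ge>M. \<forall>i<k n. \<bar>a n i - g (\<tau> n i)\<bar> \<le> b (\<tau> n i))"
    if "e > 0" for e :: real
  proof -
    define m where "m = measure \<xi> (space \<xi>)"
    \<comment> \<open>About half of \<open>e\<close> is spread over the mass \<open>m\<close> of
      \<open>\<xi>\<close>, where the summand 1 covers \<open>m = 0\<close>. The rest is left to the
      part not yet covered by bumps, whose contribution tends to 0.\<close>
    define d where "d = e / (2 * (m + 1))"
    have m0: "m \<ge> 0"
      by (simp add: m_def)
    have "d > 0"
      using \<open>e > 0\<close> m0 by (simp add: d_def)
    define I where "I = {0<..T}"
    define P where "P u \<eta> M \<longleftrightarrow> \<eta> > 0 \<and>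
       (\<forall>t\<in>{0..T}. u - \<eta> < t \<and> t \<le> u \<longrightarrow> \<bar>f t - f u\<bar> \<le> d) \<and>
       (\<forall>n\<ge>M. \<forall>i<k n. u - \<eta> < \<tau> n i \<and> \<tau> n i \<le> u \<longrightarrow> \<bar>a n i - f u\<bar> \<le> d)" for u \<eta> :: real and M
    have "\<forall>u\<in>I. \<exists>\<eta> M. P u \<eta> M"
      using left[OF _ \<open>d > 0\<close>] unfolding I_def P_def by blast
    then obtain \<eta> M where PM: "\<And>u. u \<in> I \<Longrightarrow> P u (\<eta> u) (M u)"
      by metis
    have \<eta>: "\<And>u. u \<in> I \<Longrightarrow> \<eta> u > 0"
      "\<And>u t. u \<in> I \<Longrightarrow> t \<in> {0..T} \<Longrightarrow> u - \<eta> u < t \<Longrightarrow> t \<le> u \<Longrightarrow> \<bar>f t - f u\<bar> \<le> d"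
      "\<And>u n i. u \<in> I \<Longrightarrow> n \<ge> M u \<Longrightarrow> i < k n \<Longrightarrow> u - \<eta> u < \<tau> n i \<Longrightarrow> \<tau> n i \<le> u \<Longrightarrow> \<bar>a n i - f u\<bar> \<le> d"
      using PM unfolding P_def by blast+
    define J where "J u = {u - \<eta> u<..<u}" for u
    have J_open: "open S" if "S \<in> J ` I" for S
      using that by (auto simp: J_def)
    obtain \<J> where \<J>: "\<J> \<subseteq> J ` I" "countable \<J>" "\<Union>\<J> = \<Union>(J ` I)"
      using Lindelof[of "J ` I", OF J_open] by metis
    \<comment> \<open>\<open>from_nat_into\<close> enumerates \<open>\<J>\<close> only if it is
      nonempty, which the nonempty interval \<open>J T\<close> guarantees.\<close>
    have "J ` I \<noteq> {}" "J T \<noteq> {}"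
      using \<open>T > 0\<close> \<eta>(1)[of T] by (auto simp: I_def J_def intro!: dense)
    moreover have "J T \<subseteq> \<Union>\<J>"
      using \<open>T > 0\<close> unfolding \<J> by (auto simp: I_def)
    ultimately have "\<J> \<noteq> {}"
      by auto
    then have ran: "range (from_nat_into \<J>) = \<J>"
      using \<J>(2) by (rule range_from_nat_into)
    have "\<exists>u\<in>I. from_nat_into \<J> j = J u" for j
      using ran \<J>(1) by blast
    then obtain c where c: "\<And>j. c j \<in> I" "\<And>j. from_nat_into \<J> j = J (c j)"
      by metis
    have cover: "(\<Union>j. J (c j)) = (\<Union>u\<in>I. J u)"
      using ran \<J>(3) unfolding c(2)[symmetric] by (simp add: \<J>)
    define \<phi> where "\<phi> j u = max 0 (min (u - (c j - \<eta> (c j))) (c j - u))" for j u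
    have \<phi>0: "\<phi> j u \<ge> 0" and \<phi>pos: "\<phi> j u > 0 \<longleftrightarrow> u \<in> J (c j)" for j u
      by (auto simp: \<phi>_def J_def)
    \<comment> \<open>A partition of unity without quotients: \<open>s p j\<close> truncates at 1
      the scaled partial sums of the tents \<open>\<phi>\<close>. Its increments
      \<open>h p j\<close> are nonnegative, vanish off \<open>J (c j)\<close> and telescope to
      \<open>s p p \<le> 1\<close>. The factor \<open>p\<close> makes \<open>s p p\<close>
      eventually equal to 1 at every covered point; the deficit \<open>1 - s p p\<close> is paid for
      by the crude bound \<open>C\<close> in \<open>b\<close>.\<close>
    define s where "s p j u = min 1 (real p * (\<Sum>l<j. \<phi> l u))" for p j u
    define h where "h p j u = s p (Suc j) u - s p j u" for p j u
    define g where "g p u = (\<Sum>j<p. f (c j) * h p j u)" for p u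
    define b where "b p u = d + C * (1 - s p p u)" for p u
    have s_cont: "continuous_on A (s p j)" for A p j
      unfolding s_def \<phi>_def by (intro continuous_intros)
    have g_cont: "continuous_on {0..T} (g p)" for p
      unfolding g_def h_def by (intro continuous_intros s_cont)
    have b_cont: "continuous_on {0..T} (b p)" for p
      unfolding b_def by (intro continuous_intros s_cont)
    have s01: "0 \<le> s p j u" "s p j u \<le> 1" for p j u
      using \<phi>0 by (auto simp: s_def intro!: mult_nonneg_nonneg sum_nonneg)
    have h0: "h p j u \<ge> 0" for p j u
    proof -
      have "real p * (\<Sum>l<j. \<phi> l u) \<le> real p * (\<Sum>l<Suc j. \<phi> l u)"
        using \<phi>0 by (intro mult_left_mono) auto
      then show ?thesis
        by (auto simp: h_def s_def)
    qed
    have h_supp: "h p j u = 0" if "u \<notin> J (c j)" for p j u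
      using that \<phi>0[of j u] \<phi>pos[of j u] by (simp add: h_def s_def)
    have h_sum: "(\<Sum>j<p. h p j u) = s p p u" for p u
    proof -
      have "(\<Sum>j<p. s p (Suc j) u - s p j u) = s p p u - s p 0 u"
        by (rule sum_lessThan_telescope)
      then show ?thesis
        unfolding h_def by (simp add: s_def[of p 0])
    qed
    have main: "\<bar>y - g p u\<bar> \<le> b p u"
      if "\<bar>y\<bar> \<le> C" "\<And>j. j < p \<Longrightarrow> u \<in> J (c j) \<Longrightarrow> \<bar>y - f (c j)\<bar> \<le> d" for y p u
    proof -
      have "y - g p u = y * (1 - s p p u) + (\<Sum>j<p. (y - f (c j)) * h p j u)"
      proof -
        have "(\<Sum>j<p. (y - f (c j)) * h p j u) = y * (\<Sum>j<p. h p j u) - g p u"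
          by (simp only: left_diff_distrib sum_subtractf sum_distrib_left g_def)
        then show ?thesis
          unfolding h_sum by (simp add: right_diff_distrib)
      qed
      also have "\<bar>\<dots>\<bar> \<le> \<bar>y * (1 - s p p u)\<bar> + (\<Sum>j<p. \<bar>(y - f (c j)) * h p j u\<bar>)"
        by (intro order_trans[OF abs_triangle_ineq] add_left_mono sum_abs)
      also have "\<dots> \<le> C * (1 - s p p u) + (\<Sum>j<p. d * h p j u)"
      proof (intro add_mono sum_mono)
        show "\<bar>y * (1 - s p p u)\<bar> \<le> C * (1 - s p p u)"
          using that(1) s01[of p p u] by (simp add: abs_mult mult_right_mono)
      next
        fix j
        assume "j \<in> {..<p}"
        then show "\<bar>(y - f (c j)) * h p j u\<bar> \<le> d * h p j u"
          using that(2)[of j] h0[of p j u] h_supp[of u j p]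
          by (cases "u \<in> J (c j)") (auto simp: abs_mult intro!: mult_right_mono)
      qed
      also have "(\<Sum>j<p. d * h p j u) \<le> d"
        using s01[of p p u] \<open>d > 0\<close> by (simp add: sum_distrib_left[symmetric] h_sum mult_left_le)
      finally show ?thesis
        by (simp add: b_def)
    qed
    have "(\<lambda>p. \<integral>u. 1 - s p p u \<partial>\<xi>) \<longlonglongrightarrow> (\<integral>u. 0 \<partial>\<xi>)"
    proof (rule integral_dominated_convergence[where w = "\<lambda>_. 1"])
      have null: "{0..T} - (\<Union>u\<in>I. J u) \<in> null_sets \<xi>"
      proof -
        have sing: "{u} \<in> null_sets \<xi>" if "u \<in> {0..T}" for u
          using atomless[OF that] that by (auto simp: sets_xi sets_restrict_space_iff intro!: null_setsI)
        have "countable (I - (\<Union>u\<in>I. J u))"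
          unfolding J_def by (intro countable_left_neighbourhoods_uncovered \<eta>)
        then have "countable ({0..T} - (\<Union>u\<in>I. J u))"
          by (rule countable_subset[rotated, OF countable_insert[of _ 0]]) (auto simp: I_def)
        then have "(\<Union>v\<in>{0..T} - (\<Union>u\<in>I. J u). {v}) \<in> null_sets \<xi>"
          by (intro null_sets_UN' sing) auto
        then show ?thesis
          by simp
      qed
      have "AE u in \<xi>. u \<in> (\<Union>u\<in>I. J u)"
        using AE_not_in[OF null] AE_space by eventually_elim (auto simp: space_xi)
      then show "AE u in \<xi>. (\<lambda>p. 1 - s p p u) \<longlonglongrightarrow> 0"
      proof eventually_elim
        case (elim u)
        then obtain j where j: "u \<in> J (c j)"
          using cover by blast
        \<comment> \<open>\<open>p > j\<close> puts the tent of \<open>j\<close> into the sum, and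
          the second bound makes \<open>p\<close> times that tent at least 1.\<close>
        define p0 where "p0 = max (Suc j) (nat \<lceil>1 / \<phi> j u\<rceil>)"
        have "s p p u = 1" if "p \<ge> p0" for p
        proof -
          have "1 / \<phi> j u \<le> real p"
            using that unfolding p0_def by linarith
          then have "1 \<le> real p * \<phi> j u"
            using \<phi>pos[of j u] j by (simp add: field_simps)
          also have "\<dots> \<le> real p * (\<Sum>l<p. \<phi> l u)"
            using that \<phi>0 by (intro mult_left_mono member_le_sum) (auto simp: p0_def)
          finally show ?thesis
            by (simp add: s_def)
        qed
        then have "\<forall>\<^sub>F p in sequentially. 0 = 1 - s p p u"
          by (auto intro: eventually_sequentiallyI[of p0])
        then show ?case
          by (rule Lim_transform_eventually[OF tendsto_const])
      qed
    next
      show "(\<lambda>u. 1 - s p p u) \<in> borel_measurable \<xi>" for p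
        by (intro borel_measurable_integrable cont_int continuous_on_diff continuous_on_const s_cont)
      show "AE u in \<xi>. norm (1 - s p p u) \<le> 1" for p
        using s01 by (intro AE_I2) auto
    qed simp_all
    then have "(\<lambda>p. \<integral>u. 1 - s p p u \<partial>\<xi>) \<longlonglongrightarrow> 0"
      by simp
    from tendsto_add[OF tendsto_const[of "d * m"] tendsto_mult[OF tendsto_const[of C] this]]
    have "(\<lambda>p. d * m + C * (\<integral>u. 1 - s p p u \<partial>\<xi>)) \<longlonglongrightarrow> d * m"
      by simp
    moreover have "d * m < e"
    proof -
      have "d * m = e * (m / (2 * (m + 1)))"
        by (simp add: d_def)
      also have "\<dots> < e * 1"
        using m0 \<open>e > 0\<close> by (intro mult_strict_left_mono) (auto simp: field_simps)
      finally show ?thesis by simp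
    qed
    ultimately have "\<forall>\<^sub>F p in sequentially. d * m + C * (\<integral>u. 1 - s p p u \<partial>\<xi>) < e"
      by (rule order_tendstoD)
    then obtain p where p: "d * m + C * (\<integral>u. 1 - s p p u \<partial>\<xi>) < e"
      by (auto simp: eventually_sequentially)
    have b_int: "(\<integral>u. b p u \<partial>\<xi>) = d * m + C * (\<integral>u. 1 - s p p u \<partial>\<xi>)"
      unfolding b_def m_def
      by (subst Bochner_Integration.integral_add)
        (simp_all add: cont_int continuous_on_diff continuous_on_mult_left s_cont)
    show ?thesis
    proof (intro exI conjI allI ballI impI)
      show "continuous_on {0..T} (g p)" "continuous_on {0..T} (b p)" by fact+
      show "(\<integral>u. b p u \<partial>\<xi>) < e"
        using p by (simp add: b_int)
      show "\<bar>f u - g p u\<bar> \<le> b p u" if "u \<in> {0..T}" for u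
        using \<eta>(2)[OF c(1) that] that by (intro main f_bound) (auto simp: J_def)
      \<comment> \<open>Only the finitely many intervals used by \<open>g p\<close> have thresholds
        to respect; \<open>insert 0\<close> covers \<open>p = 0\<close>.\<close>
      show "\<bar>a n i - g p (\<tau> n i)\<bar> \<le> b p (\<tau> n i)"
        if n: "n \<ge> max N (Max (insert 0 (M ` c ` {..<p})))" and "i < k n" for n i
      proof (rule main)
        fix j
        assume "j < p" "\<tau> n i \<in> J (c j)"
        have "M (c j) \<le> n"
          using n \<open>j < p\<close> by (auto simp: Max_le_iff)
        then show "\<bar>a n i - f (c j)\<bar> \<le> d"
          using \<eta>(3)[OF c(1), of j n i] \<open>i < k n\<close> \<open>\<tau> n i \<in> J (c j)\<close> by (auto simp: J_def)
      qed (use n \<open>i < k n\<close> a_bound in auto)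
    qed
  qed
  show "(\<lambda>n. \<Sum>i<k n. a n i * w n i) \<longlonglongrightarrow> (\<integral>u. f u \<partial>\<xi>)"
  proof (rule tendstoI)
    fix e :: real
    assume "e > 0"
    then have "e / 3 > 0"
      by simp
    from approx[OF this] obtain g b M where g: "continuous_on {0..T} g" and b: "continuous_on {0..T} b"
      and b_int: "(\<integral>s. b s \<partial>\<xi>) < e / 3"
      and fg: "\<forall>u\<in>{0..T}. \<bar>f u - g u\<bar> \<le> b u"
      and ag: "\<forall>n\<ge>M. \<forall>i<k n. \<bar>a n i - g (\<tau> n i)\<bar> \<le> b (\<tau> n i)"
      by blast
    have "\<bar>(\<integral>u. f u \<partial>\<xi>) - (\<integral>u. g u \<partial>\<xi>)\<bar> = \<bar>\<integral>u. f u - g u \<partial>\<xi>\<bar>"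
      using f_int cont_int[OF g] by simp
    also have "\<dots> \<le> (\<integral>u. b u \<partial>\<xi>)"
      using f_int cont_int[OF g] cont_int[OF b] fg
      by (intro order_trans[OF integral_abs_bound] integral_mono) (auto simp: space_xi)
    finally have I: "\<bar>(\<integral>u. f u \<partial>\<xi>) - (\<integral>u. g u \<partial>\<xi>)\<bar> < e / 3"
      using b_int by simp
    \<comment> \<open>The error sums are controlled by the convergence hypothesis itself, applied to
      the continuous bound \<open>b\<close>.\<close>
    have "\<forall>\<^sub>F n in sequentially. (\<Sum>i<k n. b (\<tau> n i) * w n i) < e / 3"
      using order_tendstoD(2)[OF conv[OF b] b_int] .
    moreover have "\<forall>\<^sub>F n in sequentially. dist (\<Sum>i<k n. g (\<tau> n i) * w n i) (\<integral>u. g u \<partial>\<xi>) < e / 3"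
      using tendstoD[OF conv[OF g], of "e / 3"] \<open>e > 0\<close> by simp
    ultimately show "\<forall>\<^sub>F n in sequentially. dist (\<Sum>i<k n. a n i * w n i) (\<integral>u. f u \<partial>\<xi>) < e"
      using eventually_ge_at_top[of M]
    proof eventually_elim
      case (elim n)
      have "\<bar>(\<Sum>i<k n. a n i * w n i) - (\<Sum>i<k n. g (\<tau> n i) * w n i)\<bar>
          = \<bar>\<Sum>i<k n. (a n i - g (\<tau> n i)) * w n i\<bar>"
        by (simp add: sum_subtractf algebra_simps)
      also have "\<dots> \<le> (\<Sum>i<k n. \<bar>(a n i - g (\<tau> n i)) * w n i\<bar>)"
        by (rule sum_abs)
      also have "\<dots> \<le> (\<Sum>i<k n. b (\<tau> n i) * w n i)"
        using ag elim(3) w_nonneg by (intro sum_mono) (auto simp: abs_mult intro!: mult_right_mono)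
      finally show ?case
        using elim I unfolding dist_real_def by linarith
    qed
  qed
qed

subsection \<open>Cadlag paths\<close>

lemma left_limI: "(y \<longlongrightarrow> l) (at_left s) \<Longrightarrow> left_lim y s = l" for s :: real
  unfolding left_lim_def by (rule tendsto_Lim) auto

lemma cadlag_paths_left_lim:
  fixes y :: "real \<Rightarrow> 'a::t2_space"
  assumes "y \<in> cadlag_paths T A" "s \<in> {0<..T}"
  shows "left_lim y s \<in> A" and "(y \<longlongrightarrow> left_lim y s) (at_left s)"
proof -
  obtain l where "l \<in> A" "(y \<longlongrightarrow> l) (at_left s)"
    using assms unfolding cadlag_paths_def by blast
  then show "left_lim y s \<in> A" "(y \<longlongrightarrow> left_lim y s) (at_left s)"
    using left_limI[of y l s] by auto
qed

lemma cadlag_paths_right: "y \<in> cadlag_paths T A \<Longrightarrow> s \<in> {0..<T} \<Longrightarrow> (y \<longlongrightarrow> y s) (at_right s)"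
  by (auto simp: cadlag_paths_def)

lemma cadlag_paths_mem: "y \<in> cadlag_paths T A \<Longrightarrow> s \<in> {0..T} \<Longrightarrow> y s \<in> A"
  by (auto simp: cadlag_paths_def)

text \<open>Changing the value at the right endpoint affects no one-sided limit that counts, as only
  the left limit is taken there. The restriction \<open>x\<^sub>t\<close>, the path
  \<open>x\<^sub>t\<^sub>-\<close> and vertical perturbations are all of this form.\<close>

lemma cadlag_paths_restrict_upd:
  fixes y :: "real \<Rightarrow> 'a::t2_space"
  assumes y: "y \<in> cadlag_paths T A" and t: "0 \<le> t" "t \<le> T" and "c \<in> A"
  shows "restrict (y(t := c)) {0..t} \<in> cadlag_paths t A"
  unfolding cadlag_paths_def
proof (intro CollectI conjI ballI)
  show "restrict (y(t := c)) {0..t} \<in> {0..t} \<rightarrow>\<^sub>E A"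
    using cadlag_paths_mem[OF y] t \<open>c \<in> A\<close> by auto
next
  fix s
  assume s: "s \<in> {0..<t}"
  have "\<forall>\<^sub>F u in at_right s. u \<in> {s<..<t}"
    using s by (intro eventually_at_right_real) auto
  then have "\<forall>\<^sub>F u in at_right s. y u = restrict (y(t := c)) {0..t} u"
    by eventually_elim (use s in auto)
  moreover have "(y \<longlongrightarrow> y s) (at_right s)"
    using s t by (intro cadlag_paths_right[OF y]) auto
  ultimately show "(restrict (y(t := c)) {0..t} \<longlongrightarrow> restrict (y(t := c)) {0..t} s) (at_right s)"
    using s by (auto intro: Lim_transform_eventually)
next
  fix s
  assume s: "s \<in> {0<..t}"
  have "\<forall>\<^sub>F u in at_left s. u \<in> {0<..<s}"
    using s by (intro eventually_at_left_real) auto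
  then have "\<forall>\<^sub>F u in at_left s. y u = restrict (y(t := c)) {0..t} u"
    by eventually_elim (use s in auto)
  then show "\<exists>l\<in>A. (restrict (y(t := c)) {0..t} \<longlongrightarrow> l) (at_left s)"
    using cadlag_paths_left_lim[OF y, of s] s t
    by (intro bexI[of _ "left_lim y s"]) (auto intro: Lim_transform_eventually)
qed

lemma cadlag_paths_restrict:
  fixes y :: "real \<Rightarrow> 'a::t2_space"
  assumes "y \<in> cadlag_paths T A" "0 \<le> t" "t \<le> T"
  shows "restrict y {0..t} \<in> cadlag_paths t A"
  using cadlag_paths_restrict_upd[OF assms, of "y t"] cadlag_paths_mem[OF assms(1), of t] assms by simp

lemma cadlag_paths_path_minus:
  fixes y :: "real \<Rightarrow> 'a::t2_space"
  assumes "y \<in> cadlag_paths T A" "0 \<le> t" "t \<le> T" "a \<in> A"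
  shows "path_minus a t y \<in> cadlag_paths t A"
proof -
  define c where "c = (if t = 0 then a else left_lim y t)"
  have "c \<in> A"
    using assms cadlag_paths_left_lim(1)[OF assms(1), of t] by (auto simp: c_def)
  moreover have "path_minus a t y = restrict (y(t := c)) {0..t}"
    by (auto simp: path_minus_def c_def restrict_def)
  ultimately show ?thesis
    using cadlag_paths_restrict_upd[OF assms(1-3)] by simp
qed

lemma cadlag_paths_vert_pert:
  fixes p :: "real \<Rightarrow> 'a::{t2_space,monoid_add}"
  assumes "p \<in> cadlag_paths t A" "0 \<le> t" "p t + e \<in> A"
  shows "vert_pert t e p \<in> cadlag_paths t A"
proof -
  have "vert_pert t e p = restrict (p(t := p t + e)) {0..t}"
    by (auto simp: vert_pert_def restrict_def)
  then show ?thesis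
    using cadlag_paths_restrict_upd[OF assms(1,2) order_refl assms(3)] by simp
qed

lemma cadlag_paths_hor_ext:
  fixes p :: "real \<Rightarrow> 'a::t2_space"
  assumes p: "p \<in> cadlag_paths t A" and t: "0 \<le> t" "0 \<le> h"
  shows "hor_ext t h p \<in> cadlag_paths (t + h) A"
  unfolding cadlag_paths_def
proof (intro CollectI conjI ballI)
  show "hor_ext t h p \<in> {0..t + h} \<rightarrow>\<^sub>E A"
    using cadlag_paths_mem[OF p] t by (auto simp: hor_ext_def)
next
  fix s
  assume s: "s \<in> {0..<t + h}"
  show "(hor_ext t h p \<longlongrightarrow> hor_ext t h p s) (at_right s)"
  proof (cases "s < t")
    case True
    have "\<forall>\<^sub>F u in at_right s. u \<in> {s<..<t}"
      using True by (rule eventually_at_right_real)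
    then have "\<forall>\<^sub>F u in at_right s. p u = hor_ext t h p u"
      by eventually_elim (use s t in \<open>auto simp: hor_ext_def\<close>)
    then show ?thesis
      using cadlag_paths_right[OF p, of s] s True t by (auto intro: Lim_transform_eventually simp: hor_ext_def)
  next
    case False
    have "\<forall>\<^sub>F u in at_right s. u \<in> {s<..<t + h}"
      using s by (intro eventually_at_right_real) auto
    then have "\<forall>\<^sub>F u in at_right s. hor_ext t h p s = hor_ext t h p u"
      by eventually_elim (use s t False in \<open>auto simp: hor_ext_def\<close>)
    then show ?thesis
      by (rule Lim_transform_eventually[OF tendsto_const])
  qed
next
  fix s
  assume s: "s \<in> {0<..t + h}"
  show "\<exists>l\<in>A. (hor_ext t h p \<longlongrightarrow> l) (at_left s)"
  proof (cases "s \<le> t")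
    case True
    have "\<forall>\<^sub>F u in at_left s. u \<in> {0<..<s}"
      using s by (intro eventually_at_left_real) auto
    then have "\<forall>\<^sub>F u in at_left s. p u = hor_ext t h p u"
      by eventually_elim (use s t True in \<open>auto simp: hor_ext_def\<close>)
    then show ?thesis
      using cadlag_paths_left_lim[OF p, of s] s True
      by (intro bexI[of _ "left_lim p s"]) (auto intro: Lim_transform_eventually)
  next
    case False
    have "\<forall>\<^sub>F u in at_left s. u \<in> {t<..<s}"
      using False by (intro eventually_at_left_real) auto
    then have "\<forall>\<^sub>F u in at_left s. p t = hor_ext t h p u"
      by eventually_elim (use s t False in \<open>auto simp: hor_ext_def\<close>)
    then show ?thesis
      using cadlag_paths_mem[OF p, of t] t
      by (intro bexI[of _ "p t"]) (auto intro: Lim_transform_eventually)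
  qed
qed

lemma hor_ext_0: "p \<in> cadlag_paths t A \<Longrightarrow> hor_ext t 0 p = p"
  by (auto simp: hor_ext_def cadlag_paths_def restrict_def PiE_def extensional_def)

lemma hor_ext_hor_ext: "0 \<le> g \<Longrightarrow> 0 \<le> h \<Longrightarrow> 0 \<le> t \<Longrightarrow> hor_ext (t + g) h (hor_ext t g p) = hor_ext t (g + h) p"
  by (auto simp: hor_ext_def restrict_def add.assoc)

lemma vert_pert_0: "p \<in> cadlag_paths t A \<Longrightarrow> vert_pert t 0 p = p"
  by (auto simp: vert_pert_def cadlag_paths_def restrict_def PiE_def extensional_def)

lemma vert_pert_vert_pert: "vert_pert t e (vert_pert t e' p) = vert_pert t (e' + e) p"
  by (auto simp: vert_pert_def restrict_def add.assoc)

text \<open>Evaluating the constant extension of a path on \<open>[0, t']\<close> at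
  \<open>s\<close> amounts to evaluating the path at \<open>min s t'\<close>, so pointwise estimates
  bound both suprema.\<close>

lemma d_infty_le:
  assumes "0 \<le> t'" "t' \<le> t"
    and "\<And>s. s \<in> {0..t} \<Longrightarrow> norm (x s - x' (min s t')) \<le> A"
    and "\<And>s. s \<in> {0..t} \<Longrightarrow> norm (v s - v' (min s t')) \<le> B"
  shows "d_infty t x v t' x' v' \<le> A + B + (t - t')"
proof -
  have *: "hor_ext t 0 x s - hor_ext t' (t - t') x' s = x s - x' (min s t')"
    "hor_ext t 0 v s - hor_ext t' (t - t') v' s = v s - v' (min s t')" if "s \<in> {0..t}" for s
    using that assms(1) by (auto simp: hor_ext_def min_def)
  have "(SUP u\<in>{0..t}. norm (hor_ext t 0 x u - hor_ext t' (t - t') x' u)) \<le> A"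
    using assms by (intro cSUP_least) (auto simp: *)
  moreover have "(SUP u\<in>{0..t}. norm (hor_ext t 0 v u - hor_ext t' (t - t') v' u)) \<le> B"
    using assms by (intro cSUP_least) (auto simp: *)
  ultimately show ?thesis
    using assms(2) by (simp add: d_infty_def Let_def max_def)
qed

text \<open>The local input for the compactness arguments below. At \<open>u = 0\<close> the left
  half is vacuous, so the arbitrary value of \<open>left_lim y 0\<close> does no harm; at
  \<open>u = T\<close> the right half concerns \<open>s = T\<close> only.\<close>

lemma cadlag_paths_oscillation:
  fixes y :: "real \<Rightarrow> 'a::real_normed_vector"
  assumes y: "y \<in> cadlag_paths T A" and u: "u \<in> {0..T}" and "e > 0"
  shows "\<exists>\<eta>>0. \<forall>s\<in>{0..T}. (u \<le> s \<and> s < u + \<eta> \<longrightarrow> norm (y s - y u) \<le> e) \<and>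
    (u - \<eta> < s \<and> s < u \<longrightarrow> norm (y s - left_lim y u) \<le> e)"
proof -
  have "\<exists>\<eta>>0. \<forall>s\<in>{0..T}. u \<le> s \<and> s < u + \<eta> \<longrightarrow> norm (y s - y u) \<le> e"
  proof (cases "u = T")
    case False
    then have "(y \<longlongrightarrow> y u) (at_right u)"
      using cadlag_paths_right[OF y, of u] u by auto
    then have "\<forall>\<^sub>F s in at_right u. dist (y s) (y u) < e"
      using \<open>e > 0\<close> by (rule tendstoD)
    then obtain b where b: "b > u" "\<And>s. u < s \<Longrightarrow> s < b \<Longrightarrow> dist (y s) (y u) < e"
      unfolding eventually_at_right_field by auto
    have "norm (y s - y u) \<le> e" if "u \<le> s" "s < b" for s
      using b(2)[of s] that \<open>e > 0\<close> by (cases "s = u") (auto simp: dist_norm)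
    then show ?thesis
      using b(1) by (intro exI[of _ "b - u"]) auto
  qed (use \<open>e > 0\<close> in \<open>auto intro!: exI[of _ 1]\<close>)
  moreover have "\<exists>\<eta>>0. \<forall>s\<in>{0..T}. u - \<eta> < s \<and> s < u \<longrightarrow> norm (y s - left_lim y u) \<le> e"
  proof (cases "u = 0")
    case False
    then have "(y \<longlongrightarrow> left_lim y u) (at_left u)"
      using cadlag_paths_left_lim[OF y, of u] u by auto
    then have "\<forall>\<^sub>F s in at_left u. dist (y s) (left_lim y u) < e"
      using \<open>e > 0\<close> by (rule tendstoD)
    then obtain b where b: "b < u" "\<And>s. b < s \<Longrightarrow> s < u \<Longrightarrow> dist (y s) (left_lim y u) < e"
      unfolding eventually_at_left_field by auto
    then show ?thesis
      by (intro exI[of _ "u - b"]) (auto simp: dist_norm intro: less_imp_le)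
  qed (auto intro!: exI[of _ 1])
  ultimately obtain \<eta>1 \<eta>2 where "\<eta>1 > 0" "\<eta>2 > 0"
    "\<And>s. s \<in> {0..T} \<Longrightarrow> u \<le> s \<Longrightarrow> s < u + \<eta>1 \<Longrightarrow> norm (y s - y u) \<le> e"
    "\<And>s. s \<in> {0..T} \<Longrightarrow> u - \<eta>2 < s \<Longrightarrow> s < u \<Longrightarrow> norm (y s - left_lim y u) \<le> e"
    by metis
  then show ?thesis
    by (intro exI[of _ "min \<eta>1 \<eta>2"]) auto
qed

text \<open>A Lebesgue number of the cover by oscillation intervals puts \<open>s\<close> and
  \<open>t\<close> into one interval around some \<open>u\<close>. If \<open>s < u \<le> t\<close>,
  the path is near its left limit at \<open>s\<close> and near its value at \<open>t\<close>, and
  the jump at \<open>u\<close> is the only extra cost.\<close>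

lemma cadlag_paths_modulus:
  fixes y :: "real \<Rightarrow> 'a::real_normed_vector"
  assumes y: "y \<in> cadlag_paths T A" and "e > 0"
  shows "\<exists>\<delta>>0. \<forall>s t. 0 \<le> s \<and> s \<le> t \<and> t \<le> T \<and> t - s < \<delta> \<longrightarrow>
    norm (y t - y s) \<le> e \<or> (\<exists>u. s < u \<and> u \<le> t \<and> norm (y t - y s) \<le> e + norm (y u - left_lim y u))"
proof -
  define I where "I = {0..T}"
  have "\<exists>\<eta>. \<eta> > 0 \<and> (\<forall>s\<in>I. (u \<le> s \<and> s < u + \<eta> \<longrightarrow> norm (y s - y u) \<le> e / 2) \<and>
    (u - \<eta> < s \<and> s < u \<longrightarrow> norm (y s - left_lim y u) \<le> e / 2))" if "u \<in> I" for u
    using cadlag_paths_oscillation[OF y, of u "e / 2"] that \<open>e > 0\<close> unfolding I_def by simp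
  then obtain \<eta> where \<eta>: "\<And>u. u \<in> I \<Longrightarrow> \<eta> u > 0"
    "\<And>u s. u \<in> I \<Longrightarrow> s \<in> I \<Longrightarrow> u \<le> s \<Longrightarrow> s < u + \<eta> u \<Longrightarrow> norm (y s - y u) \<le> e / 2"
    "\<And>u s. u \<in> I \<Longrightarrow> s \<in> I \<Longrightarrow> u - \<eta> u < s \<Longrightarrow> s < u \<Longrightarrow> norm (y s - left_lim y u) \<le> e / 2"
    by metis
  have "compact I" "I \<subseteq> \<Union> ((\<lambda>u. ball u (\<eta> u)) ` I)"
    using \<eta>(1) by (auto simp: I_def)
  then obtain \<delta> where \<delta>: "\<delta> > 0" "\<And>s. s \<in> I \<Longrightarrow> \<exists>G\<in>(\<lambda>u. ball u (\<eta> u)) ` I. ball s \<delta> \<subseteq> G"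
    by (rule Heine_Borel_lemma) auto
  show ?thesis
  proof (intro exI[of _ \<delta>] conjI allI impI \<delta>(1))
    fix s t
    assume st: "0 \<le> s \<and> s \<le> t \<and> t \<le> T \<and> t - s < \<delta>"
    then have I: "s \<in> I" "t \<in> I"
      by (auto simp: I_def)
    obtain u where u: "u \<in> I" "ball s \<delta> \<subseteq> ball u (\<eta> u)"
      using \<delta>(2)[OF I(1)] by auto
    moreover have "s \<in> ball s \<delta>" "t \<in> ball s \<delta>"
      using st \<delta>(1) by (auto simp: dist_real_def)
    ultimately have "s \<in> ball u (\<eta> u)" "t \<in> ball u (\<eta> u)"
      by blast+
    then have st_u: "u - \<eta> u < s" "s < u + \<eta> u" "u - \<eta> u < t" "t < u + \<eta> u"
      by (auto simp: dist_real_def)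
    consider "u \<le> s" | "t < u" | "s < u" "u \<le> t"
      by linarith
    then show "norm (y t - y s) \<le> e \<or>
      (\<exists>u. s < u \<and> u \<le> t \<and> norm (y t - y s) \<le> e + norm (y u - left_lim y u))"
    proof cases
      case 1
      then have "norm (y t - y u) \<le> e / 2" "norm (y s - y u) \<le> e / 2"
        using \<eta>(2)[OF u(1)] I st st_u by auto
      then have "norm (y t - y s) \<le> e"
        using norm_triangle_ineq4[of "y t - y u" "y s - y u"] by simp
      then show ?thesis ..
    next
      case 2
      then have "norm (y t - left_lim y u) \<le> e / 2" "norm (y s - left_lim y u) \<le> e / 2"
        using \<eta>(3)[OF u(1)] I st st_u by auto
      then have "norm (y t - y s) \<le> e"
        using norm_triangle_ineq4[of "y t - left_lim y u" "y s - left_lim y u"] by simp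
      then show ?thesis ..
    next
      case 3
      then have "norm (y t - y u) \<le> e / 2" "norm (y s - left_lim y u) \<le> e / 2"
        using \<eta>(2,3)[OF u(1)] I st st_u by auto
      then have "norm (y t - y s) \<le> e + norm (y u - left_lim y u)"
        using norm_triangle_ineq4[of "y t - y u" "y s - left_lim y u"]
          norm_triangle_ineq[of "(y t - y u) - (y s - left_lim y u)" "y u - left_lim y u"]
        by (simp add: algebra_simps)
      then show ?thesis
        using 3 by blast
    qed
  qed
qed

text \<open>Finitely many oscillation intervals cover \<open>[0, T]\<close>, and in each the path
  stays within 1 of its value or of its left limit at the centre. The bound on the jumps is there to
  make their supremum over off-grid times a genuine one.\<close>

lemma cadlag_paths_bounded:
  fixes y :: "real \<Rightarrow> 'a::real_normed_vector"
  assumes y: "y \<in> cadlag_paths T A"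
  shows "\<exists>B. (\<forall>s\<in>{0..T}. norm (y s) \<le> B) \<and> (\<forall>s\<in>{0<..T}. norm (y s - left_lim y s) \<le> 2 * B)"
proof -
  define I where "I = {0..T}"
  have "\<exists>\<eta>. \<eta> > 0 \<and> (\<forall>s\<in>I. (u \<le> s \<and> s < u + \<eta> \<longrightarrow> norm (y s - y u) \<le> 1) \<and>
    (u - \<eta> < s \<and> s < u \<longrightarrow> norm (y s - left_lim y u) \<le> 1))" if "u \<in> I" for u
    using cadlag_paths_oscillation[OF y, of u 1] that unfolding I_def by simp
  then obtain \<eta> where \<eta>: "\<And>u. u \<in> I \<Longrightarrow> \<eta> u > 0"
    "\<And>u s. u \<in> I \<Longrightarrow> s \<in> I \<Longrightarrow> u \<le> s \<Longrightarrow> s < u + \<eta> u \<Longrightarrow> norm (y s - y u) \<le> 1"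
    "\<And>u s. u \<in> I \<Longrightarrow> s \<in> I \<Longrightarrow> u - \<eta> u < s \<Longrightarrow> s < u \<Longrightarrow> norm (y s - left_lim y u) \<le> 1"
    by metis
  have "compact I" "I \<subseteq> (\<Union>u\<in>I. ball u (\<eta> u))"
    using \<eta>(1) by (auto simp: I_def)
  then obtain K where K: "K \<subseteq> I" "finite K" "I \<subseteq> (\<Union>u\<in>K. ball u (\<eta> u))"
    using compactE_image[of I I "\<lambda>u. ball u (\<eta> u)"] open_ball by metis
  define B where "B = 1 + (\<Sum>u\<in>K. norm (y u) + norm (left_lim y u))"
  have *: "norm (y u) + 1 \<le> B" "norm (left_lim y u) + 1 \<le> B" if "u \<in> K" for u
  proof -
    have "norm (y u) + norm (left_lim y u) \<le> (\<Sum>u\<in>K. norm (y u) + norm (left_lim y u))"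
      using that K(2) by (intro member_le_sum) auto
    then show "norm (y u) + 1 \<le> B" "norm (left_lim y u) + 1 \<le> B"
      using norm_ge_zero[of "y u"] norm_ge_zero[of "left_lim y u"] unfolding B_def by linarith+
  qed
  have B: "norm (y s) \<le> B" if s: "s \<in> I" for s
  proof -
    obtain u where u: "u \<in> K" "s \<in> ball u (\<eta> u)"
      using K(3) s by blast
    then have "norm (y s - y u) \<le> 1 \<or> norm (y s - left_lim y u) \<le> 1"
      using \<eta>(2,3)[of u s] K(1) s by (cases "u \<le> s") (auto simp: dist_real_def)
    then show ?thesis
      using *[OF u(1)] norm_triangle_sub[of "y s" "y u"] norm_triangle_sub[of "y s" "left_lim y u"]
      by linarith
  qed
  have "norm (y s - left_lim y s) \<le> 2 * B" if s: "s \<in> {0<..T}" for s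
  proof -
    have "\<forall>\<^sub>F u in at_left s. u \<in> {0<..<s}"
      using s by (intro eventually_at_left_real) auto
    then have "\<forall>\<^sub>F u in at_left s. norm (y u) \<le> B"
      by eventually_elim (use s in \<open>auto intro!: B simp: I_def\<close>)
    then have "norm (left_lim y s) \<le> B"
      by (intro Lim_norm_ubound[OF _ cadlag_paths_left_lim(2)[OF y s]]) auto
    then show ?thesis
      using norm_triangle_ineq4[of "y s" "left_lim y s"] B[of s] s by (simp add: I_def)
  qed
  then show ?thesis
    using B unfolding I_def by blast
qed

subsection \<open>Step paths and derivatives along path extensions\<close>

lemma grid_mono:
  fixes \<sigma> :: "nat \<Rightarrow> real"
  assumes "\<And>i. i < K \<Longrightarrow> \<sigma> i \<le> \<sigma> (Suc i)" and "i \<le> j" "j \<le> K"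
  shows "\<sigma> i \<le> \<sigma> j"
  using assms(2,3)
proof (induction j rule: dec_induct)
  case (step j)
  then show ?case
    using assms(1)[of j] by simp
qed simp

lemma grid_cell_right:
  fixes \<sigma> :: "nat \<Rightarrow> real"
  assumes "s \<in> {\<sigma> 0..<\<sigma> K}"
  shows "\<exists>i<K. s \<in> {\<sigma> i..<\<sigma> (Suc i)}"
  using assms
proof (induction K)
  case (Suc K)
  then show ?case
    by (cases "s < \<sigma> K") (auto intro: less_SucI)
qed simp

lemma grid_cell_left:
  fixes \<sigma> :: "nat \<Rightarrow> real"
  assumes "s \<in> {\<sigma> 0<..\<sigma> K}"
  shows "\<exists>i<K. s \<in> {\<sigma> i<..\<sigma> (Suc i)}"
  using assms
proof (induction K)
  case (Suc K)
  then show ?case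
    by (cases "s \<le> \<sigma> K") (auto intro: less_SucI)
qed simp

text \<open>Monotonicity makes the half-open cells disjoint; repeated subdivision points give empty
  cells, whose indicators vanish.\<close>

lemma grid_sum_indicator:
  fixes \<sigma> :: "nat \<Rightarrow> real" and c :: "nat \<Rightarrow> 'a::real_vector"
  assumes mono: "\<And>i. i < K \<Longrightarrow> \<sigma> i \<le> \<sigma> (Suc i)" and i: "i < K" "t \<in> {\<sigma> i..<\<sigma> (Suc i)}"
  shows "(\<Sum>j<K. indicator {\<sigma> j..<\<sigma> (Suc j)} t *\<^sub>R c j) = c i"
proof -
  have "t \<notin> {\<sigma> j..<\<sigma> (Suc j)}" if "j < K" "j \<noteq> i" for j
  proof (cases "j < i")
    case True
    then show ?thesis
      using grid_mono[of K \<sigma> "Suc j" i] mono i by auto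
  next
    case False
    then show ?thesis
      using grid_mono[of K \<sigma> "Suc i" j] mono i that by auto
  qed
  then have "(\<Sum>j<K. indicator {\<sigma> j..<\<sigma> (Suc j)} t *\<^sub>R c j) = (\<Sum>j<K. if j = i then c i else 0)"
    using i by (intro sum.cong) (auto simp: indicator_def)
  then show ?thesis
    using i by simp
qed

lemma grid_sum_indicator_end:
  fixes \<sigma> :: "nat \<Rightarrow> real" and c :: "nat \<Rightarrow> 'a::real_vector"
  assumes mono: "\<And>i. i < K \<Longrightarrow> \<sigma> i \<le> \<sigma> (Suc i)"
  shows "(\<Sum>j<K. indicator {\<sigma> j..<\<sigma> (Suc j)} (\<sigma> K) *\<^sub>R c j) = 0"
proof (intro sum.neutral ballI)
  fix j
  assume "j \<in> {..<K}"
  then show "indicator {\<sigma> j..<\<sigma> (Suc j)} (\<sigma> K) *\<^sub>R c j = 0"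
    using grid_mono[of K \<sigma> "Suc j" K] mono by auto
qed

lemma step_path_left:
  fixes y :: "real \<Rightarrow> 'a::topological_space"
  assumes "\<And>t. t \<in> {a..<b} \<Longrightarrow> y t = c" and "s \<in> {a<..b}"
  shows "(y \<longlongrightarrow> c) (at_left s)"
proof -
  have "\<forall>\<^sub>F u in at_left s. u \<in> {a<..<s}"
    using assms(2) by (intro eventually_at_left_real) auto
  then have "\<forall>\<^sub>F u in at_left s. c = y u"
    by eventually_elim (use assms in auto)
  then show ?thesis
    by (rule Lim_transform_eventually[OF tendsto_const])
qed

lemma step_path_cadlag:
  fixes y :: "real \<Rightarrow> 'a::topological_space"
  assumes "\<sigma> 0 = 0" "\<sigma> K = T"
    and y: "y \<in> {0..T} \<rightarrow>\<^sub>E A" and c: "\<And>i. i < K \<Longrightarrow> c i \<in> A"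
    and step: "\<And>i t. i < K \<Longrightarrow> t \<in> {\<sigma> i..<\<sigma> (Suc i)} \<Longrightarrow> y t = c i"
  shows "y \<in> cadlag_paths T A"
  unfolding cadlag_paths_def
proof (intro CollectI conjI ballI y)
  fix s
  assume "s \<in> {0..<T}"
  then obtain i where i: "i < K" "s \<in> {\<sigma> i..<\<sigma> (Suc i)}"
    using grid_cell_right[of s \<sigma> K] assms(1,2) by auto
  have "\<forall>\<^sub>F u in at_right s. u \<in> {s<..<\<sigma> (Suc i)}"
    using i(2) by (intro eventually_at_right_real) auto
  then have "\<forall>\<^sub>F u in at_right s. y s = y u"
    by eventually_elim (use i step in auto)
  then show "(y \<longlongrightarrow> y s) (at_right s)"
    by (rule Lim_transform_eventually[OF tendsto_const])
next
  fix s
  assume "s \<in> {0<..T}"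
  then obtain i where i: "i < K" "s \<in> {\<sigma> i<..\<sigma> (Suc i)}"
    using grid_cell_left[of s \<sigma> K] assms(1,2) by auto
  then show "\<exists>l\<in>A. (y \<longlongrightarrow> l) (at_left s)"
    using step_path_left[of "\<sigma> i" "\<sigma> (Suc i)" y "c i" s] step c by blast
qed

text \<open>Along paths frozen at time \<open>a\<close>, \<open>F\<close> becomes a real function of
  time with right derivative \<open>hor_deriv F\<close>. It is right continuous because it has a
  right derivative, and left continuous by \<open>left\<close>, since two extensions of one path
  differ in \<open>d_infty\<close> by the time lag only.\<close>

lemma hor_derivative_integral:
  fixes F :: "('a::real_normed_vector, 'b::real_normed_vector, real) functional"
  assumes left: "left_continuous_functional U S {0..T} F"
    and hor: "hor_differentiable U S {0..<T} F"
    and p: "p \<in> cadlag_paths a U" and q: "q \<in> cadlag_paths a S"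
    and ab: "0 \<le> a" "a \<le> b" "b \<le> T"
    and bound: "\<And>u. u \<in> {a..<b} \<Longrightarrow> \<bar>hor_deriv F u (hor_ext a (u - a) p) (hor_ext a (u - a) q)\<bar> \<le> C"
  shows "set_integrable lborel {a..<b} (\<lambda>u. hor_deriv F u (hor_ext a (u - a) p) (hor_ext a (u - a) q))"
    and "(LBINT u:{a..<b}. hor_deriv F u (hor_ext a (u - a) p) (hor_ext a (u - a) q)) =
      F b (hor_ext a (b - a) p) (hor_ext a (b - a) q) - F a p q"
proof -
  define \<psi> where "\<psi> u = F u (hor_ext a (u - a) p) (hor_ext a (u - a) q)" for u
  have paths: "hor_ext a (u - a) p \<in> cadlag_paths u U" "hor_ext a (u - a) q \<in> cadlag_paths u S"
    if "a \<le> u" for u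
    using cadlag_paths_hor_ext[OF p \<open>0 \<le> a\<close>, of "u - a"] cadlag_paths_hor_ext[OF q \<open>0 \<le> a\<close>, of "u - a"] that
    by auto
  have deriv: "(\<psi> has_real_derivative hor_deriv F u (hor_ext a (u - a) p) (hor_ext a (u - a) q)) (at_right u)"
    if u: "u \<in> {a..<b}" for u
  proof -
    define E E' where "E = hor_ext a (u - a) p" and "E' = hor_ext a (u - a) q"
    have "\<exists>D. (hor_quotient F u E E' \<longlongrightarrow> D) (at_right 0)"
      using hor paths[of u] u ab by (auto simp: hor_differentiable_def E_def E'_def)
    then obtain D where D: "(hor_quotient F u E E' \<longlongrightarrow> D) (at_right 0)" ..
    then have "hor_deriv F u E E' = D"
      unfolding hor_deriv_def by (intro tendsto_Lim) auto
    moreover have "\<forall>\<^sub>F h in at_right 0. hor_quotient F u E E' h = (\<psi> (u + h) - \<psi> u) / h"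
      using eventually_at_right_less[of "0::real"]
    proof eventually_elim
      case (elim h)
      \<comment> \<open>Extending twice is extending once, so the horizontal quotient at the
        extended path is a difference quotient of \<open>\<psi>\<close>.\<close>
      have "hor_ext u h (hor_ext a (u - a) p) = hor_ext a (u + h - a) p"
        "hor_ext u h (hor_ext a (u - a) q) = hor_ext a (u + h - a) q"
        using hor_ext_hor_ext[of "u - a" h a p] hor_ext_hor_ext[of "u - a" h a q] elim u ab
        by (simp_all add: algebra_simps)
      then show ?case
        by (simp add: hor_quotient_def \<psi>_def E_def E'_def)
    qed
    ultimately have "((\<lambda>h. (\<psi> (u + h) - \<psi> u) / h) \<longlongrightarrow> hor_deriv F u E E') (at_right 0)"
      using D by (auto intro: Lim_transform_eventually)
    then show ?thesis
      by (simp add: has_field_derivative_iff filterlim_at_right_to_0[of _ _ u] E_def E'_def add.commute)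
  qed
  have right: "(\<psi> \<longlongrightarrow> \<psi> u) (at_right u)" if "u \<in> {a..<b}" for u
    using DERIV_continuous[OF deriv[OF that]] by (simp add: continuous_within)
  have left: "(\<psi> \<longlongrightarrow> \<psi> u) (at_left u)" if u: "u \<in> {a<..b}" for u
  proof (rule tendstoI)
    fix e :: real
    assume "e > 0"
    have "\<exists>\<eta>>0. \<forall>h\<in>{0..u}. \<forall>x'\<in>cadlag_paths (u - h) U. \<forall>v'\<in>cadlag_paths (u - h) S.
      d_infty u (hor_ext a (u - a) p) (hor_ext a (u - a) q) (u - h) x' v' < \<eta> \<longrightarrow>
        norm (F u (hor_ext a (u - a) p) (hor_ext a (u - a) q) - F (u - h) x' v') < e"
      using left paths[of u] u ab \<open>e > 0\<close> unfolding left_continuous_functional_def by simp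
    then obtain \<eta> where \<eta>: "\<eta> > 0" "\<And>h x' v'. h \<in> {0..u} \<Longrightarrow> x' \<in> cadlag_paths (u - h) U \<Longrightarrow>
        v' \<in> cadlag_paths (u - h) S \<Longrightarrow>
        d_infty u (hor_ext a (u - a) p) (hor_ext a (u - a) q) (u - h) x' v' < \<eta> \<Longrightarrow>
        norm (F u (hor_ext a (u - a) p) (hor_ext a (u - a) q) - F (u - h) x' v') < e"
      by blast
    have "\<forall>\<^sub>F s in at_left u. s \<in> {max a (u - \<eta>)<..<u}"
      using u \<eta>(1) by (intro eventually_at_left_real) auto
    then show "\<forall>\<^sub>F s in at_left u. dist (\<psi> s) (\<psi> u) < e"
    proof eventually_elim
      case (elim s)
      have "d_infty u (hor_ext a (u - a) p) (hor_ext a (u - a) q) s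
          (hor_ext a (s - a) p) (hor_ext a (s - a) q) \<le> 0 + 0 + (u - s)"
        using elim ab by (intro d_infty_le) (auto simp: hor_ext_def min_def)
      then have "norm (\<psi> u - \<psi> s) < e"
        unfolding \<psi>_def using \<eta>(2)[of "u - s"] elim ab u paths[of s] by auto
      then show ?case
        by (simp add: dist_norm norm_minus_commute)
    qed
  qed
  have cont: "continuous_on {a..b} \<psi>"
  proof (cases "a = b")
    case False
    then show ?thesis
      using ab left right by (intro continuous_on_IccI) (auto simp: filterlim_split_at)
  qed simp
  note * = right_derivative_integral[OF \<open>a \<le> b\<close> cont deriv bound]
  show "set_integrable lborel {a..<b} (\<lambda>u. hor_deriv F u (hor_ext a (u - a) p) (hor_ext a (u - a) q))"
    using *(1) by simp
  show "(LBINT u:{a..<b}. hor_deriv F u (hor_ext a (u - a) p) (hor_ext a (u - a) q)) =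
      F b (hor_ext a (b - a) p) (hor_ext a (b - a) q) - F a p q"
    using *(2) hor_ext_0[OF p] hor_ext_0[OF q] by (simp add: \<psi>_def)
qed

section \<open>Vertical derivatives and Taylor expansion\<close>

lemma GDERIV_ex1:
  fixes f :: "'a::euclidean_space \<Rightarrow> real"
  assumes "f differentiable (at x)"
  shows "\<exists>!D. GDERIV f x :> D"
proof -
  obtain f' where f': "(f has_derivative f') (at x)"
    using assms by (auto simp: differentiable_def)
  have "f' = (\<lambda>h. h \<bullet> (\<Sum>b\<in>Basis. f' b *\<^sub>R b))"
  proof
    fix h
    have "f' h = f' (\<Sum>b\<in>Basis. (h \<bullet> b) *\<^sub>R b)"
      by (simp add: euclidean_representation)
    also have "\<dots> = (\<Sum>b\<in>Basis. (h \<bullet> b) * f' b)"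
      using has_derivative_linear[OF f'] by (simp add: linear_sum linear_cmul)
    finally show "f' h = h \<bullet> (\<Sum>b\<in>Basis. f' b *\<^sub>R b)"
      by (simp add: inner_sum_right mult.commute)
  qed
  then have "GDERIV f x :> (\<Sum>b\<in>Basis. f' b *\<^sub>R b)"
    using f' by (simp add: gderiv_def)
  moreover have "D = D'" if "GDERIV f x :> D" "GDERIV f x :> D'" for D D'
  proof -
    have "(\<lambda>h. h \<bullet> D) = (\<lambda>h. h \<bullet> D')"
      using that unfolding gderiv_def by (rule has_derivative_unique)
    then show ?thesis
      by (metis vector_eq_ldot)
  qed
  ultimately show ?thesis
    by blast
qed

text \<open>The definite description in \<open>vert_grad\<close> is resolved by the Riesz
  representation of the derivative and by its uniqueness.\<close>

lemma vert_grad_has_derivative: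
  fixes F :: "(real^'d, 'b::topological_space, real) functional"
  assumes "vert_differentiable U S I F" "t \<in> I" "p \<in> cadlag_paths t U" "q \<in> cadlag_paths t S"
  shows "((\<lambda>e. F t (vert_pert t e p) q) has_derivative (\<lambda>h. h \<bullet> vert_grad F t p q)) (at 0)"
proof -
  have "(\<lambda>e. F t (vert_pert t e p) q) differentiable (at 0)"
    using assms by (auto simp: vert_differentiable_def)
  from theI'[OF GDERIV_ex1[OF this]] show ?thesis
    by (simp add: vert_grad_def gderiv_def)
qed

lemma vert_hess_has_derivative:
  fixes F :: "(real^'d, 'b::topological_space, real) functional"
  assumes "vert_differentiable U S I (vert_grad F)" "t \<in> I" "p \<in> cadlag_paths t U" "q \<in> cadlag_paths t S"
  shows "((\<lambda>e. vert_grad F t (vert_pert t e p) q) has_derivative (\<lambda>h. vert_hess F t p q *v h)) (at 0)"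
proof -
  define G where "G = (\<lambda>e. vert_grad F t (vert_pert t e p) q)"
  have "G differentiable (at 0)"
    using assms by (auto simp: vert_differentiable_def G_def)
  then have G: "(G has_derivative frechet_derivative G (at 0)) (at 0)"
    using frechet_derivative_works by blast
  have "(\<lambda>h. matrix (frechet_derivative G (at 0)) *v h) = frechet_derivative G (at 0)"
    using has_derivative_linear[OF G] by (rule matrix_vector_mul(2))
  then show ?thesis
    using G by (simp add: vert_hess_def G_def)
qed

text \<open>Maclaurin's formula of order 2 along the segment of endpoint values.
  \<open>vert_grad\<close> and \<open>vert_hess\<close> are derivatives at the zero perturbation, so
  the derivative at an intermediate \<open>s\<close> is obtained by taking the perturbed path
  \<open>P s\<close> as new base point; \<open>seg\<close> keeps all these base points in
  \<open>U\<close>.\<close>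

lemma vert_taylor:
  fixes F :: "(real^'d, 'b::topological_space, real) functional"
  assumes F: "vert_differentiable U S I F" "vert_differentiable U S I (vert_grad F)"
    and t: "t \<in> I" "0 \<le> t" and p: "p \<in> cadlag_paths t U" and q: "q \<in> cadlag_paths t S"
    and seg: "\<And>s. s \<in> {0..1} \<Longrightarrow> p t + s *\<^sub>R \<delta> \<in> U"
  shows "\<exists>s\<in>{0..1}. F t (vert_pert t \<delta> p) q - F t p q =
    vert_grad F t p q \<bullet> \<delta> + (1 / 2) * (\<delta> \<bullet> (vert_hess F t (vert_pert t (s *\<^sub>R \<delta>) p) q *v \<delta>))"
proof -
  define P where "P s = vert_pert t (s *\<^sub>R \<delta>) p" for s
  define g where "g m s = (if m = 0 then F t (P s) q else if m = 1 then \<delta> \<bullet> vert_grad F t (P s) q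
     else \<delta> \<bullet> (vert_hess F t (P s) q *v \<delta>))" for m :: nat and s
  have g_fun: "g 0 = (\<lambda>s. F t (P s) q)" "g 1 = (\<lambda>s. \<delta> \<bullet> vert_grad F t (P s) q)"
    "g (Suc 1) = (\<lambda>s. \<delta> \<bullet> (vert_hess F t (P s) q *v \<delta>))"
    by (auto simp: g_def)
  have shift: "((\<lambda>y. (y - s) *\<^sub>R \<delta>) has_derivative (\<lambda>h. h *\<^sub>R \<delta>)) (at s)" for s
    by (auto intro!: derivative_eq_intros)
  have P_shift: "vert_pert t ((y - s) *\<^sub>R \<delta>) (P s) = P y" for y s
    by (simp add: P_def vert_pert_vert_pert algebra_simps)
  have "\<exists>s. 0 < s \<and> s < 1 \<and> g 0 1 = (\<Sum>m<2. g m 0 / fact m * 1 ^ m) + g 2 s / fact 2 * 1 ^ 2"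
  proof (rule Maclaurin)
    show "\<forall>m s. m < 2 \<and> 0 \<le> s \<and> s \<le> 1 \<longrightarrow> DERIV (g m) s :> g (Suc m) s"
    proof (intro allI impI)
      fix m :: nat and s :: real
      assume ms: "m < 2 \<and> 0 \<le> s \<and> s \<le> 1"
      have Ps: "P s \<in> cadlag_paths t U"
        unfolding P_def using ms by (intro cadlag_paths_vert_pert p t seg) auto
      show "DERIV (g m) s :> g (Suc m) s"
      proof (cases "m = 0")
        case True
        have "((\<lambda>y. F t (P y) q) has_derivative (\<lambda>h. (h *\<^sub>R \<delta>) \<bullet> vert_grad F t (P s) q)) (at s)"
          using has_derivative_compose[OF shift[of s], of "\<lambda>e. F t (vert_pert t e (P s)) q" "\<lambda>h. h \<bullet> vert_grad F t (P s) q"]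
            vert_grad_has_derivative[OF F(1) t(1) Ps q] by (simp add: P_shift)
        then show ?thesis
          using True g_fun by (simp add: has_field_derivative_def mult_commute_abs)
      next
        case False
        have "((\<lambda>y. vert_grad F t (P y) q) has_derivative (\<lambda>h. vert_hess F t (P s) q *v (h *\<^sub>R \<delta>))) (at s)"
          using has_derivative_compose[OF shift[of s], of "\<lambda>e. vert_grad F t (vert_pert t e (P s)) q" "\<lambda>h. vert_hess F t (P s) q *v h"]
            vert_hess_has_derivative[OF F(2) t(1) Ps q] by (simp add: P_shift)
        from has_derivative_inner_right[OF this, of \<delta>]
        have "DERIV (g 1) s :> g (Suc 1) s"
          unfolding g_fun by (simp add: has_field_derivative_def matrix_vector_mult_scaleR mult_commute_abs)
        moreover have "m = 1"
          using False ms by simp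
        ultimately show ?thesis
          by simp
      qed
    qed
  qed auto
  then obtain s where "0 < s" "s < 1" "g 0 1 = g 0 0 + g 1 0 + g 2 s / 2"
    by (auto simp: numeral_2_eq_2)
  then show ?thesis
    using vert_pert_0[OF p] by (intro bexI[of _ s]) (auto simp: g_def P_def inner_commute)
qed

subsection \<open>Left continuity along paths\<close>

lemma continuous_paths_imp_cadlag:
  fixes x :: "real \<Rightarrow> 'a::t2_space"
  assumes "x \<in> continuous_paths T A"
  shows "x \<in> cadlag_paths T A"
  unfolding cadlag_paths_def
proof (intro CollectI conjI ballI)
  have cont: "continuous_on {0..T} x"
    using assms by (simp add: continuous_paths_def)
  show "x \<in> {0..T} \<rightarrow>\<^sub>E A"
    using assms by (simp add: continuous_paths_def)
  show "(x \<longlongrightarrow> x s) (at_right s)" if "s \<in> {0..<T}" for s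
    using that continuous_on_Icc_at_rightD[OF continuous_on_subset[OF cont, of "{s..T}"]] by auto
  show "\<exists>l\<in>A. (x \<longlongrightarrow> l) (at_left s)" if "s \<in> {0<..T}" for s
    using that continuous_on_Icc_at_leftD[OF continuous_on_subset[OF cont, of "{0..s}"]] assms
    by (intro bexI[of _ "x s"]) (auto simp: continuous_paths_def)
qed

section \<open>Predictability and its passage to the vertical derivatives\<close>

lemma path_minus_restrict:
  fixes y :: "real \<Rightarrow> 'a::t2_space"
  assumes "y \<in> cadlag_paths T A" "0 \<le> t" "t \<le> T"
  shows "path_minus a t (restrict y {0..t}) = path_minus a t y"
proof (cases "t = 0")
  case False
  then have t: "t \<in> {0<..t}" "t \<in> {0<..T}"
    using assms by auto
  have "\<forall>\<^sub>F u in at_left t. u \<in> {0<..<t}"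
    using t by (intro eventually_at_left_real) auto
  then have "\<forall>\<^sub>F u in at_left t. y u = restrict y {0..t} u"
    by eventually_elim auto
  then have "(restrict y {0..t} \<longlongrightarrow> left_lim y t) (at_left t)"
    by (rule Lim_transform_eventually[OF cadlag_paths_left_lim(2)[OF assms(1) t(2)]])
  then have "left_lim (restrict y {0..t}) t = left_lim y t"
    by (rule left_limI)
  then show ?thesis
    by (auto simp: path_minus_def restrict_def)
qed (auto simp: path_minus_def restrict_def)

lemma predictable_restrict:
  assumes "predictable_in_second U S I G" "t \<in> I" "0 \<le> t" "t \<le> T"
    and "z \<in> cadlag_paths t U" "y \<in> cadlag_paths T S"
  shows "G t z (restrict y {0..t}) = G t z (path_minus (y 0) t y)"
  using assms cadlag_paths_restrict[OF assms(6,3,4)] path_minus_restrict[OF assms(6,3,4)]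
  by (auto simp: predictable_in_second_def)

lemma eventually_vert_pert_cadlag:
  fixes p :: "real \<Rightarrow> 'a::real_normed_vector"
  assumes "open U" "p \<in> cadlag_paths t U" "0 \<le> t"
  shows "\<forall>\<^sub>F e in nhds 0. vert_pert t e p \<in> cadlag_paths t U"
proof -
  have "p t \<in> U"
    using assms cadlag_paths_mem[OF assms(2), of t] by auto
  moreover have "((\<lambda>e. p t + e) \<longlongrightarrow> p t) (nhds 0)"
    using tendsto_add[OF tendsto_const, of "\<lambda>e. e" 0 "nhds 0" "p t"] by (simp add: filterlim_ident)
  ultimately have "\<forall>\<^sub>F e in nhds 0. p t + e \<in> U"
    using topological_tendstoD[OF _ assms(1)] by blast
  then show ?thesis
    by eventually_elim (rule cadlag_paths_vert_pert[OF assms(2,3)])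
qed

text \<open>Predictability is known for \<open>U\<close>-valued perturbed paths only, that is for
  small perturbations, so derivatives are compared through agreement near 0.\<close>

lemma has_derivative_cong_nhds:
  assumes "\<forall>\<^sub>F e in nhds a. f e = g e"
  shows "(f has_derivative D) (at a) \<longleftrightarrow> (g has_derivative D) (at a)"
proof -
  have *: "f a = g a" "\<forall>\<^sub>F e in at a. f e = g e"
    using assms eventually_nhds_x_imp_x by (auto simp: eventually_nhds_conv_at)
  then show ?thesis
    using has_derivative_transform_eventually[of f D a UNIV g] has_derivative_transform_eventually[of g D a UNIV f]
    by (auto simp: eq_commute)
qed

text \<open>The perturbation acts on the first path and the left version is taken of the second, so
  the two do not interact. As \<open>U\<close> is open, small perturbations stay in the path space,
  and both sides are gradients of functions that agree near 0: they satisfy the same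
  description.\<close>

lemma predictable_vert_grad:
  fixes U :: "(real^'d) set"
  assumes "predictable_in_second U S I F" "open U" "\<And>t. t \<in> I \<Longrightarrow> 0 \<le> t"
  shows "predictable_in_second U S I (vert_grad F)"
  unfolding predictable_in_second_def
proof (intro ballI)
  fix t p q
  assume t: "t \<in> I" and p: "p \<in> cadlag_paths t U" and q: "q \<in> cadlag_paths t S"
  have "\<forall>\<^sub>F e in nhds 0. F t (vert_pert t e p) q = F t (vert_pert t e p) (path_minus (q 0) t q)"
    using eventually_vert_pert_cadlag[OF assms(2) p assms(3)[OF t]]
    by eventually_elim (use assms(1) t q in \<open>simp add: predictable_in_second_def\<close>)
  then show "vert_grad F t p q = vert_grad F t p (path_minus (q 0) t q)"
    unfolding vert_grad_def gderiv_def by (simp add: has_derivative_cong_nhds)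
qed

lemma predictable_vert_hess:
  fixes U :: "(real^'d) set"
  assumes "predictable_in_second U S I F" "open U" "\<And>t. t \<in> I \<Longrightarrow> 0 \<le> t"
  shows "predictable_in_second U S I (vert_hess F)"
  unfolding predictable_in_second_def
proof (intro ballI)
  fix t p q
  assume t: "t \<in> I" and p: "p \<in> cadlag_paths t U" and q: "q \<in> cadlag_paths t S"
  have "\<forall>\<^sub>F e in nhds 0. vert_grad F t (vert_pert t e p) q = vert_grad F t (vert_pert t e p) (path_minus (q 0) t q)"
    using eventually_vert_pert_cadlag[OF assms(2) p assms(3)[OF t]]
    by eventually_elim (use predictable_vert_grad[OF assms] t q in \<open>simp add: predictable_in_second_def\<close>)
  then show "vert_hess F t p q = vert_hess F t p (path_minus (q 0) t q)"
    unfolding vert_hess_def frechet_derivative_def by (simp add: has_derivative_cong_nhds)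
qed

text \<open>
  The approximating paths \<open>y\<close> are compared through \<open>y\<^sub>t\<^sub>-\<close>, since a jump of \<open>v\<close> at \<open>u\<close> is not seen
  by the approximations at times \<open>t < u\<close>.
\<close>

lemma left_continuous_along_paths:
  fixes G :: "('a::real_normed_vector, 'b::real_normed_vector, 'c::real_normed_vector) functional"
  assumes left: "left_continuous_functional U S {0..T} G" and pred: "predictable_in_second U S {0..T} G"
    and x: "x \<in> continuous_paths T U" and v: "v \<in> cadlag_paths T S"
    and u: "u \<in> {0<..T}" and "e > 0"
  shows "\<exists>\<eta>>0. \<forall>t y z. t \<in> {0..T} \<and> u - \<eta> < t \<and> t \<le> u \<and> z \<in> cadlag_paths t U \<and> y \<in> cadlag_paths T S \<and>
     (\<forall>s\<in>{0..t}. norm (z s - x s) \<le> \<eta>) \<and> (\<forall>s\<in>{0..T}. norm (y s - v s) \<le> \<eta>) \<longrightarrow>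
     norm (G t z (path_minus (y 0) t y) - G u (restrict x {0..u}) (restrict v {0..u})) < e"
proof -
  have xc: "x \<in> cadlag_paths T U"
    by (rule continuous_paths_imp_cadlag[OF x])
  have u': "0 \<le> u" "u \<le> T" "u \<in> {0..T}"
    using u by auto
  have xr: "restrict x {0..u} \<in> cadlag_paths u U"
    by (rule cadlag_paths_restrict[OF xc u'(1,2)])
  have vm: "path_minus (v 0) u v \<in> cadlag_paths u S"
    using cadlag_paths_mem[OF v, of 0] u by (intro cadlag_paths_path_minus[OF v u'(1,2)]) auto
  \<comment> \<open>Left continuity is used at \<open>(x\<^sub>u, v\<^sub>u\<^sub>-)\<close>, which
    the paths approach from the left; predictability returns to \<open>v\<^sub>u\<close> at the
    end.\<close>
  have "\<exists>\<eta>>0. \<forall>h\<in>{0..u}. \<forall>x'\<in>cadlag_paths (u - h) U. \<forall>v'\<in>cadlag_paths (u - h) S.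
      d_infty u (restrict x {0..u}) (path_minus (v 0) u v) (u - h) x' v' < \<eta> \<longrightarrow>
        norm (G u (restrict x {0..u}) (path_minus (v 0) u v) - G (u - h) x' v') < e"
    using left u' xr vm \<open>e > 0\<close> unfolding left_continuous_functional_def by blast
  then obtain \<kappa> where \<kappa>: "\<kappa> > 0" "\<And>h x' v'. h \<in> {0..u} \<Longrightarrow> x' \<in> cadlag_paths (u - h) U \<Longrightarrow>
      v' \<in> cadlag_paths (u - h) S \<Longrightarrow>
      d_infty u (restrict x {0..u}) (path_minus (v 0) u v) (u - h) x' v' < \<kappa> \<Longrightarrow>
      norm (G u (restrict x {0..u}) (path_minus (v 0) u v) - G (u - h) x' v') < e"
    by blast
  \<comment> \<open>Each path contributes at most \<open>3 * d\<close> and the time lag at most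
    \<open>d\<close>, altogether \<open>7 * d < \<kappa>\<close>.\<close>
  define d where "d = \<kappa> / 16"
  have "d > 0"
    using \<kappa>(1) by (simp add: d_def)
  obtain \<eta>1 where \<eta>1: "\<eta>1 > 0" "\<And>s. s \<in> {0..T} \<Longrightarrow> u - \<eta>1 < s \<Longrightarrow> s < u \<Longrightarrow> norm (v s - left_lim v u) \<le> d"
    using cadlag_paths_oscillation[OF v u'(3) \<open>d > 0\<close>] by blast
  have "(x \<longlongrightarrow> x u) (at_left u)"
    using continuous_on_Icc_at_leftD[OF continuous_on_subset[of "{0..T}" x "{0..u}"]] x u
    by (auto simp: continuous_paths_def)
  then have "left_lim x u = x u"
    by (rule left_limI)
  then obtain \<eta>2 where \<eta>2: "\<eta>2 > 0" "\<And>s. s \<in> {0..T} \<Longrightarrow> u - \<eta>2 < s \<Longrightarrow> s < u \<Longrightarrow> norm (x s - x u) \<le> d"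
    using cadlag_paths_oscillation[OF xc u'(3) \<open>d > 0\<close>] by auto
  \<comment> \<open>The bound by \<open>u\<close> forces \<open>t > 0\<close>, so that left limits
    at \<open>t\<close> exist; the bound by \<open>d\<close> controls the time lag and the distances
    of \<open>z\<close> and \<open>y\<close> from \<open>x\<close> and \<open>v\<close>.\<close>
  define \<eta> where "\<eta> = min (min \<eta>1 \<eta>2) (min d u)"
  have \<eta>: "\<eta> > 0" "\<eta> \<le> \<eta>1" "\<eta> \<le> \<eta>2" "\<eta> \<le> d" "\<eta> \<le> u"
    using \<eta>1(1) \<eta>2(1) \<open>d > 0\<close> u by (auto simp: \<eta>_def)
  have x_near: "norm (x s - x u) \<le> d" if "u - \<eta> < s" "s \<le> u" for s
    using \<eta>2(2)[of s] that \<eta> u \<open>d > 0\<close> by (cases "s = u") auto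
  have v_near: "norm (v s - left_lim v u) \<le> d" if "u - \<eta> < s" "s < u" for s
    using \<eta>1(2)[of s] that \<eta> u by auto
  have main: "norm (G t z (path_minus (y 0) t y) - G u (restrict x {0..u}) (restrict v {0..u})) < e"
    if t: "t \<in> {0..T}" "u - \<eta> < t" "t \<le> u" and z: "z \<in> cadlag_paths t U" and y: "y \<in> cadlag_paths T S"
      and zx: "\<forall>s\<in>{0..t}. norm (z s - x s) \<le> \<eta>" and yv: "\<forall>s\<in>{0..T}. norm (y s - v s) \<le> \<eta>" for t y z
  proof -
    have "t > 0"
      using t \<eta>(5) by linarith
    then have t': "t \<in> {0<..T}"
      using t by auto
    have ev: "\<forall>\<^sub>F s in at_left t. s \<in> {max 0 (u - \<eta>)<..<t}"
      using \<open>t > 0\<close> t by (intro eventually_at_left_real) auto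
    then have "\<forall>\<^sub>F s in at_left t. norm (y s - v s) \<le> \<eta>"
      by eventually_elim (use yv t in auto)
    then have yv_left: "norm (left_lim y t - left_lim v t) \<le> \<eta>"
      by (rule Lim_norm_ubound[rotated 2])
        (auto intro!: tendsto_intros cadlag_paths_left_lim(2)[OF y t'] cadlag_paths_left_lim(2)[OF v t'])
    from ev have "\<forall>\<^sub>F s in at_left t. norm (v s - left_lim v u) \<le> d"
      by eventually_elim (use v_near t in auto)
    then have v_left: "norm (left_lim v t - left_lim v u) \<le> d"
      by (rule Lim_norm_ubound[rotated 2])
        (auto intro!: tendsto_intros cadlag_paths_left_lim(2)[OF v t'])
    have "d_infty u (restrict x {0..u}) (path_minus (v 0) u v) t z (path_minus (y 0) t y) \<le> 3 * d + 3 * d + (u - t)"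
    proof (rule d_infty_le)
      show "norm (restrict x {0..u} s - z (min s t)) \<le> 3 * d" if s: "s \<in> {0..u}" for s
      proof (cases "s \<le> t")
        case True
        then have "norm (z s - x s) \<le> \<eta>"
          using zx s by auto
        then show ?thesis
          using True s \<eta>(4) \<open>d > 0\<close> by (simp add: norm_minus_commute)
      next
        case False
        then have "norm (x s - x u) \<le> d" "norm (x t - x u) \<le> d" "norm (z t - x t) \<le> d"
          using x_near[of s] x_near[of t] t s zx \<eta>(4) by force+
        moreover have "x s - z t = (x s - x u) - (x t - x u) - (z t - x t)"
          by simp
        ultimately have "norm (x s - z t) \<le> 3 * d"
          using norm_triangle_ineq4[of "(x s - x u) - (x t - x u)" "z t - x t"]
            norm_triangle_ineq4[of "x s - x u" "x t - x u"] by simp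
        then show ?thesis
          using False s by simp
      qed
      show "norm (path_minus (v 0) u v s - path_minus (y 0) t y (min s t)) \<le> 3 * d" if s: "s \<in> {0..u}" for s
      proof (cases "s < t")
        case True
        then have "norm (y s - v s) \<le> \<eta>"
          using yv s t by auto
        then show ?thesis
          using True s t \<eta>(4) \<open>d > 0\<close> by (simp add: path_minus_def norm_minus_commute)
      next
        case False
        \<comment> \<open>From \<open>t\<close> on, the shorter path is frozen at
          \<open>left_lim y t\<close>. It is compared with \<open>w\<close> through
          \<open>left_lim v t\<close> and \<open>left_lim v u\<close>, so the jump of
          \<open>v\<close> at \<open>u\<close> never enters.\<close>
        define w where "w = path_minus (v 0) u v s"
        have "norm (w - left_lim v u) \<le> d"
          using v_near[of s] s False t \<open>t > 0\<close> \<open>d > 0\<close> by (cases "s = u") (auto simp: w_def path_minus_def)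
        moreover have "w - left_lim y t = (w - left_lim v u) - (left_lim v t - left_lim v u) - (left_lim y t - left_lim v t)"
          by simp
        ultimately have "norm (w - left_lim y t) \<le> 3 * d"
          using norm_triangle_ineq4[of "(w - left_lim v u) - (left_lim v t - left_lim v u)" "left_lim y t - left_lim v t"]
            norm_triangle_ineq4[of "w - left_lim v u" "left_lim v t - left_lim v u"] yv_left v_left \<eta>(4) by simp
        moreover have "path_minus (y 0) t y (min s t) = left_lim y t"
          using False \<open>t > 0\<close> by (simp add: path_minus_def)
        ultimately show ?thesis
          by (simp add: w_def)
      qed
    qed (use t in auto)
    also have "\<dots> < \<kappa>"
      using t \<eta>(4) \<open>d > 0\<close> by (simp add: d_def)
    finally have "d_infty u (restrict x {0..u}) (path_minus (v 0) u v) (u - (u - t)) z (path_minus (y 0) t y) < \<kappa>"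
      by simp
    moreover have "path_minus (y 0) t y \<in> cadlag_paths t S"
      using t cadlag_paths_mem[OF y, of 0] u by (intro cadlag_paths_path_minus[OF y]) auto
    ultimately have "norm (G u (restrict x {0..u}) (path_minus (v 0) u v) - G t z (path_minus (y 0) t y)) < e"
      using \<kappa>(2)[of "u - t" z "path_minus (y 0) t y"] t z by auto
    moreover have "G u (restrict x {0..u}) (restrict v {0..u}) = G u (restrict x {0..u}) (path_minus (v 0) u v)"
      using u' by (intro predictable_restrict[OF pred _ _ _ xr v]) auto
    ultimately show ?thesis
      by (simp add: norm_minus_commute)
  qed
  show ?thesis
    using main \<eta>(1) by (intro exI[of _ \<eta>]) blast
qed

text \<open>Turns vague convergence into convergence of weighted sums over the subdivision; under
  the image measure, coinciding grid points add their weights.\<close>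

lemma qv_discrete_integral:
  assumes "\<And>i. i < k n \<Longrightarrow> \<tau> n i \<in> {0..T}" and g: "continuous_on {0..T} g"
  shows "(\<integral>s. g s \<partial>qv_discrete T k \<tau> f n) = (\<Sum>i<k n. g (\<tau> n i) * (f (\<tau> n (Suc i)) - f (\<tau> n i))\<^sup>2)"
proof -
  have "\<tau> n \<in> measurable (point_measure {..<k n} (\<lambda>i. ennreal ((f (\<tau> n (Suc i)) - f (\<tau> n i))\<^sup>2)))
      (restrict_space borel {0..T})"
    using assms(1) by (auto simp: measurable_def space_point_measure sets_point_measure space_restrict_space)
  then show ?thesis
    unfolding qv_discrete_def
    by (subst integral_distr[OF _ borel_measurable_continuous_on_restrict[OF g]])
      (simp_all add: lebesgue_integral_point_measure_finite mult.commute)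
qed

lemma qv_limit_qv_measure: "finite_qv T k \<tau> f \<Longrightarrow> qv_limit T k \<tau> f (qv_measure T k \<tau> f)"
  unfolding finite_qv_def qv_measure_def by (rule someI_ex)

subsection \<open>The approximating paths\<close>

locale functional_ito =
  fixes T :: real
    and U :: "(real^'d) set" and S :: "(real^'m) set"
    and x :: "real \<Rightarrow> real^'d" and v :: "real \<Rightarrow> real^'m"
    and k :: "nat \<Rightarrow> nat" and \<tau> :: "nat \<Rightarrow> nat \<Rightarrow> real"
    and F :: "(real^'d, real^'m, real) functional"
  assumes T_pos: "T > 0" and U_open: "open U"
    and x_path: "x \<in> continuous_paths T U" and v_path: "v \<in> cadlag_paths T S"
    and subdiv: "subdivisions T k \<tau>"
    and qv: "finite_qv_vec T k \<tau> x"
    and jumps: "(\<lambda>n. SUP t\<in>{0..T} - \<tau> n ` {..k n}. norm (v t - left_lim v t)) \<longlonglongrightarrow> 0"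
    and C12: "C12_functional T U S F"
    and pred: "predictable_in_second U S {0..T} F"
    and F_left: "left_continuous_functional U S {0..T} F"
    and F_diff: "vert_differentiable U S {0..T} F"
    and grad_diff: "vert_differentiable U S {0..T} (vert_grad F)"
    and hess_left: "left_continuous_functional U S {0..T} (vert_hess F)"
    and hess_bounded: "locally_bounded_functional T U S {0..T} (vert_hess F)"
    and hor_bounded: "locally_bounded_functional T U S {0..<T} (hor_deriv F)"
begin

abbreviation X :: "nat \<Rightarrow> real \<Rightarrow> real^'d" where "X \<equiv> x_approx T k \<tau> x"
abbreviation V :: "nat \<Rightarrow> real \<Rightarrow> real^'m" where "V \<equiv> v_approx T k \<tau> v"
abbreviation \<delta> :: "nat \<Rightarrow> nat \<Rightarrow> real^'d" where "\<delta> n i \<equiv> x (\<tau> n (Suc i)) - x (\<tau> n i)"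
abbreviation p :: "nat \<Rightarrow> real \<Rightarrow> real \<Rightarrow> real^'d" where "p n t \<equiv> path_minus (x 0) t (X n)"
abbreviation q :: "nat \<Rightarrow> real \<Rightarrow> real \<Rightarrow> real^'m" where "q n t \<equiv> path_minus (v 0) t (V n)"

lemma x_cadlag: "x \<in> cadlag_paths T U"
  by (rule continuous_paths_imp_cadlag[OF x_path])

lemma x_in: "t \<in> {0..T} \<Longrightarrow> x t \<in> U" and v_in: "t \<in> {0..T} \<Longrightarrow> v t \<in> S"
  using cadlag_paths_mem[OF x_cadlag] cadlag_paths_mem[OF v_path] by auto

lemma tau_0: "\<tau> n 0 = 0" and tau_k: "\<tau> n (k n) = T"
  and tau_step: "i < k n \<Longrightarrow> \<tau> n i \<le> \<tau> n (Suc i)"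
  using subdiv by (auto simp: subdivisions_def)

lemma tau_mono: "i \<le> j \<Longrightarrow> j \<le> k n \<Longrightarrow> \<tau> n i \<le> \<tau> n j"
  by (rule grid_mono[where K = "k n"]) (auto simp: tau_step)

lemma tau_in: "i \<le> k n \<Longrightarrow> \<tau> n i \<in> {0..T}"
  using tau_mono[of 0 i n] tau_mono[of i "k n" n] by (simp add: tau_0 tau_k)

lemma tau_in': "i < k n \<Longrightarrow> \<tau> n i \<in> {0..T}" "i < k n \<Longrightarrow> \<tau> n (Suc i) \<in> {0..T}"
  by (simp_all only: tau_in less_imp_le Suc_leI)

lemma mesh: "e > 0 \<Longrightarrow> \<forall>\<^sub>F n in sequentially. \<forall>i<k n. \<tau> n (Suc i) - \<tau> n i < e"
proof -
  assume "e > 0"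
  have "(\<lambda>n. Max ((\<lambda>i. \<tau> n (Suc i) - \<tau> n i) ` {..<k n})) \<longlonglongrightarrow> 0"
    using subdiv by (simp add: subdivisions_def)
  then have "\<forall>\<^sub>F n in sequentially. Max ((\<lambda>i. \<tau> n (Suc i) - \<tau> n i) ` {..<k n}) < e"
    using \<open>e > 0\<close> by (rule order_tendstoD)
  then show ?thesis
  proof eventually_elim
    case (elim n)
    show ?case
    proof (intro allI impI)
      fix i
      assume "i < k n"
      then have "\<tau> n (Suc i) - \<tau> n i \<le> Max ((\<lambda>i. \<tau> n (Suc i) - \<tau> n i) ` {..<k n})"
        by (intro Max_ge) auto
      then show "\<tau> n (Suc i) - \<tau> n i < e"
        using elim by simp
    qed
  qed
qed

lemma cell: "t \<in> {0..<T} \<Longrightarrow> \<exists>i<k n. t \<in> {\<tau> n i..<\<tau> n (Suc i)}"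
  using grid_cell_right[of t "\<tau> n" "k n"] by (simp add: tau_0 tau_k)

lemma X_eq:
  assumes "i < k n" "t \<in> {\<tau> n i..<\<tau> n (Suc i)}"
  shows "X n t = x (\<tau> n (Suc i))"
proof -
  have "t \<in> {0..<T}"
    using tau_in'[OF assms(1)] assms(2) by auto
  then show ?thesis
    using grid_sum_indicator[of "k n" "\<tau> n" i t "\<lambda>i. x (\<tau> n (Suc i))"] tau_step assms
    by (auto simp: x_approx_def)
qed

lemma V_eq:
  assumes "i < k n" "t \<in> {\<tau> n i..<\<tau> n (Suc i)}"
  shows "V n t = v (\<tau> n i)"
proof -
  have "t \<in> {0..<T}"
    using tau_in'[OF assms(1)] assms(2) by auto
  then show ?thesis
    using grid_sum_indicator[of "k n" "\<tau> n" i t "\<lambda>i. v (\<tau> n i)"] tau_step assms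
    by (auto simp: v_approx_def)
qed

lemma X_T: "X n T = x T" and V_T: "V n T = v T"
  using grid_sum_indicator_end[of "k n" "\<tau> n" "\<lambda>i. x (\<tau> n (Suc i))"]
    grid_sum_indicator_end[of "k n" "\<tau> n" "\<lambda>i. v (\<tau> n i)"] tau_step T_pos
  by (simp_all add: x_approx_def v_approx_def tau_k)

lemma X_cadlag: "X n \<in> cadlag_paths T U"
proof (rule step_path_cadlag[where \<sigma> = "\<tau> n" and K = "k n" and c = "\<lambda>i. x (\<tau> n (Suc i))"])
  have "X n t \<in> U" if t: "t \<in> {0..T}" for t
  proof (cases "t = T")
    case False
    then obtain i where "i < k n" "t \<in> {\<tau> n i..<\<tau> n (Suc i)}"
      using cell[of t n] t by auto
    then show ?thesis
      using X_eq x_in tau_in' by simp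
  qed (use x_in T_pos in \<open>auto simp: X_T\<close>)
  then show "X n \<in> {0..T} \<rightarrow>\<^sub>E U"
    by (auto simp: x_approx_def PiE_def extensional_def)
qed (simp_all only: tau_0 tau_k X_eq x_in tau_in')

lemma V_cadlag: "V n \<in> cadlag_paths T S"
proof (rule step_path_cadlag[where \<sigma> = "\<tau> n" and K = "k n" and c = "\<lambda>i. v (\<tau> n i)"])
  have "V n t \<in> S" if t: "t \<in> {0..T}" for t
  proof (cases "t = T")
    case False
    then obtain i where "i < k n" "t \<in> {\<tau> n i..<\<tau> n (Suc i)}"
      using cell[of t n] t by auto
    then show ?thesis
      using V_eq v_in tau_in' by simp
  qed (use v_in T_pos in \<open>auto simp: V_T\<close>)
  then show "V n \<in> {0..T} \<rightarrow>\<^sub>E S"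
    by (auto simp: v_approx_def PiE_def extensional_def)
qed (simp_all only: tau_0 tau_k V_eq v_in tau_in')

text \<open>Leading cells may be degenerate, but the first nondegenerate one starts at 0. The
  equality reconciles the convention \<open>v 0\<close> in \<open>q\<close> with the value
  \<open>V n 0\<close> in the predictability lemmas. \<open>X n 0\<close> is a value of
  \<open>x\<close> at a right endpoint and in general differs from \<open>x 0\<close>.\<close>

lemma V_0: "V n 0 = v 0"
proof -
  obtain i where i: "i < k n" "0 \<in> {\<tau> n i..<\<tau> n (Suc i)}"
    using cell[of 0 n] T_pos by auto
  then have "\<tau> n i = 0"
    using tau_in'(1)[OF i(1)] by auto
  then show ?thesis
    using V_eq[OF i] by simp
qed

text \<open>If subdivision points repeat, the nondegenerate cell ending at \<open>\<tau> n i\<close>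
  may have an index below \<open>i - 1\<close>. On that cell \<open>X n\<close> has the value of
  \<open>x\<close> at the right endpoint, which is \<open>\<tau> n i\<close>.\<close>

lemma X_left:
  assumes "i \<le> k n" "\<tau> n i > 0"
  shows "left_lim (X n) (\<tau> n i) = x (\<tau> n i)"
proof -
  obtain j where j: "j < i" "\<tau> n i \<in> {\<tau> n j<..\<tau> n (Suc j)}"
    using grid_cell_left[of "\<tau> n i" "\<tau> n" i] assms by (auto simp: tau_0)
  then have "\<tau> n (Suc j) = \<tau> n i"
    using tau_mono[of "Suc j" i n] assms by auto
  then have "(X n \<longlongrightarrow> x (\<tau> n i)) (at_left (\<tau> n i))"
    using step_path_left[of "\<tau> n j" "\<tau> n (Suc j)" "X n" "x (\<tau> n i)" "\<tau> n i"] X_eq[of j n] j assms by simp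
  then show ?thesis
    by (rule left_limI)
qed

lemma V_left:
  assumes "i < k n" "\<tau> n i < \<tau> n (Suc i)"
  shows "left_lim (V n) (\<tau> n (Suc i)) = v (\<tau> n i)"
  using step_path_left[of "\<tau> n i" "\<tau> n (Suc i)" "V n" "v (\<tau> n i)" "\<tau> n (Suc i)"] V_eq[of i n] assms
  by (intro left_limI) simp

lemma p_end: "i \<le> k n \<Longrightarrow> p n (\<tau> n i) (\<tau> n i) = x (\<tau> n i)"
  using X_left[of i n] tau_in[of i n] by (auto simp: path_minus_def)

lemma p_cadlag: "t \<in> {0..T} \<Longrightarrow> p n t \<in> cadlag_paths t U"
  using x_in T_pos by (intro cadlag_paths_path_minus[OF X_cadlag]) auto

lemma q_cadlag: "t \<in> {0..T} \<Longrightarrow> q n t \<in> cadlag_paths t S"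
  using v_in T_pos by (intro cadlag_paths_path_minus[OF V_cadlag]) auto

section \<open>Uniform convergence of the approximating paths\<close>

lemma x_increments:
  assumes "e > 0"
  shows "\<forall>\<^sub>F n in sequentially. \<forall>i<k n. \<forall>t\<in>{\<tau> n i..\<tau> n (Suc i)}. norm (x t - x (\<tau> n (Suc i))) \<le> e \<and> norm (\<delta> n i) \<le> e"
proof -
  have "uniformly_continuous_on {0..T} x"
    using x_path by (intro compact_uniformly_continuous) (auto simp: continuous_paths_def)
  then obtain d where d: "d > 0" "\<And>s t. s \<in> {0..T} \<Longrightarrow> t \<in> {0..T} \<Longrightarrow> dist s t < d \<Longrightarrow> dist (x s) (x t) < e"
    unfolding uniformly_continuous_on_def using assms by metis
  from mesh[OF d(1)] show ?thesis
  proof eventually_elim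
    case (elim n)
    have *: "norm (x t - x (\<tau> n (Suc i))) \<le> e" if "i < k n" "t \<in> {\<tau> n i..\<tau> n (Suc i)}" for t i
      using d(2)[of t "\<tau> n (Suc i)"] elim that tau_in'[of i n]
      by (fastforce simp: dist_norm dist_real_def)
    have "norm (\<delta> n i) \<le> e" if "i < k n" for i
      using *[of i "\<tau> n i"] that tau_step[of i n] by (simp add: norm_minus_commute)
    with * show ?case
      by blast
  qed
qed

lemma X_uniform:
  assumes "e > 0"
  shows "\<forall>\<^sub>F n in sequentially. \<forall>t\<in>{0..T}. norm (X n t - x t) \<le> e"
  using x_increments[OF assms]
proof eventually_elim
  case (elim n)
  show ?case
  proof
    fix t
    assume t: "t \<in> {0..T}"
    show "norm (X n t - x t) \<le> e"
    proof (cases "t = T")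
      case False
      then obtain i where i: "i < k n" "t \<in> {\<tau> n i..<\<tau> n (Suc i)}"
        using cell[of t n] t by auto
      then have "norm (x t - x (\<tau> n (Suc i))) \<le> e"
        using elim by auto
      then show ?thesis
        using X_eq[OF i] by (simp add: norm_minus_commute)
    qed (use assms in \<open>simp add: X_T\<close>)
  qed
qed

text \<open>A real supremum bounds its terms only over a set bounded above, which the boundedness of
  \<open>v\<close> supplies. Time 0 is a grid point, so the arbitrary \<open>left_lim v 0\<close>
  never occurs.\<close>

lemma jumps_off_grid:
  assumes "e > 0"
  shows "\<forall>\<^sub>F n in sequentially. \<forall>t\<in>{0..T} - \<tau> n ` {..k n}. norm (v t - left_lim v t) < e"
  using order_tendstoD(2)[OF jumps assms]
proof eventually_elim
  case (elim n)
  obtain B where B: "\<forall>s\<in>{0<..T}. norm (v s - left_lim v s) \<le> 2 * B"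
    using cadlag_paths_bounded[OF v_path] by blast
  have "bdd_above ((\<lambda>t. norm (v t - left_lim v t)) ` ({0..T} - \<tau> n ` {..k n}))"
  proof (rule bdd_aboveI2)
    fix t
    assume t: "t \<in> {0..T} - \<tau> n ` {..k n}"
    have "t \<noteq> 0"
      using t tau_0[of n] by force
    then show "norm (v t - left_lim v t) \<le> 2 * B"
      using B t by auto
  qed
  then show ?case
    using elim cSUP_upper by (metis (no_types, lifting) order_le_less_trans)
qed

text \<open>Inside a cell, \<open>V n\<close> holds the value of \<open>v\<close> at the left
  endpoint. All times after that endpoint up to \<open>t\<close> are off the grid, so the jump
  allowed by the modulus of \<open>v\<close> is one that the assumption on the jumps makes
  small.\<close>

lemma V_uniform:
  assumes "e > 0"
  shows "\<forall>\<^sub>F n in sequentially. \<forall>t\<in>{0..T}. norm (V n t - v t) \<le> e"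
proof -
  obtain d where d: "d > 0" "\<And>s t. 0 \<le> s \<Longrightarrow> s \<le> t \<Longrightarrow> t \<le> T \<Longrightarrow> t - s < d \<Longrightarrow>
    norm (v t - v s) \<le> e / 2 \<or> (\<exists>u. s < u \<and> u \<le> t \<and> norm (v t - v s) \<le> e / 2 + norm (v u - left_lim v u))"
    using cadlag_paths_modulus[OF v_path, of "e / 2"] assms by auto
  have "e / 2 > 0"
    using assms by simp
  from mesh[OF d(1)] jumps_off_grid[OF this] show ?thesis
  proof eventually_elim
    case (elim n)
    show ?case
    proof
      fix t
      assume t: "t \<in> {0..T}"
      show "norm (V n t - v t) \<le> e"
      proof (cases "t = T")
        case False
        then obtain i where i: "i < k n" "t \<in> {\<tau> n i..<\<tau> n (Suc i)}"
          using cell[of t n] t by auto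
        have off: "u \<notin> \<tau> n ` {..k n}" if "\<tau> n i < u" "u \<le> t" for u
        proof
          assume "u \<in> \<tau> n ` {..k n}"
          then obtain j where j: "j \<le> k n" "u = \<tau> n j"
            by auto
          show False
          proof (cases "j \<le> i")
            case True
            then show False
              using tau_mono[of j i n] i j that by simp
          next
            case False
            then show False
              using tau_mono[of "Suc i" j n] i j that by simp
          qed
        qed
        have "norm (v t - v (\<tau> n i)) \<le> e"
        proof -
          have "t - \<tau> n i < d"
            using elim(1) i by fastforce
          then have "norm (v t - v (\<tau> n i)) \<le> e / 2 \<or>
            (\<exists>u. \<tau> n i < u \<and> u \<le> t \<and> norm (v t - v (\<tau> n i)) \<le> e / 2 + norm (v u - left_lim v u))"
            using i tau_in'[OF i(1)] t by (intro d(2)) auto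
          then show ?thesis
          proof (elim disjE exE conjE)
            fix u
            assume u: "\<tau> n i < u" "u \<le> t" "norm (v t - v (\<tau> n i)) \<le> e / 2 + norm (v u - left_lim v u)"
            have "norm (v u - left_lim v u) < e / 2"
              using elim(2) off[OF u(1,2)] u t tau_in'[OF i(1)] by auto
            then show ?thesis
              using u(3) by simp
          qed (use assms in simp)
        qed
        then show ?thesis
          using V_eq[OF i] by (simp add: norm_minus_commute)
      qed (use assms in \<open>simp add: V_T\<close>)
    qed
  qed
qed

text \<open>\<open>U\<close> need not be convex. The compact image of \<open>x\<close> has a
  neighbourhood of uniform radius inside \<open>U\<close>, and the increments eventually fall below
  that radius.\<close>

lemma segment_in_U: "\<forall>\<^sub>F n in sequentially. \<forall>i<k n. \<forall>s\<in>{0..1}. x (\<tau> n i) + s *\<^sub>R \<delta> n i \<in> U"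
proof -
  have "compact (x ` {0..T})"
    using x_path by (intro compact_continuous_image) (auto simp: continuous_paths_def)
  then obtain r where r: "r > 0" "(\<Union>y\<in>x ` {0..T}. ball y r) \<subseteq> U"
    using compact_subset_open_imp_ball_epsilon_subset[of "x ` {0..T}" U] U_open x_in by blast
  have "r / 2 > 0"
    using r(1) by simp
  from x_increments[OF this] show ?thesis
  proof eventually_elim
    case (elim n)
    show ?case
    proof (intro allI impI ballI)
      fix i and s :: real
      assume i: "i < k n" and s: "s \<in> {0..1}"
      have "norm (s *\<^sub>R \<delta> n i) \<le> 1 * norm (\<delta> n i)"
        using s unfolding norm_scaleR by (intro mult_right_mono) auto
      also have "norm (\<delta> n i) \<le> r / 2"
        using elim i tau_step[OF i] by fastforce
      finally have "x (\<tau> n i) + s *\<^sub>R \<delta> n i \<in> ball (x (\<tau> n i)) r"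
        using r(1) by (simp add: dist_norm)
      then show "x (\<tau> n i) + s *\<^sub>R \<delta> n i \<in> U"
        using r(2) tau_in'(1)[OF i] by blast
    qed
  qed
qed

end

subsection \<open>Second order terms and horizontal integrals\<close>

context functional_ito begin

abbreviation xr :: "real \<Rightarrow> real \<Rightarrow> real^'d" where "xr t \<equiv> restrict x {0..t}"
abbreviation vr :: "real \<Rightarrow> real \<Rightarrow> real^'m" where "vr t \<equiv> restrict v {0..t}"
abbreviation Xr :: "nat \<Rightarrow> real \<Rightarrow> real \<Rightarrow> real^'d" where "Xr n t \<equiv> restrict (X n) {0..t}"
abbreviation Vr :: "nat \<Rightarrow> real \<Rightarrow> real \<Rightarrow> real^'m" where "Vr n t \<equiv> restrict (V n) {0..t}"

text \<open>\<open>Z n i 0\<close> is \<open>x\<^sup>n\<close> stopped just before \<open>\<tau> n i\<close>, and \<open>Z n i 1\<close> is \<open>x\<^sup>n\<close> restricted to \<open>[0, \<tau> n i]\<close>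
  when the cell is nondegenerate.\<close>

definition Z :: "nat \<Rightarrow> nat \<Rightarrow> real \<Rightarrow> real \<Rightarrow> real^'d" where
  "Z n i s = vert_pert (\<tau> n i) (s *\<^sub>R \<delta> n i) (p n (\<tau> n i))"

lemma restrict_cadlag:
  assumes "t \<in> {0..T}"
  shows "xr t \<in> cadlag_paths t U" "vr t \<in> cadlag_paths t S" "Xr n t \<in> cadlag_paths t U" "Vr n t \<in> cadlag_paths t S"
  using assms by (auto intro!: cadlag_paths_restrict x_cadlag v_path X_cadlag V_cadlag)

lemma pred_hess: "predictable_in_second U S {0..T} (vert_hess F)"
  by (rule predictable_vert_hess[OF pred U_open]) simp

lemma Z_cadlag: "\<forall>\<^sub>F n in sequentially. \<forall>i<k n. \<forall>s\<in>{0..1}. Z n i s \<in> cadlag_paths (\<tau> n i) U"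
  using segment_in_U
proof eventually_elim
  case (elim n)
  show ?case
  proof (intro allI impI ballI)
    fix i and s :: real
    assume i: "i < k n" and s: "s \<in> {0..1}"
    show "Z n i s \<in> cadlag_paths (\<tau> n i) U"
      unfolding Z_def
    proof (rule cadlag_paths_vert_pert[OF p_cadlag])
      show "p n (\<tau> n i) (\<tau> n i) + s *\<^sub>R \<delta> n i \<in> U"
        using elim i s p_end[of i n] by simp
    qed (use tau_in'[OF i] in auto)
  qed
qed

lemma Z_close:
  assumes "e > 0"
  shows "\<forall>\<^sub>F n in sequentially. \<forall>i<k n. \<forall>s\<in>{0..1}. \<forall>r\<in>{0..\<tau> n i}. norm (Z n i s r - x r) \<le> e"
  using x_increments[OF assms] X_uniform[OF assms]
proof eventually_elim
  case (elim n)
  show ?case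
  proof (intro allI impI ballI)
    fix i and s r :: real
    assume i: "i < k n" and s: "s \<in> {0..1}" and r: "r \<in> {0..\<tau> n i}"
    show "norm (Z n i s r - x r) \<le> e"
    proof (cases "r = \<tau> n i")
      case True
      have "norm (s *\<^sub>R \<delta> n i) \<le> 1 * norm (\<delta> n i)"
        using s unfolding norm_scaleR by (intro mult_right_mono) auto
      also have "norm (\<delta> n i) \<le> e"
        using elim(1) i tau_step[OF i] by fastforce
      finally show ?thesis
        using True p_end[of i n] i r by (simp add: Z_def vert_pert_def)
    next
      case False
      then have "Z n i s r = X n r"
        using r by (auto simp: Z_def vert_pert_def path_minus_def)
      then show ?thesis
        using elim(2) r tau_in'[OF i] by auto
    qed
  qed
qed

lemma hess_q:
  assumes "t \<in> {0..T}" "z \<in> cadlag_paths t U"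
  shows "vert_hess F t z (Vr n t) = vert_hess F t z (q n t)"
  using predictable_restrict[OF pred_hess assms(1) _ _ assms(2) V_cadlag[of n]] assms(1) by (simp add: V_0)

lemma hess_bound:
  "\<exists>C>0. (\<forall>u\<in>{0..T}. norm (vert_hess F u (xr u) (vr u)) \<le> C) \<and>
    (\<forall>\<^sub>F n in sequentially. \<forall>i<k n. \<forall>s\<in>{0..1}. norm (vert_hess F (\<tau> n i) (Z n i s) (q n (\<tau> n i))) \<le> C)"
proof -
  obtain C \<eta> where C: "C > 0" "\<eta> > 0" "\<forall>t\<in>{0..T}. \<forall>x'\<in>cadlag_paths t U. \<forall>v'\<in>cadlag_paths t S.
      d_infty t (xr t) (vr t) t x' v' < \<eta> \<longrightarrow> norm (vert_hess F t x' v') \<le> C"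
    using hess_bounded x_cadlag v_path unfolding locally_bounded_functional_def by blast
  have "norm (vert_hess F u (xr u) (vr u)) \<le> C" if u: "u \<in> {0..T}" for u
  proof -
    have "d_infty u (xr u) (vr u) u (xr u) (vr u) \<le> 0 + 0 + (u - u)"
      using u by (intro d_infty_le) auto
    then show ?thesis
      using C restrict_cadlag[OF u] u by auto
  qed
  moreover have "\<eta> / 4 > 0"
    using C(2) by simp
  from Z_cadlag Z_close[OF this] V_uniform[OF this]
  have "\<forall>\<^sub>F n in sequentially. \<forall>i<k n. \<forall>s\<in>{0..1}. norm (vert_hess F (\<tau> n i) (Z n i s) (q n (\<tau> n i))) \<le> C"
  proof eventually_elim
    case (elim n)
    show ?case
    proof (intro allI impI ballI)
      fix i and s :: real
      assume i: "i < k n" and s: "s \<in> {0..1}"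
      note t = tau_in'(1)[OF i]
      have z: "Z n i s \<in> cadlag_paths (\<tau> n i) U"
        using elim(1) i s by blast
      \<comment> \<open>Closeness is measured with \<open>Vr\<close>, not with \<open>q\<close>:
        where \<open>v\<close> jumps at a grid point, \<open>q\<close> still has the value before
        the jump and may stay away from \<open>v\<close>. \<open>hess_q\<close> exchanges the two
        afterwards.\<close>
      have "d_infty (\<tau> n i) (xr (\<tau> n i)) (vr (\<tau> n i)) (\<tau> n i) (Z n i s) (Vr n (\<tau> n i))
          \<le> \<eta> / 4 + \<eta> / 4 + (\<tau> n i - \<tau> n i)"
        using t elim(2,3) i s by (intro d_infty_le) (auto simp: norm_minus_commute)
      also have "\<dots> < \<eta>"
        using C(2) by simp
      finally have "norm (vert_hess F (\<tau> n i) (Z n i s) (Vr n (\<tau> n i))) \<le> C"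
        using C(3) t z restrict_cadlag(4)[OF t] by blast
      then show "norm (vert_hess F (\<tau> n i) (Z n i s) (q n (\<tau> n i))) \<le> C"
        using hess_q[OF t z] by simp
    qed
  qed
  ultimately show ?thesis
    using C(1) by blast
qed

text \<open>Supplies the left limit hypothesis of the weighted sum lemma. Both halves are instances
  of left continuity along paths, with \<open>(x, v)\<close> itself and with
  \<open>(Z n i s, V n)\<close> as nearby paths. The estimate is uniform in \<open>s\<close>, since
  the Taylor points are arbitrary elements of \<open>[0, 1]\<close>.\<close>

lemma hess_left_convergence:
  assumes u: "u \<in> {0<..T}" and "e > 0"
  shows "\<exists>\<eta>>0. \<exists>M. (\<forall>t\<in>{0..T}. u - \<eta> < t \<and> t \<le> u \<longrightarrow>
      norm (vert_hess F t (xr t) (vr t) - vert_hess F u (xr u) (vr u)) \<le> e) \<and>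
    (\<forall>n\<ge>M. \<forall>i<k n. \<forall>s\<in>{0..1}. u - \<eta> < \<tau> n i \<and> \<tau> n i \<le> u \<longrightarrow>
      norm (vert_hess F (\<tau> n i) (Z n i s) (q n (\<tau> n i)) - vert_hess F u (xr u) (vr u)) \<le> e)"
proof -
  obtain \<eta> where \<eta>: "\<eta> > 0" "\<And>t y z. t \<in> {0..T} \<Longrightarrow> u - \<eta> < t \<Longrightarrow> t \<le> u \<Longrightarrow> z \<in> cadlag_paths t U \<Longrightarrow>
     y \<in> cadlag_paths T S \<Longrightarrow> \<forall>s\<in>{0..t}. norm (z s - x s) \<le> \<eta> \<Longrightarrow> \<forall>s\<in>{0..T}. norm (y s - v s) \<le> \<eta> \<Longrightarrow>
     norm (vert_hess F t z (path_minus (y 0) t y) - vert_hess F u (xr u) (vr u)) < e"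
    using left_continuous_along_paths[OF hess_left pred_hess x_path v_path assms] by blast
  have 1: "norm (vert_hess F t (xr t) (vr t) - vert_hess F u (xr u) (vr u)) \<le> e"
    if t: "t \<in> {0..T}" "u - \<eta> < t" "t \<le> u" for t
    using \<eta>(2)[OF t restrict_cadlag(1)[OF t(1)] v_path] \<eta>(1)
      predictable_restrict[OF pred_hess t(1) _ _ restrict_cadlag(1)[OF t(1)] v_path] t by auto
  have "\<forall>\<^sub>F n in sequentially. \<forall>i<k n. \<forall>s\<in>{0..1}. u - \<eta> < \<tau> n i \<and> \<tau> n i \<le> u \<longrightarrow>
      norm (vert_hess F (\<tau> n i) (Z n i s) (q n (\<tau> n i)) - vert_hess F u (xr u) (vr u)) \<le> e"
    using Z_cadlag Z_close[OF \<eta>(1)] V_uniform[OF \<eta>(1)]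
  proof eventually_elim
    case (elim n)
    show ?case
    proof (intro allI impI ballI)
      fix i and s :: real
      assume i: "i < k n" and s: "s \<in> {0..1}" and t: "u - \<eta> < \<tau> n i \<and> \<tau> n i \<le> u"
      have z: "Z n i s \<in> cadlag_paths (\<tau> n i) U"
        using elim(1) i s by blast
      have "norm (vert_hess F (\<tau> n i) (Z n i s) (path_minus (V n 0) (\<tau> n i) (V n)) - vert_hess F u (xr u) (vr u)) < e"
        using elim(2,3) i s t by (intro \<eta>(2) tau_in' z V_cadlag) auto
      then show "norm (vert_hess F (\<tau> n i) (Z n i s) (q n (\<tau> n i)) - vert_hess F u (xr u) (vr u)) \<le> e"
        by (simp add: V_0)
    qed
  qed
  then obtain M where "\<forall>n\<ge>M. \<forall>i<k n. \<forall>s\<in>{0..1}. u - \<eta> < \<tau> n i \<and> \<tau> n i \<le> u \<longrightarrow>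
      norm (vert_hess F (\<tau> n i) (Z n i s) (q n (\<tau> n i)) - vert_hess F u (xr u) (vr u)) \<le> e"
    unfolding eventually_sequentially by blast
  then show ?thesis
    using 1 \<eta>(1) by blast
qed

text \<open>\<open>f\<close> is kept general because an off-diagonal entry of the Hessian is
  integrated against the quadratic variations of two coordinates and of their sum.\<close>

lemma hess_qv_convergence:
  assumes f: "finite_qv T k \<tau> f" and s: "\<And>n i. s n i \<in> {0..1}"
  shows "integrable (qv_measure T k \<tau> f) (\<lambda>u. vert_hess F u (xr u) (vr u) $ j $ l)"
    and "(\<lambda>n. \<Sum>i<k n. vert_hess F (\<tau> n i) (Z n i (s n i)) (q n (\<tau> n i)) $ j $ l * (f (\<tau> n (Suc i)) - f (\<tau> n i))\<^sup>2)
      \<longlonglongrightarrow> (\<integral>u. vert_hess F u (xr u) (vr u) $ j $ l \<partial>qv_measure T k \<tau> f)"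
proof -
  define h where "h u = vert_hess F u (xr u) (vr u) $ j $ l" for u
  define a where "a n i = vert_hess F (\<tau> n i) (Z n i (s n i)) (q n (\<tau> n i)) $ j $ l" for n i
  define w where "w n i = (f (\<tau> n (Suc i)) - f (\<tau> n i))\<^sup>2" for n i
  have entry: "\<bar>A $ j $ l\<bar> \<le> norm A" for A :: "real^'d^'d"
  proof -
    have "norm (A $ j $ l) \<le> norm (A $ j)" "norm (A $ j) \<le> norm A"
      by (rule Finite_Cartesian_Product.norm_nth_le)+
    then show ?thesis
      by simp
  qed
  obtain C N where C: "\<And>u. u \<in> {0..T} \<Longrightarrow> norm (vert_hess F u (xr u) (vr u)) \<le> C"
    "\<And>n i s. n \<ge> N \<Longrightarrow> i < k n \<Longrightarrow> s \<in> {0..1} \<Longrightarrow> norm (vert_hess F (\<tau> n i) (Z n i s) (q n (\<tau> n i))) \<le> C"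
    using hess_bound unfolding eventually_sequentially by blast
  define \<xi> where "\<xi> = qv_measure T k \<tau> f"
  have lim: "sets \<xi> = sets (restrict_space borel {0..T})" "finite_measure \<xi>"
    "\<And>s. s \<in> {0..T} \<Longrightarrow> emeasure \<xi> {s} = 0"
    "\<And>g::real \<Rightarrow> real. continuous_on {0..T} g \<Longrightarrow>
        (\<lambda>n. \<integral>s. g s \<partial>qv_discrete T k \<tau> f n) \<longlonglongrightarrow> (\<integral>s. g s \<partial>\<xi>)"
    using qv_limit_qv_measure[OF f] unfolding qv_limit_def \<xi>_def by blast+
  have conv: "(\<lambda>n. \<Sum>i<k n. g (\<tau> n i) * w n i) \<longlonglongrightarrow> (\<integral>s. g s \<partial>\<xi>)" if g: "continuous_on {0..T} g"
    for g :: "real \<Rightarrow> real"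
    using lim(4)[OF g] qv_discrete_integral[where k = k and \<tau> = \<tau> and T = T and f = f, OF tau_in'(1) g] unfolding w_def by simp
  have left: "\<exists>\<eta>>0. \<exists>M. (\<forall>t\<in>{0..T}. u - \<eta> < t \<and> t \<le> u \<longrightarrow> \<bar>h t - h u\<bar> \<le> e) \<and>
       (\<forall>n\<ge>M. \<forall>i<k n. u - \<eta> < \<tau> n i \<and> \<tau> n i \<le> u \<longrightarrow> \<bar>a n i - h u\<bar> \<le> e)"
    if u: "u \<in> {0<..T}" and "e > 0" for u e
  proof -
    obtain \<eta> M where \<eta>: "\<eta> > 0" "\<And>t. t \<in> {0..T} \<Longrightarrow> u - \<eta> < t \<Longrightarrow> t \<le> u \<Longrightarrow>
        norm (vert_hess F t (xr t) (vr t) - vert_hess F u (xr u) (vr u)) \<le> e"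
      "\<And>n i s. n \<ge> M \<Longrightarrow> i < k n \<Longrightarrow> s \<in> {0..1} \<Longrightarrow> u - \<eta> < \<tau> n i \<Longrightarrow> \<tau> n i \<le> u \<Longrightarrow>
        norm (vert_hess F (\<tau> n i) (Z n i s) (q n (\<tau> n i)) - vert_hess F u (xr u) (vr u)) \<le> e"
      using hess_left_convergence[OF u \<open>e > 0\<close>] by blast
    have "\<bar>h t - h u\<bar> \<le> e" if "t \<in> {0..T}" "u - \<eta> < t" "t \<le> u" for t
      using \<eta>(2)[OF that] entry[of "vert_hess F t (xr t) (vr t) - vert_hess F u (xr u) (vr u)"]
      by (simp add: h_def)
    moreover have "\<bar>a n i - h u\<bar> \<le> e" if "n \<ge> M" "i < k n" "u - \<eta> < \<tau> n i" "\<tau> n i \<le> u" for n i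
      using \<eta>(3)[OF that(1,2) s[of n i] that(3,4)]
        entry[of "vert_hess F (\<tau> n i) (Z n i (s n i)) (q n (\<tau> n i)) - vert_hess F u (xr u) (vr u)"]
      by (simp add: h_def a_def)
    ultimately show ?thesis
      using \<eta>(1) by blast
  qed
  have h_le: "\<bar>h u\<bar> \<le> C" if "u \<in> {0..T}" for u
    using entry C(1)[OF that] unfolding h_def by (rule order_trans)
  have a_le: "\<bar>a n i\<bar> \<le> C" if "n \<ge> N" "i < k n" for n i
    using entry C(2)[OF that s[of n i]] unfolding a_def by (rule order_trans)
  have "w n i \<ge> 0" for n i
    by (simp add: w_def)
  note * = weighted_sum_tendsto_integral[OF T_pos lim(1-3) conv this tau_in'(1) h_le a_le left]
  show "integrable (qv_measure T k \<tau> f) (\<lambda>u. vert_hess F u (xr u) (vr u) $ j $ l)"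
    using *(1) by (simp add: h_def[abs_def] \<xi>_def)
  show "(\<lambda>n. \<Sum>i<k n. vert_hess F (\<tau> n i) (Z n i (s n i)) (q n (\<tau> n i)) $ j $ l * (f (\<tau> n (Suc i)) - f (\<tau> n i))\<^sup>2)
      \<longlonglongrightarrow> (\<integral>u. vert_hess F u (xr u) (vr u) $ j $ l \<partial>qv_measure T k \<tau> f)"
    using *(2) by (simp add: h_def[abs_def] a_def w_def \<xi>_def)
qed

lemma hess_qvar_integrable: "qvar_integrable T k \<tau> x j l (\<lambda>u. vert_hess F u (xr u) (vr u) $ a $ b)"
  using qv hess_qv_convergence(1)[where s = "\<lambda>_ _. 0" and j = a and l = b]
  by (auto simp: qvar_integrable_def finite_qv_vec_def)

text \<open>Polarization: the product of two increments is half of the square of their sum minus the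
  two squares, and the three sums of squares converge separately with the same coefficients.\<close>

lemma hess_qvar_convergence:
  assumes s: "\<And>n i. s n i \<in> {0..1}"
  shows "(\<lambda>n. \<Sum>i<k n. vert_hess F (\<tau> n i) (Z n i (s n i)) (q n (\<tau> n i)) $ j $ l * (\<delta> n i $ j * \<delta> n i $ l))
      \<longlonglongrightarrow> qvar_integral T k \<tau> x j l (\<lambda>u. vert_hess F u (xr u) (vr u) $ j $ l)"
proof -
  have fj: "finite_qv T k \<tau> (\<lambda>s. x s $ a)" for a
    using qv by (simp add: finite_qv_vec_def)
  have conv: "(\<lambda>n. \<Sum>i<k n. vert_hess F (\<tau> n i) (Z n i (s n i)) (q n (\<tau> n i)) $ j $ l * (f (\<tau> n (Suc i)) - f (\<tau> n i))\<^sup>2)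
      \<longlonglongrightarrow> (\<integral>u. vert_hess F u (xr u) (vr u) $ j $ l \<partial>qv_measure T k \<tau> f)"
    if "finite_qv T k \<tau> f" for f
    by (rule hess_qv_convergence(2)[OF that s])
  show ?thesis
  proof (cases "j = l")
    case True
    then show ?thesis
      using conv[OF fj[of l]] by (simp add: qvar_integral_def power2_eq_square)
  next
    case False
    then have fjl: "finite_qv T k \<tau> (\<lambda>s. x s $ j + x s $ l)"
      using qv by (simp add: finite_qv_vec_def)
    define a where "a n i = vert_hess F (\<tau> n i) (Z n i (s n i)) (q n (\<tau> n i)) $ j $ l" for n i
    have "(\<lambda>n. ((\<Sum>i<k n. a n i * ((x (\<tau> n (Suc i)) $ j + x (\<tau> n (Suc i)) $ l) - (x (\<tau> n i) $ j + x (\<tau> n i) $ l))\<^sup>2)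
        - (\<Sum>i<k n. a n i * (x (\<tau> n (Suc i)) $ j - x (\<tau> n i) $ j)\<^sup>2)
        - (\<Sum>i<k n. a n i * (x (\<tau> n (Suc i)) $ l - x (\<tau> n i) $ l)\<^sup>2)) / 2)
      \<longlonglongrightarrow> qvar_integral T k \<tau> x j l (\<lambda>u. vert_hess F u (xr u) (vr u) $ j $ l)"
      using False unfolding qvar_integral_def a_def
      by (simp only: if_False) (intro tendsto_intros conv[OF fjl] conv[OF fj]; simp)
    moreover have "((\<Sum>i<k n. a n i * ((x (\<tau> n (Suc i)) $ j + x (\<tau> n (Suc i)) $ l) - (x (\<tau> n i) $ j + x (\<tau> n i) $ l))\<^sup>2)
        - (\<Sum>i<k n. a n i * (x (\<tau> n (Suc i)) $ j - x (\<tau> n i) $ j)\<^sup>2)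
        - (\<Sum>i<k n. a n i * (x (\<tau> n (Suc i)) $ l - x (\<tau> n i) $ l)\<^sup>2)) / 2
      = (\<Sum>i<k n. a n i * (\<delta> n i $ j * \<delta> n i $ l))" for n
      unfolding sum_subtractf[symmetric] sum_divide_distrib
      by (intro sum.cong refl) (simp add: power2_eq_square field_simps)
    ultimately show ?thesis
      by (simp add: a_def)
  qed
qed

text \<open>On a cell both step paths are constant, so their restrictions to \<open>[0, u]\<close>
  are horizontal extensions of those to \<open>[0, \<tau> n i]\<close> and each cell contributes an
  integral of \<open>hor_deriv F\<close>. Local boundedness around \<open>(x, v)\<close> gives one
  bound \<open>C\<close> for all large \<open>n\<close>, and continuity at fixed times gives
  pointwise convergence on \<open>[0, T)\<close>.\<close>

lemma hor_sum:
  "\<forall>\<^sub>F n in sequentially. set_integrable lborel {0..<T} (\<lambda>u. hor_deriv F u (Xr n u) (Vr n u)) \<and>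
     (LBINT u:{0..<T}. hor_deriv F u (Xr n u) (Vr n u)) =
     (\<Sum>i<k n. F (\<tau> n (Suc i)) (hor_ext (\<tau> n i) (\<tau> n (Suc i) - \<tau> n i) (Xr n (\<tau> n i)))
          (hor_ext (\<tau> n i) (\<tau> n (Suc i) - \<tau> n i) (Vr n (\<tau> n i)))
        - F (\<tau> n i) (Xr n (\<tau> n i)) (Vr n (\<tau> n i)))"
  and hor_limit: "set_integrable lborel {0..<T} (\<lambda>u. hor_deriv F u (xr u) (vr u))"
  "(\<lambda>n. LBINT u:{0..<T}. hor_deriv F u (Xr n u) (Vr n u)) \<longlonglongrightarrow> (LBINT u:{0..<T}. hor_deriv F u (xr u) (vr u))"
proof -
  define h where "h n u = hor_deriv F u (Xr n u) (Vr n u)" for n u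
  obtain C \<eta> where C: "C > 0" "\<eta> > 0" "\<forall>t\<in>{0..<T}. \<forall>x'\<in>cadlag_paths t U. \<forall>v'\<in>cadlag_paths t S.
      d_infty t (xr t) (vr t) t x' v' < \<eta> \<longrightarrow> norm (hor_deriv F t x' v') \<le> C"
    using hor_bounded x_cadlag v_path unfolding locally_bounded_functional_def by blast
  have close: "\<forall>\<^sub>F n in sequentially. \<forall>t\<in>{0..T}. d_infty t (xr t) (vr t) t (Xr n t) (Vr n t) < e"
    if "e > 0" for e :: real
  proof -
    have "e / 4 > 0"
      using that by simp
    from X_uniform[OF this] V_uniform[OF this] show ?thesis
    proof eventually_elim
      case (elim n)
      show ?case
      proof
        fix t
        assume t: "t \<in> {0..T}"
        have "d_infty t (xr t) (vr t) t (Xr n t) (Vr n t) \<le> e / 4 + e / 4 + (t - t)"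
          using t elim by (intro d_infty_le) (auto simp: norm_minus_commute)
        also have "\<dots> < e"
          using that by simp
        finally show "d_infty t (xr t) (vr t) t (Xr n t) (Vr n t) < e" .
      qed
    qed
  qed
  have bound: "\<forall>\<^sub>F n in sequentially. \<forall>u\<in>{0..<T}. \<bar>h n u\<bar> \<le> C"
    using close[OF C(2)]
  proof eventually_elim
    case (elim n)
    show ?case
    proof
      fix u
      assume u: "u \<in> {0..<T}"
      then have u': "u \<in> {0..T}"
        by simp
      show "\<bar>h n u\<bar> \<le> C"
        using C(3) elim u u' restrict_cadlag(3,4)[OF u', of n] unfolding h_def real_norm_def by blast
    qed
  qed
  have cells: "set_integrable lborel {0..<T} (h n) \<and> (LBINT u:{0..<T}. h n u) =
     (\<Sum>i<k n. F (\<tau> n (Suc i)) (hor_ext (\<tau> n i) (\<tau> n (Suc i) - \<tau> n i) (Xr n (\<tau> n i)))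
          (hor_ext (\<tau> n i) (\<tau> n (Suc i) - \<tau> n i) (Vr n (\<tau> n i)))
        - F (\<tau> n i) (Xr n (\<tau> n i)) (Vr n (\<tau> n i)))"
    if n: "\<forall>u\<in>{0..<T}. \<bar>h n u\<bar> \<le> C" for n
  proof -
    define c where "c i = F (\<tau> n (Suc i)) (hor_ext (\<tau> n i) (\<tau> n (Suc i) - \<tau> n i) (Xr n (\<tau> n i)))
          (hor_ext (\<tau> n i) (\<tau> n (Suc i) - \<tau> n i) (Vr n (\<tau> n i)))
        - F (\<tau> n i) (Xr n (\<tau> n i)) (Vr n (\<tau> n i))" for i
    have "set_integrable lborel {0..<\<tau> n j} (h n) \<and> (LBINT u:{0..<\<tau> n j}. h n u) = (\<Sum>i<j. c i)" if "j \<le> k n" for j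
      using that
    proof (induction j)
      case 0
      then show ?case
        by (simp add: tau_0 set_integrable_def set_lebesgue_integral_def)
    next
      case (Suc i)
      then have i: "i < k n"
        by simp
      note t = tau_in'[OF i]
      have ext: "hor_ext (\<tau> n i) (u - \<tau> n i) (Xr n (\<tau> n i)) = Xr n u"
        "hor_ext (\<tau> n i) (u - \<tau> n i) (Vr n (\<tau> n i)) = Vr n u" if u: "u \<in> {\<tau> n i..<\<tau> n (Suc i)}" for u
      proof -
        have eq: "X n s = X n (\<tau> n i)" "V n s = V n (\<tau> n i)" if "\<tau> n i < s" "s \<le> u" for s
          using X_eq[OF i, of s] X_eq[OF i, of "\<tau> n i"] V_eq[OF i, of s] V_eq[OF i, of "\<tau> n i"] that u by auto
        show "hor_ext (\<tau> n i) (u - \<tau> n i) (Xr n (\<tau> n i)) = Xr n u"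
        proof
          fix s
          show "hor_ext (\<tau> n i) (u - \<tau> n i) (Xr n (\<tau> n i)) s = Xr n u s"
            using eq(1)[of s] u t by (cases "s \<le> \<tau> n i") (simp_all add: hor_ext_def)
        qed
        show "hor_ext (\<tau> n i) (u - \<tau> n i) (Vr n (\<tau> n i)) = Vr n u"
        proof
          fix s
          show "hor_ext (\<tau> n i) (u - \<tau> n i) (Vr n (\<tau> n i)) s = Vr n u s"
            using eq(2)[of s] u t by (cases "s \<le> \<tau> n i") (simp_all add: hor_ext_def)
        qed
      qed
      have "hor_differentiable U S {0..<T} F"
        using C12 by (simp add: C12_functional_def)
      note I = hor_derivative_integral[OF F_left this restrict_cadlag(3)[OF t(1), of n] restrict_cadlag(4)[OF t(1), of n],
          of "\<tau> n (Suc i)" C]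
      have b: "\<bar>hor_deriv F u (hor_ext (\<tau> n i) (u - \<tau> n i) (Xr n (\<tau> n i))) (hor_ext (\<tau> n i) (u - \<tau> n i) (Vr n (\<tau> n i)))\<bar> \<le> C"
        if "u \<in> {\<tau> n i..<\<tau> n (Suc i)}" for u
        using n that t unfolding ext[OF that] h_def by auto
      have int: "set_integrable lborel {\<tau> n i..<\<tau> n (Suc i)} (h n)"
        using I(1)[OF _ tau_step[OF i] _ b] t
        by (subst set_integrable_cong[OF refl refl]) (auto simp: ext h_def)
      have val: "(LBINT u:{\<tau> n i..<\<tau> n (Suc i)}. h n u) = c i"
        using I(2)[OF _ tau_step[OF i] _ b] t
        by (subst set_lebesgue_integral_cong) (auto simp: ext h_def c_def)
      have IH: "set_integrable lborel {0..<\<tau> n i} (h n)" "(LBINT u:{0..<\<tau> n i}. h n u) = (\<Sum>i<i. c i)"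
        using Suc by auto
      have un: "{0..<\<tau> n (Suc i)} = {0..<\<tau> n i} \<union> {\<tau> n i..<\<tau> n (Suc i)}"
        using t tau_step[OF i] by auto
      show ?case
        unfolding un using IH int val
        by (auto intro!: set_integrable_Un simp: set_integral_Un)
    qed
    from this[of "k n"] show ?thesis
      by (simp add: tau_k c_def)
  qed
  show "\<forall>\<^sub>F n in sequentially. set_integrable lborel {0..<T} (\<lambda>u. hor_deriv F u (Xr n u) (Vr n u)) \<and>
     (LBINT u:{0..<T}. hor_deriv F u (Xr n u) (Vr n u)) =
     (\<Sum>i<k n. F (\<tau> n (Suc i)) (hor_ext (\<tau> n i) (\<tau> n (Suc i) - \<tau> n i) (Xr n (\<tau> n i)))
          (hor_ext (\<tau> n i) (\<tau> n (Suc i) - \<tau> n i) (Vr n (\<tau> n i)))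
        - F (\<tau> n i) (Xr n (\<tau> n i)) (Vr n (\<tau> n i)))"
    using bound by eventually_elim (use cells in \<open>simp add: h_def[abs_def]\<close>)
  obtain N where N: "\<And>n. n \<ge> N \<Longrightarrow> \<forall>u\<in>{0..<T}. \<bar>h n u\<bar> \<le> C"
    using bound unfolding eventually_sequentially by blast
  \<comment> \<open>The shift by \<open>N\<close> makes the domination by \<open>C\<close> hold for
    every index; \<open>LIMSEQ_offset\<close> undoes it at the end.\<close>
  define H where "H n u = indicator {0..<T} u *\<^sub>R h (n + N) u" for n u
  have H_meas: "H n \<in> borel_measurable lborel" for n
    using cells[OF N[of "n + N"]] unfolding set_integrable_def H_def by (auto dest: borel_measurable_integrable)
  have pointwise: "(\<lambda>n. h n u) \<longlonglongrightarrow> hor_deriv F u (xr u) (vr u)" if u: "u \<in> {0..<T}" for u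
  proof (rule tendstoI)
    fix e :: real
    assume "e > 0"
    have u': "u \<in> {0..T}"
      using u by simp
    have "continuous_at_fixed_times U S {0..<T} (hor_deriv F)"
      using C12 by (simp add: C12_functional_def)
    then have "\<exists>\<kappa>>0. \<forall>x'\<in>cadlag_paths u U. \<forall>v'\<in>cadlag_paths u S.
        d_infty u (xr u) (vr u) u x' v' < \<kappa> \<longrightarrow> norm (hor_deriv F u (xr u) (vr u) - hor_deriv F u x' v') < e"
      using u restrict_cadlag(1,2)[OF u'] \<open>e > 0\<close> unfolding continuous_at_fixed_times_def by blast
    then obtain \<kappa> where \<kappa>: "\<kappa> > 0" "\<forall>x'\<in>cadlag_paths u U. \<forall>v'\<in>cadlag_paths u S.
        d_infty u (xr u) (vr u) u x' v' < \<kappa> \<longrightarrow> norm (hor_deriv F u (xr u) (vr u) - hor_deriv F u x' v') < e"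
      by blast
    from close[OF \<kappa>(1)] show "\<forall>\<^sub>F n in sequentially. dist (h n u) (hor_deriv F u (xr u) (vr u)) < e"
    proof eventually_elim
      case (elim n)
      then have "norm (hor_deriv F u (xr u) (vr u) - h n u) < e"
        using \<kappa>(2) restrict_cadlag(3,4)[OF u', of n] u' unfolding h_def by blast
      then show ?case
        by (simp add: dist_norm norm_minus_commute)
    qed
  qed
  have H_lim: "(\<lambda>n. H n u) \<longlonglongrightarrow> indicator {0..<T} u *\<^sub>R hor_deriv F u (xr u) (vr u)" for u
    using LIMSEQ_ignore_initial_segment[OF pointwise, of u N] by (cases "u \<in> {0..<T}") (auto simp: H_def)
  have H_le: "norm (H n u) \<le> indicator {0..<T} u *\<^sub>R C" for n u
    using N[of "n + N"] by (auto simp: H_def indicator_def)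
  have dom: "integrable lborel (\<lambda>u. indicator {0..<T} u *\<^sub>R C)"
    using T_pos by (intro integrable_scaleR_left) (auto simp: integrable_indicator_iff)
  have meas: "(\<lambda>u. indicator {0..<T} u *\<^sub>R hor_deriv F u (xr u) (vr u)) \<in> borel_measurable lborel"
    using borel_measurable_LIMSEQ_metric[OF H_meas H_lim] .
  show "set_integrable lborel {0..<T} (\<lambda>u. hor_deriv F u (xr u) (vr u))"
    unfolding set_integrable_def
    by (intro integrable_dominated_convergence[where s = H, OF meas H_meas dom] AE_I2 H_lim H_le)
  have "(\<lambda>n. integral\<^sup>L lborel (H n)) \<longlonglongrightarrow> (LBINT u:{0..<T}. hor_deriv F u (xr u) (vr u))"
    unfolding set_lebesgue_integral_def
    by (intro integral_dominated_convergence[where s = H, OF meas H_meas dom] AE_I2 H_lim H_le)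
  then have "(\<lambda>n. LBINT u:{0..<T}. h (n + N) u) \<longlonglongrightarrow> (LBINT u:{0..<T}. hor_deriv F u (xr u) (vr u))"
    by (simp add: H_def[abs_def] set_lebesgue_integral_def)
  then show "(\<lambda>n. LBINT u:{0..<T}. hor_deriv F u (Xr n u) (Vr n u)) \<longlonglongrightarrow> (LBINT u:{0..<T}. hor_deriv F u (xr u) (vr u))"
    unfolding h_def by (rule LIMSEQ_offset)
qed

end

subsection \<open>Passage to the limit\<close>

context functional_ito begin

text \<open>Over a nondegenerate cell, the extension of \<open>Xr n (\<tau> n i)\<close> to the next
  grid point is exactly the path stopped before that point, because the left limit there continues
  the constant value. Adding the full increment to the stopped path at \<open>\<tau> n i\<close>
  yields \<open>Xr n (\<tau> n i)\<close>, and predictability removes the jump of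
  \<open>V n\<close>. On a degenerate cell both brackets vanish.\<close>

lemma increment_decomposition:
  assumes i: "i < k n" and Z: "Z n i 1 \<in> cadlag_paths (\<tau> n i) U"
  shows "F (\<tau> n (Suc i)) (p n (\<tau> n (Suc i))) (q n (\<tau> n (Suc i))) - F (\<tau> n i) (p n (\<tau> n i)) (q n (\<tau> n i)) =
    (F (\<tau> n (Suc i)) (hor_ext (\<tau> n i) (\<tau> n (Suc i) - \<tau> n i) (Xr n (\<tau> n i)))
        (hor_ext (\<tau> n i) (\<tau> n (Suc i) - \<tau> n i) (Vr n (\<tau> n i)))
      - F (\<tau> n i) (Xr n (\<tau> n i)) (Vr n (\<tau> n i))) +
    (F (\<tau> n i) (Z n i 1) (q n (\<tau> n i)) - F (\<tau> n i) (p n (\<tau> n i)) (q n (\<tau> n i)))"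
proof (cases "\<tau> n i = \<tau> n (Suc i)")
  case True
  then have "Z n i 1 = p n (\<tau> n i)"
    using vert_pert_0[OF p_cadlag[OF tau_in'(1)[OF i]]] by (simp add: Z_def)
  then show ?thesis
    using True hor_ext_0[OF restrict_cadlag(3)[OF tau_in'(1)[OF i]]] hor_ext_0[OF restrict_cadlag(4)[OF tau_in'(1)[OF i]]]
    by simp
next
  case False
  then have lt: "\<tau> n i < \<tau> n (Suc i)"
    using tau_step[OF i] by simp
  note t = tau_in'[OF i]
  have X: "X n s = x (\<tau> n (Suc i))" and V: "V n s = v (\<tau> n i)" if "\<tau> n i \<le> s" "s < \<tau> n (Suc i)" for s
    using X_eq[OF i] V_eq[OF i] that by auto
  have left: "left_lim (X n) (\<tau> n (Suc i)) = x (\<tau> n (Suc i))" "left_lim (V n) (\<tau> n (Suc i)) = v (\<tau> n i)"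
    using X_left[of "Suc i" n] V_left[OF i lt] i lt t by auto
  have 1: "hor_ext (\<tau> n i) (\<tau> n (Suc i) - \<tau> n i) (Xr n (\<tau> n i)) = p n (\<tau> n (Suc i))"
  proof
    fix s
    show "hor_ext (\<tau> n i) (\<tau> n (Suc i) - \<tau> n i) (Xr n (\<tau> n i)) s = p n (\<tau> n (Suc i)) s"
      using X[of s] X[of "\<tau> n i"] left lt t
      by (cases "s \<le> \<tau> n i"; cases "s < \<tau> n (Suc i)") (simp_all add: hor_ext_def path_minus_def)
  qed
  have 2: "hor_ext (\<tau> n i) (\<tau> n (Suc i) - \<tau> n i) (Vr n (\<tau> n i)) = q n (\<tau> n (Suc i))"
  proof
    fix s
    show "hor_ext (\<tau> n i) (\<tau> n (Suc i) - \<tau> n i) (Vr n (\<tau> n i)) s = q n (\<tau> n (Suc i)) s"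
      using V[of s] V[of "\<tau> n i"] left lt t
      by (cases "s \<le> \<tau> n i"; cases "s < \<tau> n (Suc i)") (simp_all add: hor_ext_def path_minus_def)
  qed
  have 3: "Z n i 1 = Xr n (\<tau> n i)"
  proof
    fix s
    show "Z n i 1 s = Xr n (\<tau> n i) s"
      using X[of "\<tau> n i"] lt p_end[of i n] i
      by (cases "s = \<tau> n i") (auto simp: Z_def vert_pert_def path_minus_def restrict_def)
  qed
  have "F (\<tau> n i) (Xr n (\<tau> n i)) (Vr n (\<tau> n i)) = F (\<tau> n i) (Xr n (\<tau> n i)) (q n (\<tau> n i))"
    using predictable_restrict[OF pred t(1) _ _ restrict_cadlag(3)[OF t(1)] V_cadlag[of n], of n] t
    by (simp add: V_0)
  then show ?thesis
    unfolding 1 2 3 by simp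
qed

text \<open>Left continuity along paths is used with \<open>t = u = T\<close>: the stopped paths
  miss a possible jump of \<open>v\<close> at \<open>T\<close>, which predictability renders
  harmless.\<close>

lemma terminal_convergence: "(\<lambda>n. F T (p n T) (q n T)) \<longlonglongrightarrow> F T (xr T) (vr T)"
proof (rule tendstoI)
  fix e :: real
  assume "e > 0"
  have "T \<in> {0<..T}"
    using T_pos by simp
  from left_continuous_along_paths[OF F_left pred x_path v_path this \<open>e > 0\<close>]
  obtain \<eta> where \<eta>: "\<eta> > 0" "\<And>t y z. t \<in> {0..T} \<Longrightarrow> T - \<eta> < t \<Longrightarrow> t \<le> T \<Longrightarrow> z \<in> cadlag_paths t U \<Longrightarrow>
     y \<in> cadlag_paths T S \<Longrightarrow> \<forall>s\<in>{0..t}. norm (z s - x s) \<le> \<eta> \<Longrightarrow> \<forall>s\<in>{0..T}. norm (y s - v s) \<le> \<eta> \<Longrightarrow>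
     norm (F t z (path_minus (y 0) t y) - F T (xr T) (vr T)) < e"
    by blast
  from X_uniform[OF \<eta>(1)] V_uniform[OF \<eta>(1)]
  show "\<forall>\<^sub>F n in sequentially. dist (F T (p n T) (q n T)) (F T (xr T) (vr T)) < e"
  proof eventually_elim
    case (elim n)
    have "norm (p n T s - x s) \<le> \<eta>" if "s \<in> {0..T}" for s
      using elim(1) that p_end[of "k n" n] \<eta>(1)
      by (cases "s = T") (auto simp: tau_k path_minus_def)
    then have "norm (F T (p n T) (path_minus (V n 0) T (V n)) - F T (xr T) (vr T)) < e"
      using elim(2) \<eta>(1) T_pos by (intro \<eta>(2) p_cadlag V_cadlag) auto
    then show ?case
      by (simp add: V_0 dist_norm)
  qed
qed

lemma inner_matrix_vector_mult:
  fixes A :: "real^'d^'d"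
  shows "y \<bullet> (A *v y) = (\<Sum>j\<in>UNIV. \<Sum>l\<in>UNIV. A $ j $ l * (y $ j * y $ l))"
  by (simp add: inner_vec_def matrix_vector_mult_def sum_distrib_left ac_simps)

lemma follmer_sum_decomposition:
  "\<exists>s. (\<forall>n i. s n i \<in> {0..1}) \<and> (\<forall>\<^sub>F n in sequentially.
     F T (p n T) (q n T) - F 0 (xr 0) (vr 0) - (LBINT u:{0..<T}. hor_deriv F u (Xr n u) (Vr n u))
     - (1 / 2) * (\<Sum>j\<in>UNIV. \<Sum>l\<in>UNIV. \<Sum>i<k n.
         vert_hess F (\<tau> n i) (Z n i (s n i)) (q n (\<tau> n i)) $ j $ l * (\<delta> n i $ j * \<delta> n i $ l))
     = follmer_sum T k \<tau> F x v n)"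
proof -
  define E where "E n i s \<longleftrightarrow> F (\<tau> n i) (Z n i 1) (q n (\<tau> n i)) - F (\<tau> n i) (p n (\<tau> n i)) (q n (\<tau> n i)) =
    vert_grad F (\<tau> n i) (p n (\<tau> n i)) (q n (\<tau> n i)) \<bullet> \<delta> n i
    + (1 / 2) * (\<delta> n i \<bullet> (vert_hess F (\<tau> n i) (Z n i s) (q n (\<tau> n i)) *v \<delta> n i))" for n i s
  \<comment> \<open>The default 0 keeps \<open>s n i\<close> in \<open>[0, 1]\<close> for all
    indices, as the convergence lemmas require, while a Taylor point is guaranteed only for large
    \<open>n\<close> and \<open>i < k n\<close>.\<close>
  define s where "s n i = (if \<exists>s\<in>{0..1}. E n i s then SOME s. s \<in> {0..1} \<and> E n i s else 0)" for n i
  have s: "s n i \<in> {0..1::real}" "(\<exists>s\<in>{0..1}. E n i s) \<Longrightarrow> E n i (s n i)" for n i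
    using someI_ex[of "\<lambda>s. s \<in> {0..1} \<and> E n i s"] by (auto simp: s_def Bex_def)
  have taylor: "\<forall>\<^sub>F n in sequentially. \<forall>i<k n. E n i (s n i)"
    using segment_in_U
  proof eventually_elim
    case (elim n)
    show ?case
    proof (intro allI impI s(2))
      fix i
      assume i: "i < k n"
      have "\<exists>s\<in>{0..1}. F (\<tau> n i) (vert_pert (\<tau> n i) (\<delta> n i) (p n (\<tau> n i))) (q n (\<tau> n i))
          - F (\<tau> n i) (p n (\<tau> n i)) (q n (\<tau> n i)) =
        vert_grad F (\<tau> n i) (p n (\<tau> n i)) (q n (\<tau> n i)) \<bullet> \<delta> n i + (1 / 2) * (\<delta> n i \<bullet>
          (vert_hess F (\<tau> n i) (vert_pert (\<tau> n i) (s *\<^sub>R \<delta> n i) (p n (\<tau> n i))) (q n (\<tau> n i)) *v \<delta> n i))"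
        using tau_in'[OF i] elim i p_end[of i n]
        by (intro vert_taylor[OF F_diff grad_diff] p_cadlag q_cadlag) auto
      then show "\<exists>s\<in>{0..1}. E n i s"
        by (simp add: E_def Z_def)
    qed
  qed
  have "\<forall>\<^sub>F n in sequentially.
     F T (p n T) (q n T) - F 0 (xr 0) (vr 0) - (LBINT u:{0..<T}. hor_deriv F u (Xr n u) (Vr n u))
     - (1 / 2) * (\<Sum>j\<in>UNIV. \<Sum>l\<in>UNIV. \<Sum>i<k n.
         vert_hess F (\<tau> n i) (Z n i (s n i)) (q n (\<tau> n i)) $ j $ l * (\<delta> n i $ j * \<delta> n i $ l))
     = follmer_sum T k \<tau> F x v n"
    using taylor hor_sum Z_cadlag
  proof eventually_elim
    case (elim n)
    define G where "G i = F (\<tau> n i) (p n (\<tau> n i)) (q n (\<tau> n i))" for i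
    define A where "A i = vert_hess F (\<tau> n i) (Z n i (s n i)) (q n (\<tau> n i))" for i
    \<comment> \<open>The conventions at time 0 make the initial term exact for every
      \<open>n\<close>.\<close>
    have "p n 0 = xr 0" "q n 0 = vr 0"
      by (auto simp: path_minus_def restrict_def)
    then have "F T (p n T) (q n T) - F 0 (xr 0) (vr 0) = G (k n) - G 0"
      by (simp add: G_def tau_0 tau_k)
    also have "\<dots> = (\<Sum>i<k n. G (Suc i) - G i)"
      by (rule sum_lessThan_telescope[symmetric])
    also have "\<dots> = (LBINT u:{0..<T}. hor_deriv F u (Xr n u) (Vr n u))
        + (\<Sum>i<k n. F (\<tau> n i) (Z n i 1) (q n (\<tau> n i)) - F (\<tau> n i) (p n (\<tau> n i)) (q n (\<tau> n i)))"
      unfolding conjunct2[OF elim(2)] sum.distrib[symmetric] G_def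
      using elim(3) by (intro sum.cong refl increment_decomposition) auto
    also have "(\<Sum>i<k n. F (\<tau> n i) (Z n i 1) (q n (\<tau> n i)) - F (\<tau> n i) (p n (\<tau> n i)) (q n (\<tau> n i))) =
        (\<Sum>i<k n. vert_grad F (\<tau> n i) (p n (\<tau> n i)) (q n (\<tau> n i)) \<bullet> \<delta> n i + (1 / 2) * (\<delta> n i \<bullet> (A i *v \<delta> n i)))"
      using elim(1) by (intro sum.cong refl) (auto simp: E_def A_def)
    also have "\<dots> = follmer_sum T k \<tau> F x v n + (1 / 2) * (\<Sum>i<k n. \<delta> n i \<bullet> (A i *v \<delta> n i))"
      by (simp only: sum.distrib sum_distrib_left[symmetric] follmer_sum_def)
    also have "(\<Sum>i<k n. \<delta> n i \<bullet> (A i *v \<delta> n i)) = (\<Sum>j\<in>UNIV. \<Sum>l\<in>UNIV. \<Sum>i<k n. A i $ j $ l * (\<delta> n i $ j * \<delta> n i $ l))"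
      unfolding inner_matrix_vector_mult by (subst sum.swap, intro sum.cong refl, rule sum.swap)
    finally show ?case
      unfolding A_def by linarith
  qed
  then show ?thesis
    using s(1) by blast
qed

lemma follmer_sum_convergence:
  "follmer_sum T k \<tau> F x v \<longlonglongrightarrow> F T (xr T) (vr T) - F 0 (xr 0) (vr 0)
     - (LBINT u:{0..<T}. hor_deriv F u (xr u) (vr u))
     - trace_qvar_integral T k \<tau> x (\<lambda>u. (1 / 2) *\<^sub>R vert_hess F u (xr u) (vr u))"
proof -
  obtain s where s: "\<And>n i. s n i \<in> {0..1}" and ev: "\<forall>\<^sub>F n in sequentially.
     F T (p n T) (q n T) - F 0 (xr 0) (vr 0) - (LBINT u:{0..<T}. hor_deriv F u (Xr n u) (Vr n u))
     - (1 / 2) * (\<Sum>j\<in>UNIV. \<Sum>l\<in>UNIV. \<Sum>i<k n.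
         vert_hess F (\<tau> n i) (Z n i (s n i)) (q n (\<tau> n i)) $ j $ l * (\<delta> n i $ j * \<delta> n i $ l))
     = follmer_sum T k \<tau> F x v n"
    using follmer_sum_decomposition by blast
  have half: "qvar_integral T k \<tau> x j l (\<lambda>u. (1 / 2) * f u) = (1 / 2) * qvar_integral T k \<tau> x j l f" for j l f
    by (simp add: qvar_integral_def)
  have trace: "trace_qvar_integral T k \<tau> x (\<lambda>u. (1 / 2) *\<^sub>R vert_hess F u (xr u) (vr u)) =
      (1 / 2) * (\<Sum>j\<in>UNIV. \<Sum>l\<in>UNIV. qvar_integral T k \<tau> x j l (\<lambda>u. vert_hess F u (xr u) (vr u) $ j $ l))"
    unfolding trace_qvar_integral_def sum_distrib_left by (simp only: vector_scaleR_component real_scaleR_def half)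
  have "(\<lambda>n. F T (p n T) (q n T) - F 0 (xr 0) (vr 0) - (LBINT u:{0..<T}. hor_deriv F u (Xr n u) (Vr n u))
     - (1 / 2) * (\<Sum>j\<in>UNIV. \<Sum>l\<in>UNIV. \<Sum>i<k n.
         vert_hess F (\<tau> n i) (Z n i (s n i)) (q n (\<tau> n i)) $ j $ l * (\<delta> n i $ j * \<delta> n i $ l)))
    \<longlonglongrightarrow> F T (xr T) (vr T) - F 0 (xr 0) (vr 0) - (LBINT u:{0..<T}. hor_deriv F u (xr u) (vr u))
     - (1 / 2) * (\<Sum>j\<in>UNIV. \<Sum>l\<in>UNIV. qvar_integral T k \<tau> x j l (\<lambda>u. vert_hess F u (xr u) (vr u) $ j $ l))"
    by (intro tendsto_diff tendsto_mult tendsto_sum tendsto_const terminal_convergence hor_limit(2)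
        hess_qvar_convergence[OF s])
  then show ?thesis
    unfolding trace using ev by (rule Lim_transform_eventually)
qed

end

theorem theorem3:
  fixes T :: real
    and U :: "(real^'d) set" and S :: "(real^'m) set"
    and x :: "real \<Rightarrow> real^'d" and v :: "real \<Rightarrow> real^'m"
    and k :: "nat \<Rightarrow> nat" and \<tau> :: "nat \<Rightarrow> nat \<Rightarrow> real"
    and F :: "(real^'d, real^'m, real) functional"
  assumes "T > 0" and "open U" and "S \<in> sets borel"
    and "x \<in> continuous_paths T U" and "v \<in> cadlag_paths T S"
    and "subdivisions T k \<tau>"
    and "finite_qv_vec T k \<tau> x"
    and "(\<lambda>n. SUP t\<in>{0..T} - \<tau> n ` {..k n}. norm (v t - left_lim v t)) \<longlonglongrightarrow> 0"
    and "C12_functional T U S F"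
    and "predictable_in_second U S {0..T} F"
    and "left_continuous_functional U S {0..T} F"
    and "vert_differentiable U S {0..T} F"
    and "left_continuous_functional U S {0..T} (vert_grad F)"
    and "vert_differentiable U S {0..T} (vert_grad F)"
    and "left_continuous_functional U S {0..T} (vert_hess F)"
    and "locally_bounded_functional T U S {0..T} (vert_hess F)"
    and "locally_bounded_functional T U S {0..<T} (hor_deriv F)"
  shows "convergent (follmer_sum T k \<tau> F x v)
    \<and> set_integrable lborel {0..<T}
        (\<lambda>u. hor_deriv F u (restrict x {0..u}) (restrict v {0..u}))
    \<and> (\<forall>i j. qvar_integrable T k \<tau> x i j
        (\<lambda>u. vert_hess F u (restrict x {0..u}) (restrict v {0..u}) $ i $ j))
    \<and> F T (restrict x {0..T}) (restrict v {0..T}) - F 0 (restrict x {0..0}) (restrict v {0..0}) =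
        (LBINT u:{0..<T}. hor_deriv F u (restrict x {0..u}) (restrict v {0..u}))
        + trace_qvar_integral T k \<tau> x
            (\<lambda>u. (1/2) *\<^sub>R vert_hess F u (restrict x {0..u}) (restrict v {0..u}))
        + follmer_integral T k \<tau> F x v"
proof -
  interpret functional_ito T U S x v k \<tau> F
    using assms by unfold_locales
  have "follmer_integral T k \<tau> F x v = F T (xr T) (vr T) - F 0 (xr 0) (vr 0)
     - (LBINT u:{0..<T}. hor_deriv F u (xr u) (vr u))
     - trace_qvar_integral T k \<tau> x (\<lambda>u. (1 / 2) *\<^sub>R vert_hess F u (xr u) (vr u))"
    unfolding follmer_integral_def by (rule limI[OF follmer_sum_convergence])
  then show ?thesis
    using convergentI[OF follmer_sum_convergence] hor_limit(1) hess_qvar_integrable by simp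
qed

end
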